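(* There exist infinitely many disjoint optimally intersective realizations of the alternating group $A_5$ over $\mathbb{Q}$; that is, there is an infinite family of Galois extensions $K/\mathbb{Q}$, linearly disjoint over $\mathbb{Q}$, each of which is an optimally intersective realization of $A_5$.
   Context: A monic polynomial $f\in\mathbb{Z}[x]$ is called intersective if it has a root modulo $m$ for every positive integer $m$ and it has no rational root. For a finite noncyclic group $G$, let $s(G)$ be the smallest number $m$ for which there exist proper subgroups $H_1,\dots,H_m$ of $G$ such that the union of all conjugates of the $H_i$ is $G$ and the intersection of all these conjugates is trivial. An intersective polynomial $f(x)$ with Galois group $G$ over $\mathbb{Q}$ is called optimally intersective for $G$ if it is the product of exactly $s(G)$ irreducible factors over $\mathbb{Q}$. A Galois extension $K/\mathbb{Q}$ with Galois group $G$ is an optimally intersective realization of $G$ if it is the splitting field over $\mathbb{Q}$ of a polynomial that is optimally intersective for $G$. A family of finite Galois extensions of $\mathbb{Q}$ is linearly disjoint over $\mathbb{Q}$ if each member intersects the compositum of any finitely many other members in $\mathbb{Q}$. *)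

theory Defs
  imports Complex_Main "HOL-Algebra.Algebra" "HOL-Algebra.Algebraic_Closure_Type"
begin

definition intersective :: "int poly \<Rightarrow> bool" where
  "intersective f \<longleftrightarrow>
     Polynomial.lead_coeff f = 1 \<and>
     (\<forall>m::int. m > 0 \<longrightarrow> (\<exists>x::int. m dvd poly f x)) \<and>
     \<not> (\<exists>q::rat. poly (map_poly of_int f) q = 0)"

definition conjugates :: "('a, 'b) monoid_scheme \<Rightarrow> 'a set \<Rightarrow> 'a set set" where
  "conjugates G H = {g <#\<^bsub>G\<^esub> H #>\<^bsub>G\<^esub> inv\<^bsub>G\<^esub> g | g. g \<in> carrier G}"

text \<open>The number $s(G)$. It is meaningful for finite noncyclic groups only; for other groups
  a suitable \<open>m\<close> need not exist.\<close>
definition covering_number :: "('a, 'b) monoid_scheme \<Rightarrow> nat" where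
  "covering_number G = (LEAST m. \<exists>H :: nat \<Rightarrow> 'a set.
     (\<forall>i\<in>{1..m}. subgroup (H i) G \<and> H i \<noteq> carrier G) \<and>
     \<Union>(\<Union>i\<in>{1..m}. conjugates G (H i)) = carrier G \<and>
     \<Inter>(\<Union>i\<in>{1..m}. conjugates G (H i)) = {\<one>\<^bsub>G\<^esub>})"

text \<open>All number fields are taken inside the complex numbers; there the base field of rational
  numbers is the set \<open>\<rat>\<close>, and \<^const>\<open>generate_field\<close> always contains it because a subfield
  contains \<open>1\<close>.\<close>
abbreviation CC :: "complex ring" where
  "CC \<equiv> ring_of_type_algebra"

text \<open>Automorphisms are extensional functions, so that each one is counted once.\<close>
definition galois_group :: "complex set \<Rightarrow> (complex \<Rightarrow> complex) monoid" where
  "galois_group K = BijGroup K \<lparr>carrier :=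
     {\<sigma> \<in> Bij K. \<sigma> \<in> ring_hom (CC\<lparr>carrier := K\<rparr>) (CC\<lparr>carrier := K\<rparr>) \<and> (\<forall>q\<in>\<rat>. \<sigma> q = q)}\<rparr>"

definition finite_galois_extension :: "complex set \<Rightarrow> bool" where
  "finite_galois_extension K \<longleftrightarrow>
     subfield K CC \<and> ring.finite_dimension CC \<rat> K \<and>
     {x \<in> K. \<forall>\<sigma> \<in> carrier (galois_group K). \<sigma> x = x} = \<rat>"

definition splitting_field :: "int poly \<Rightarrow> complex set" where
  "splitting_field f = generate_field CC {z. poly (map_poly of_int f) z = 0}"

text \<open>Irreducible factors over the rationals are counted with multiplicity.\<close>
definition optimally_intersective :: "('a, 'b) monoid_scheme \<Rightarrow> int poly \<Rightarrow> bool" where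
  "optimally_intersective G f \<longleftrightarrow>
     intersective f \<and> galois_group (splitting_field f) \<cong> G \<and>
     (\<exists>ps :: rat poly list. length ps = covering_number G \<and>
        (\<forall>p\<in>set ps. Factorial_Ring.irreducible p) \<and> prod_list ps = map_poly of_int f)"

definition optimally_intersective_realization ::
    "('a, 'b) monoid_scheme \<Rightarrow> complex set \<Rightarrow> bool" where
  "optimally_intersective_realization G K \<longleftrightarrow>
     finite_galois_extension K \<and> galois_group K \<cong> G \<and>
     (\<exists>f. optimally_intersective G f \<and> K = splitting_field f)"

definition compositum :: "complex set set \<Rightarrow> complex set" where
  "compositum F = generate_field CC (\<Union>F)"

definition linearly_disjoint :: "complex set set \<Rightarrow> bool" where
  "linearly_disjoint \<K> \<longleftrightarrow>
     (\<forall>K\<in>\<K>. \<forall>F. finite F \<and> F \<subseteq> \<K> - {K} \<longrightarrow> K \<inter> compositum F = \<rat>)"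

end

theory Submission
  imports Defs "Jordan_Normal_Form.Char_Poly" "HOL-Number_Theory.Number_Theory"
begin

text \<open>For \<open>w \<equiv> 10 (mod 60)\<close> and \<open>a = 1 - 3125 w\<^sup>4\<close> the quintic \<open>x\<^sup>5 + a x + 4 a w\<close> has the square
  discriminant \<open>(16 a\<^sup>2)\<^sup>2\<close>, so its Galois group consists of even permutations. Its sextic resolvent
  \<open>x\<^sup>6 - 5 a x\<^sup>4 + 15 a\<^sup>2 x\<^sup>2 - 16 a\<^sup>2 x + 5 a\<^sup>3\<close> has the root
  \<open>x\<^sub>1x\<^sub>2 + x\<^sub>2x\<^sub>3 + x\<^sub>3x\<^sub>4 + x\<^sub>4x\<^sub>5 + x\<^sub>5x\<^sub>1\<close>, which is fixed by a five-cycle. An even permutation of five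
  points that fixes none of them is a five-cycle; applied to Frobenius elements, this shows that the
  product of the two polynomials has a root modulo every power of a prime not dividing \<open>2 a\<close>; the
  remaining primes yield to Hensel's lemma, for instance at \<open>p\<close> dividing \<open>a\<close> with a root of the resolvent
  close to \<open>5 a / 16\<close>. Both factors are irreducible, hence
  30 divides the order of the Galois group, which leaves only \<open>A\<^sub>5\<close>; and the covering number of \<open>A\<^sub>5\<close>
  is two. As \<open>A\<^sub>5\<close> is simple and nonabelian, distinct fields of the family are linearly disjoint, and
  infinitely many distinct ones arise because a prime exactly dividing \<open>a\<close> ramifies.\<close>

section \<open>Algebraic integers\<close>

text \<open>The two factors mirror a cover of A5 by subgroups: a root of the quintic has stabilizer
  A4, a root of the sextic has stabilizer D5, and every element of A5 lies in a conjugate of one of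
  the two. By itself the cover gives roots modulo unramified primes only, and this shapes the
  family. Since 10 divides \<open>w\<close>, the primes 2 and 5 divide \<open>w\<close>, and 0 is a
  simple root of the quintic modulo every prime dividing \<open>w\<close>. Modulo 3 the quintic
  becomes x^5 - x - 1, which is irreducible. That \<open>w\<close> is 2 modulo 4 fixes
  \<open>a\<close> modulo 256, which excludes linear factors of the sextic, a task for which the
  modulus 3 fails. Galois theory is done inside the field of all algebraic numbers: automorphisms of
  normal subfields are restrictions of automorphisms of that one field, so different fields can be
  compared directly. Likewise congruences are taken modulo a prime ideal of the ring of all
  algebraic integers, so that no ring of integers of a number field and no decomposition group has
  to be formed.\<close>

text \<open>The equations make \<open>x\<close> an eigenvalue of the integer matrix
  \<open>c\<close>, with the nonzero vector \<open>v\<close> as eigenvector, so \<open>x\<close> is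
  a root of the characteristic polynomial, which is monic and integral.\<close>

lemma algebraic_int_if_preserves_span:
  fixes x :: complex and v :: "nat \<Rightarrow> complex" and c :: "nat \<Rightarrow> nat \<Rightarrow> int"
  assumes eq: "\<And>i. i < n \<Longrightarrow> x * v i = (\<Sum>j<n. of_int (c i j) * v j)"
    and nz: "i0 < n" "v i0 \<noteq> 0"
  shows "algebraic_int x"
proof -
  define A where "A = mat n n (\<lambda>(i,j). c i j)"
  define B :: "complex mat" where "B = map_mat of_int A"
  have A: "A \<in> carrier_mat n n" and B: "B \<in> carrier_mat n n"
    by (auto simp: A_def B_def)
  have "B *\<^sub>v vec n v = x \<cdot>\<^sub>v vec n v"
  proof (rule eq_vecI)
    fix i assume "i < dim_vec (x \<cdot>\<^sub>v vec n v)"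
    then have i: "i < n" by simp
    have "(B *\<^sub>v vec n v) $ i = (\<Sum>j<n. of_int (c i j) * v j)"
      using i by (auto simp: B_def A_def scalar_prod_def atLeast0LessThan intro!: sum.cong)
    then show "(B *\<^sub>v vec n v) $ i = (x \<cdot>\<^sub>v vec n v) $ i"
      using i eq[OF i] by simp
  qed (use B in auto)
  moreover have "vec n v \<noteq> 0\<^sub>v n"
  proof
    assume "vec n v = 0\<^sub>v n"
    then have "vec n v $ i0 = 0\<^sub>v n $ i0" by simp
    with nz show False by simp
  qed
  ultimately have "eigenvalue B x"
    unfolding eigenvalue_def eigenvector_def using B by (intro exI[of _ "vec n v"]) auto
  then have "poly (char_poly B) x = 0"
    using eigenvalue_root_char_poly[OF B] by simp
  moreover have "char_poly B = map_poly of_int (char_poly A)"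
    unfolding B_def by (rule of_int_hom.char_poly_hom[OF A])
  moreover have "Polynomial.lead_coeff (char_poly A) = 1"
    using degree_monic_char_poly[OF A] by simp
  ultimately show ?thesis
    unfolding algebraic_int_altdef_ipoly by metis
qed

text \<open>The integer span of the monomials \<open>x ^ i * y ^ j\<close> with i < m and j < n is
  stable under multiplication by \<open>x\<close> and by \<open>y\<close>, because the monic
  relations rewrite \<open>x ^ m\<close> and \<open>y ^ n\<close>. Hence it is stable under
  \<open>x + y\<close> and \<open>x * y\<close>, and the eigenvalue criterion applies.\<close>

lemma algebraic_int_plus_times:
  fixes x y :: complex
  assumes "algebraic_int x" "algebraic_int y"
  shows "algebraic_int (x + y)" "algebraic_int (x * y)"
proof -
  obtain p where p: "poly (map_poly of_int p) x = 0" "Polynomial.lead_coeff p = 1"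
    using assms(1) unfolding algebraic_int_altdef_ipoly by blast
  obtain q where q: "poly (map_poly of_int q) y = 0" "Polynomial.lead_coeff q = 1"
    using assms(2) unfolding algebraic_int_altdef_ipoly by blast
  define m where "m = Polynomial.degree p"
  define n where "n = Polynomial.degree q"
  have lead: "\<exists>e. t ^ Polynomial.degree r = (\<Sum>k<Polynomial.degree r. of_int (e k) * t ^ k)"
    if "poly (map_poly of_int r) t = 0" "Polynomial.lead_coeff r = 1" for r and t :: complex
  proof
    have "0 = (\<Sum>k\<le>Polynomial.degree r. of_int (Polynomial.coeff r k) * t ^ k)"
      using that(1) by (simp add: poly_altdef degree_map_poly coeff_map_poly)
    also have "\<dots> = t ^ Polynomial.degree r
        + (\<Sum>k<Polynomial.degree r. of_int (Polynomial.coeff r k) * t ^ k)"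
      using that(2) by (simp add: lessThan_Suc_atMost[symmetric])
    finally show "t ^ Polynomial.degree r
        = (\<Sum>k<Polynomial.degree r. of_int (- Polynomial.coeff r k) * t ^ k)"
      by (simp add: sum_negf algebra_simps add_eq_0_iff)
  qed
  obtain d where d: "x ^ m = (\<Sum>k<m. of_int (d k) * x ^ k)"
    using lead[OF p] by (auto simp: m_def)
  obtain e where e: "y ^ n = (\<Sum>k<n. of_int (e k) * y ^ k)"
    using lead[OF q] by (auto simp: n_def)
  have m: "m > 0" using d by (cases m) auto
  have n: "n > 0" using e by (cases n) auto
  \<comment> \<open>The exponent pair (i, j) is coded as the single index i * n + j, so that the
    span is indexed by k < m * n.\<close>
  define v where "v k = x ^ (k div n) * y ^ (k mod n)" for k
  define S where "S = {\<Sum>k<m*n. of_int (c k) * v k | c :: nat \<Rightarrow> int. True}"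
  have S_add: "s + t \<in> S" if "s \<in> S" "t \<in> S" for s t
  proof -
    obtain c c' where "s = (\<Sum>k<m*n. of_int (c k) * v k)" "t = (\<Sum>k<m*n. of_int (c' k) * v k)"
      using \<open>s \<in> S\<close> \<open>t \<in> S\<close> unfolding S_def by blast
    then have "s + t = (\<Sum>k<m*n. of_int (c k + c' k) * v k)"
      by (simp add: sum.distrib algebra_simps)
    then show ?thesis unfolding S_def by (intro CollectI exI[of _ "\<lambda>k. c k + c' k"]) simp
  qed
  have S_mult: "of_int z * s \<in> S" if "s \<in> S" for s z
  proof -
    obtain c where "s = (\<Sum>k<m*n. of_int (c k) * v k)"
      using \<open>s \<in> S\<close> unfolding S_def by blast
    then have "of_int z * s = (\<Sum>k<m*n. of_int (z * c k) * v k)"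
      by (simp add: sum_distrib_left algebra_simps)
    then show ?thesis unfolding S_def by (intro CollectI exI[of _ "\<lambda>k. z * c k"]) simp
  qed
  have S_0: "0 \<in> S" unfolding S_def by (rule CollectI, rule exI[of _ "\<lambda>_. 0"]) simp
  have S_sum: "(\<Sum>k\<in>K. of_int (c k) * f k) \<in> S" if "\<And>k. k \<in> K \<Longrightarrow> f k \<in> S"
    for K :: "nat set" and c :: "nat \<Rightarrow> int" and f
    using that by (induction K rule: infinite_finite_induct) (auto simp: S_0 intro!: S_add S_mult)
  have S_gen: "v k \<in> S" if "k < m * n" for k
  proof -
    have "(\<Sum>j<m*n. of_int (if j = k then 1 else 0) * v j) = (\<Sum>j<m*n. if j = k then v j else 0)"
      by (rule sum.cong) auto
    also have "\<dots> = v k"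
      using that by simp
    finally show ?thesis
      unfolding S_def by (intro CollectI exI[of _ "\<lambda>j. if j = k then 1 else 0"]) auto
  qed
  have S_mono: "x ^ i * y ^ j \<in> S" if "i < m" "j < n" for i j
  proof -
    have "i * n + j < m * n"
      using that mult_le_mono1[of "Suc i" m n] by simp
    moreover have "v (i * n + j) = x ^ i * y ^ j"
      using that n by (simp add: v_def)
    ultimately show ?thesis using S_gen by metis
  qed
  have S_x: "x * s \<in> S" if "s \<in> S" for s
  proof -
    have "x * v k \<in> S" if "k < m * n" for k
    proof -
      have j: "k mod n < n" and i: "k div n < m"
        using n that by (auto simp: less_mult_imp_div_less)
      show ?thesis
      proof (cases "Suc (k div n) < m")
        case True
        then show ?thesis using S_mono[OF True j] by (simp add: v_def mult.assoc)
      next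
        case False
        then have "Suc (k div n) = m" using i by simp
        then have "x * v k = x ^ m * y ^ (k mod n)"
          by (simp add: v_def flip: power_Suc)
        also have "\<dots> = (\<Sum>i<m. of_int (d i) * (x ^ i * y ^ (k mod n)))"
          unfolding d sum_distrib_right by (rule sum.cong) (auto simp: algebra_simps)
        also have "\<dots> \<in> S" by (rule S_sum) (use S_mono j in auto)
        finally show ?thesis .
      qed
    qed
    then have "(\<Sum>k<m*n. of_int (c k) * (x * v k)) \<in> S" for c
      by (intro S_sum) simp
    moreover obtain c where "s = (\<Sum>k<m*n. of_int (c k) * v k)"
      using \<open>s \<in> S\<close> unfolding S_def by blast
    then have "x * s = (\<Sum>k<m*n. of_int (c k) * (x * v k))"
      by (simp add: sum_distrib_left algebra_simps)
    ultimately show ?thesis by metis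
  qed
  have S_y: "y * s \<in> S" if "s \<in> S" for s
  proof -
    have "y * v k \<in> S" if "k < m * n" for k
    proof -
      have j: "k mod n < n" and i: "k div n < m"
        using n that by (auto simp: less_mult_imp_div_less)
      show ?thesis
      proof (cases "Suc (k mod n) < n")
        case True
        then show ?thesis using S_mono[OF i True] by (simp add: v_def algebra_simps)
      next
        case False
        then have "Suc (k mod n) = n" using j by simp
        then have "y * v k = x ^ (k div n) * y ^ n"
          by (metis v_def mult.left_commute power_Suc)
        also have "\<dots> = (\<Sum>j<n. of_int (e j) * (x ^ (k div n) * y ^ j))"
          unfolding e sum_distrib_left by (rule sum.cong) (auto simp: algebra_simps)
        also have "\<dots> \<in> S" by (rule S_sum) (use S_mono i in auto)
        finally show ?thesis .
      qed
    qed
    then have "(\<Sum>k<m*n. of_int (c k) * (y * v k)) \<in> S" for c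
      by (intro S_sum) simp
    moreover obtain c where "s = (\<Sum>k<m*n. of_int (c k) * v k)"
      using \<open>s \<in> S\<close> unfolding S_def by blast
    then have "y * s = (\<Sum>k<m*n. of_int (c k) * (y * v k))"
      by (simp add: sum_distrib_left algebra_simps)
    ultimately show ?thesis by metis
  qed
  have integral: "algebraic_int z" if "\<And>s. s \<in> S \<Longrightarrow> z * s \<in> S" for z
  proof -
    have "\<forall>i. i < m * n \<longrightarrow> (\<exists>c :: nat \<Rightarrow> int. z * v i = (\<Sum>j<m*n. of_int (c j) * v j))"
      using that[OF S_gen] unfolding S_def by blast
    then obtain c where "\<And>i. i < m * n \<Longrightarrow> z * v i = (\<Sum>j<m*n. of_int (c i j) * v j)"
      by metis
    then show ?thesis
      by (rule algebraic_int_if_preserves_span[of _ _ _ _ 0]) (use m n in \<open>auto simp: v_def\<close>)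
  qed
  show "algebraic_int (x + y)"
    by (rule integral) (auto simp: distrib_right intro: S_add S_x S_y)
  show "algebraic_int (x * y)"
    by (rule integral) (auto simp: mult.assoc intro: S_x S_y)
qed

lemma algebraic_int_diff:
  fixes x y :: complex
  shows "algebraic_int x \<Longrightarrow> algebraic_int y \<Longrightarrow> algebraic_int (x - y)"
  using algebraic_int_plus_times(1)[of x "- y"] by simp

lemma algebraic_int_of_int: "algebraic_int (of_int n :: complex)"
  by (rule int_imp_algebraic_int) simp

lemma algebraic_int_sum:
  "(\<And>i. i \<in> A \<Longrightarrow> algebraic_int (f i :: complex)) \<Longrightarrow> algebraic_int (\<Sum>i\<in>A. f i)"
  by (induction A rule: infinite_finite_induct) (auto intro: algebraic_int_plus_times)

lemma algebraic_int_prod: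
  "(\<And>i. i \<in> A \<Longrightarrow> algebraic_int (f i :: complex)) \<Longrightarrow> algebraic_int (\<Prod>i\<in>A. f i)"
  using int_imp_algebraic_int[of "1::complex"]
  by (induction A rule: infinite_finite_induct) (auto intro: algebraic_int_plus_times)

lemma algebraic_int_power: "algebraic_int (x :: complex) \<Longrightarrow> algebraic_int (x ^ n)"
  using int_imp_algebraic_int[of "1::complex"]
  by (induction n) (auto intro: algebraic_int_plus_times)

lemma algebraic_int_poly:
  "algebraic_int (x :: complex) \<Longrightarrow> algebraic_int (poly (map_poly of_int p) x)"
  unfolding poly_altdef
  by (auto simp: coeff_map_poly intro!: algebraic_int_sum algebraic_int_plus_times
      algebraic_int_power algebraic_int_of_int)

text \<open>Multiplying by a leading coefficient suffices: if c is the leading coefficient of an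
  integral polynomial p of degree d, then c^(d-1) p(X / c) is monic and integral and has the root c
  x.\<close>

lemma algebraic_times_of_int:
  assumes "algebraic (x :: complex)"
  obtains n :: int where "n \<noteq> 0" "algebraic_int (of_int n * x)"
proof -
  obtain p where p: "\<forall>i. Polynomial.coeff p i \<in> \<int>" "p \<noteq> 0" "poly p x = 0"
    using assms unfolding algebraic_def by blast
  define d where "d = Polynomial.degree p"
  have "\<forall>i. \<exists>k. Polynomial.coeff p i = complex_of_int k"
    using p(1) by (auto elim: Ints_cases)
  then obtain c where c: "\<And>i. Polynomial.coeff p i = complex_of_int (c i)"
    by metis
  have cd: "c d \<noteq> 0" using p(2) c[of d] by (auto simp: d_def)
  have d0: "d > 0"
  proof (rule ccontr)
    assume "\<not> d > 0"
    then have "Polynomial.degree p = 0" by (simp add: d_def)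
    then obtain a where "p = [:a:]" by (rule degree_eq_zeroE)
    with p(2,3) show False by simp
  qed
  define q where "q = Polynomial.monom 1 d
      + (\<Sum>i<d. Polynomial.monom (c i * c d ^ (d - 1 - i)) i)"
  have q_coeff: "Polynomial.coeff q j = (if j = d then 1 else if j < d then c j * c d ^ (d - 1 - j) else 0)" for j
    by (simp add: q_def Polynomial.coeff_sum)
  have "Polynomial.degree q = d"
    using q_coeff by (intro antisym degree_le le_degree) auto
  then have "Polynomial.lead_coeff q = 1" by (simp add: q_coeff)
  moreover have "poly (map_poly of_int q) (of_int (c d) * x) = 0"
  proof -
    have "poly (map_poly of_int q) (of_int (c d) * x)
       = (\<Sum>i\<le>d. of_int (Polynomial.coeff q i) * (of_int (c d) * x) ^ i)"
      using \<open>Polynomial.degree q = d\<close> by (simp add: poly_altdef coeff_map_poly degree_map_poly)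
    also have "\<dots> = (\<Sum>i\<le>d. of_int (c d) ^ (d - 1) * (of_int (c i) * x ^ i))"
    proof (rule sum.cong)
      fix i assume "i \<in> {..d}"
      then consider "i = d" | "i < d" by force
      then show "of_int (Polynomial.coeff q i) * (of_int (c d) * x) ^ i
          = of_int (c d) ^ (d - 1) * (of_int (c i) * x ^ i)"
      proof cases
        case 1
        then show ?thesis using d0 by (cases d) (auto simp: q_coeff power_mult_distrib)
      next
        case 2
        then have "d - 1 = (d - 1 - i) + i" by simp
        then have "(of_int (c d) :: complex) ^ (d - 1) = of_int (c d) ^ (d - 1 - i) * of_int (c d) ^ i"
          by (metis power_add)
        with 2 show ?thesis by (simp add: q_coeff power_mult_distrib)
      qed
    qed auto
    also have "\<dots> = of_int (c d) ^ (d - 1) * poly p x"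
      by (simp add: poly_altdef sum_distrib_left c d_def)
    finally show ?thesis using p(3) by simp
  qed
  ultimately have "algebraic_int (of_int (c d) * x)"
    unfolding algebraic_int_altdef_ipoly by blast
  with cd show thesis using that by blast
qed

lemma algebraic_if_of_int_times:
  assumes "algebraic_int (of_int n * x :: complex)" "n \<noteq> 0"
  shows "algebraic x"
proof -
  obtain p where p: "poly p (of_int n * x) = 0" "p \<noteq> 0" "\<forall>i. Polynomial.coeff p i \<in> \<int>"
    using algebraic_int_imp_algebraic[OF assms(1)] unfolding algebraic_def by blast
  have "Polynomial.coeff (p \<circ>\<^sub>p [:0, of_int n:]) i \<in> \<int>" for i
    using p(3) by (intro coeff_pcompose_semiring_closed)
      (auto simp: coeff_pCons split: nat.splits)
  moreover have "p \<circ>\<^sub>p [:0, of_int n:] \<noteq> 0"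
    using p(2) assms(2) by (simp add: pcompose_eq_0_iff)
  moreover have "poly (p \<circ>\<^sub>p [:0, of_int n:]) x = 0"
    using p(1) by (simp add: poly_pcompose mult.commute)
  ultimately show ?thesis unfolding algebraic_def by blast
qed

text \<open>Closure is inherited from the algebraic integers by clearing the denominators of both
  numbers.\<close>

lemma algebraic_plus_times:
  fixes x y :: complex
  assumes "algebraic x" "algebraic y"
  shows "algebraic (x + y)" "algebraic (x * y)"
proof -
  obtain n where n: "n \<noteq> 0" "algebraic_int (of_int n * x)"
    using algebraic_times_of_int[OF assms(1)] .
  obtain m where m: "m \<noteq> 0" "algebraic_int (of_int m * y)"
    using algebraic_times_of_int[OF assms(2)] .
  have "algebraic_int (of_int m * (of_int n * x) + of_int n * (of_int m * y))"
    by (rule algebraic_int_plus_times(1)[OF algebraic_int_plus_times(2)[OF algebraic_int_of_int n(2)]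
          algebraic_int_plus_times(2)[OF algebraic_int_of_int m(2)]])
  then have "algebraic_int (of_int (n * m) * (x + y))" by (simp add: algebra_simps)
  then show "algebraic (x + y)" by (rule algebraic_if_of_int_times) (use n m in auto)
  have "algebraic_int ((of_int n * x) * (of_int m * y))"
    using n(2) m(2) by (rule algebraic_int_plus_times(2))
  then have "algebraic_int (of_int (n * m) * (x * y))" by (simp add: algebra_simps)
  then show "algebraic (x * y)" by (rule algebraic_if_of_int_times) (use n m in auto)
qed

section \<open>Subfields of the complex numbers and their embeddings\<close>

text \<open>Elementary closure conditions in place of \<open>subfield F CC\<close>, to which they
  are equivalent by \<open>subfield_CC_iff\<close>. As \<open>inverse 0 = 0\<close>, closure under
  \<open>inverse\<close> carries no proviso.\<close>

definition csubfield :: "complex set \<Rightarrow> bool" where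
  "csubfield F \<longleftrightarrow> 0 \<in> F \<and> 1 \<in> F \<and> (\<forall>x\<in>F. \<forall>y\<in>F. x + y \<in> F \<and> x * y \<in> F) \<and>
     (\<forall>x\<in>F. - x \<in> F \<and> inverse x \<in> F)"

lemma csubfieldD:
  assumes "csubfield F"
  shows "0 \<in> F" "1 \<in> F" "x \<in> F \<Longrightarrow> y \<in> F \<Longrightarrow> x + y \<in> F" "x \<in> F \<Longrightarrow> y \<in> F \<Longrightarrow> x * y \<in> F"
    "x \<in> F \<Longrightarrow> - x \<in> F" "x \<in> F \<Longrightarrow> inverse x \<in> F" "x \<in> F \<Longrightarrow> y \<in> F \<Longrightarrow> x - y \<in> F"
    "x \<in> F \<Longrightarrow> y \<in> F \<Longrightarrow> x / y \<in> F"
  using assms unfolding csubfield_def by (auto simp: divide_inverse) (metis diff_conv_add_uminus)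

lemma csubfield_power: "csubfield F \<Longrightarrow> x \<in> F \<Longrightarrow> x ^ n \<in> F"
  by (induction n) (auto intro: csubfieldD)

lemma csubfield_sum: "csubfield F \<Longrightarrow> (\<And>i. i \<in> A \<Longrightarrow> f i \<in> F) \<Longrightarrow> sum f A \<in> F"
  by (induction A rule: infinite_finite_induct) (auto intro: csubfieldD)

lemma csubfield_of_int: "csubfield F \<Longrightarrow> of_int n \<in> F"
proof -
  assume F: "csubfield F"
  have "of_nat k \<in> F" for k by (induction k) (auto intro: csubfieldD[OF F])
  then show ?thesis by (cases n) (auto intro: csubfieldD[OF F] simp del: of_nat_Suc)
qed

lemma Rats_subset_csubfield: "csubfield F \<Longrightarrow> \<rat> \<subseteq> F"
  by (auto elim!: Rats_cases' simp: csubfieldD csubfield_of_int)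

lemma csubfield_Rats: "csubfield \<rat>"
  by (auto simp: csubfield_def)

lemma CC_simps [simp]:
  "carrier CC = UNIV" "\<one>\<^bsub>CC\<^esub> = 1" "\<zero>\<^bsub>CC\<^esub> = 0" "x \<otimes>\<^bsub>CC\<^esub> y = x * y" "x \<oplus>\<^bsub>CC\<^esub> y = x + y"
  by (auto simp: ring_of_type_algebra_def)

lemma field_CC: "field CC" and domain_CC: "domain CC" and cring_CC: "cring CC" and ring_CC: "ring CC"
  using field_from_type_algebra field.axioms(1) domain.axioms(1) cring.axioms(1) by blast+

lemma CC_a_inv [simp]: "\<ominus>\<^bsub>CC\<^esub> x = - x"
  using abelian_group.minus_equality[OF ring.is_abelian_group[OF ring_CC], of "- x" x] by simp

lemma CC_inv: "x \<noteq> 0 \<Longrightarrow> inv\<^bsub>CC\<^esub> x = inverse x"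
  using comm_monoid.comm_inv_char[OF cring.axioms(2)[OF cring_CC], of x "inverse x"] by simp

lemma subfield_CC_iff: "subfield F CC \<longleftrightarrow> csubfield F"
proof
  assume F: "subfield F CC"
  show "csubfield F"
    unfolding csubfield_def
  proof (intro conjI ballI)
    show "0 \<in> F" "1 \<in> F" using subringE(2,3)[OF subfieldE(1)[OF F]] by auto
    fix x assume x: "x \<in> F"
    then show "- x \<in> F" using subringE(5)[OF subfieldE(1)[OF F]] by auto
    show "inverse x \<in> F"
    proof (cases "x = 0")
      case False
      then show ?thesis using ring.subfield_m_inv(1)[OF ring_CC F, of x] x by (simp add: CC_inv)
    qed (use x in simp)
    fix y assume "y \<in> F"
    with x show "x + y \<in> F" "x * y \<in> F" using subringE(6,7)[OF subfieldE(1)[OF F]] by auto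
  qed
next
  assume F: "csubfield F"
  have "subring F CC"
    by (rule ring.subringI[OF ring_CC]) (use F in \<open>auto simp: csubfield_def\<close>)
  then show "subfield F CC"
    by (rule field.subfieldI'[OF field_CC]) (use F in \<open>auto simp: csubfield_def CC_inv\<close>)
qed

lemma csubfield_generate: "csubfield (generate_field CC S)"
  using field.generate_field_is_subfield[OF field_CC, of S] subfield_CC_iff by simp

lemma subset_generate_field: "S \<subseteq> generate_field CC S"
  by (auto intro: generate_field.incl)

lemma generate_field_least: "csubfield F \<Longrightarrow> S \<subseteq> F \<Longrightarrow> generate_field CC S \<subseteq> F"
  using field.generate_field_min_subfield1[OF field_CC, of S F] subfield_CC_iff by simp

lemma csubfield_algebraic: "csubfield {x. algebraic x}"
  by (auto simp: csubfield_def intro: algebraic_plus_times)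

section \<open>Polynomials over a subfield and minimal polynomials\<close>

definition polys_over :: "complex set \<Rightarrow> complex poly set" where
  "polys_over F = {p. \<forall>i. Polynomial.coeff p i \<in> F}"

lemma polys_over_arith:
  assumes F: "csubfield F" and "p \<in> polys_over F" "q \<in> polys_over F"
  shows "p + q \<in> polys_over F" "p * q \<in> polys_over F" "- p \<in> polys_over F" "p - q \<in> polys_over F"
  using assms by (auto simp: polys_over_def coeff_mult intro!: csubfield_sum csubfieldD[OF F])

lemma polys_over_simps:
  assumes F: "csubfield F"
  shows "[:c:] \<in> polys_over F \<longleftrightarrow> c \<in> F" "0 \<in> polys_over F" "1 \<in> polys_over F"
    "Polynomial.monom c n \<in> polys_over F \<longleftrightarrow> c \<in> F"
    "pCons c p \<in> polys_over F \<longleftrightarrow> c \<in> F \<and> p \<in> polys_over F"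
  using csubfieldD(1,2)[OF F]
  by (auto simp: polys_over_def coeff_pCons split: nat.splits if_splits)

lemma polys_over_prod:
  assumes F: "csubfield F"
  shows "(\<And>i. i \<in> A \<Longrightarrow> f i \<in> polys_over F) \<Longrightarrow> prod f A \<in> polys_over F"
  by (induction A rule: infinite_finite_induct)
    (auto intro: polys_over_arith[OF F] simp: polys_over_simps[OF F])

lemma polys_over_mono: "F \<subseteq> F' \<Longrightarrow> p \<in> polys_over F \<Longrightarrow> p \<in> polys_over F'"
  by (auto simp: polys_over_def)

lemma polys_over_division:
  assumes F: "csubfield F" and p: "p \<in> polys_over F" "p \<noteq> 0" and q: "q \<in> polys_over F"
  obtains s r where "s \<in> polys_over F" "r \<in> polys_over F" "q = p * s + r"
    "r = 0 \<or> Polynomial.degree r < Polynomial.degree p"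
proof -
  have "\<exists>s\<in>polys_over F. \<exists>r\<in>polys_over F. q = p * s + r \<and>
      (r = 0 \<or> Polynomial.degree r < Polynomial.degree p)"
    using q
  \<comment> \<open>The measure separates the zero polynomial from the nonzero constants, which
    share the degree 0.\<close>
  proof (induction "if q = 0 then 0 else Suc (Polynomial.degree q)" arbitrary: q rule: less_induct)
    case less
    show ?case
    proof (cases "q = 0 \<or> Polynomial.degree q < Polynomial.degree p")
      case True
      then show ?thesis
        using less.prems by (intro bexI[of _ 0] bexI[of _ q]) (auto simp: polys_over_simps[OF F])
    next
      case False
      define t where "t = Polynomial.monom (Polynomial.lead_coeff q / Polynomial.lead_coeff p)
          (Polynomial.degree q - Polynomial.degree p)"
      have t: "t \<in> polys_over F"
        using p less.prems
        by (auto simp: t_def polys_over_simps[OF F] polys_over_def intro!: csubfieldD(1,8)[OF F])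
      have t0: "t \<noteq> 0" using False p by (auto simp: t_def)
      have degt: "Polynomial.degree t = Polynomial.degree q - Polynomial.degree p"
        unfolding t_def by (rule Polynomial.degree_monom_eq) (use False p in auto)
      have lct: "Polynomial.lead_coeff t = Polynomial.lead_coeff q / Polynomial.lead_coeff p"
        unfolding degt by (simp add: t_def)
      define q' where "q' = q - p * t"
      have q': "q' \<in> polys_over F"
        unfolding q'_def using p less.prems t by (intro polys_over_arith[OF F])
      have deg: "Polynomial.degree (p * t) = Polynomial.degree q"
        using False p t0 degt by (subst degree_mult_eq) auto
      have "Polynomial.lead_coeff (p * t) = Polynomial.lead_coeff q"
        using p lct by (simp add: Polynomial.lead_coeff_mult)
      then have c0: "Polynomial.coeff q' (Polynomial.degree q) = 0"
        by (simp add: q'_def deg)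
      have "Polynomial.degree q' \<le> Polynomial.degree q"
        unfolding q'_def using deg by (metis degree_diff_le order.refl)
      moreover have "Polynomial.degree q' \<noteq> Polynomial.degree q" if "q' \<noteq> 0"
        using c0 that by (metis leading_coeff_0_iff)
      ultimately have "(if q' = 0 then 0 else Suc (Polynomial.degree q'))
          < (if q = 0 then 0 else Suc (Polynomial.degree q))"
        using False by auto
      from less.hyps[OF this q'] obtain s r where sr: "s \<in> polys_over F" "r \<in> polys_over F"
        "q' = p * s + r" "r = 0 \<or> Polynomial.degree r < Polynomial.degree p" by blast
      then have "q = p * (s + t) + r" by (simp add: q'_def algebra_simps)
      with sr t show ?thesis using polys_over_arith(1)[OF F] by blast
    qed
  qed
  then show thesis using that by blast
qed

text \<open>Characterized by least degree and not normalized to be monic, so it is determined only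
  up to a nonzero scalar.\<close>

definition min_poly_over :: "complex set \<Rightarrow> complex \<Rightarrow> complex poly \<Rightarrow> bool" where
  "min_poly_over F x p \<longleftrightarrow> p \<in> polys_over F \<and> p \<noteq> 0 \<and> poly p x = 0 \<and>
     (\<forall>q\<in>polys_over F. poly q x = 0 \<longrightarrow> q \<noteq> 0 \<longrightarrow> Polynomial.degree p \<le> Polynomial.degree q)"

lemma min_poly_over_exists:
  assumes F: "csubfield F" and "algebraic x"
  obtains p where "min_poly_over F x p"
proof -
  obtain q where q: "\<forall>i. Polynomial.coeff q i \<in> \<rat>" "q \<noteq> 0" "poly q x = 0"
    using assms(2) unfolding algebraic_altdef by blast
  then have "q \<in> polys_over F" using Rats_subset_csubfield[OF F] by (auto simp: polys_over_def)
  with q have "\<exists>p. p \<in> polys_over F \<and> p \<noteq> 0 \<and> poly p x = 0" by blast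
  from exists_least_iff[of "\<lambda>n. \<exists>p. p \<in> polys_over F \<and> p \<noteq> 0 \<and> poly p x = 0 \<and> Polynomial.degree p = n"]
  obtain p where "p \<in> polys_over F" "p \<noteq> 0" "poly p x = 0"
    "\<And>q. q \<in> polys_over F \<Longrightarrow> q \<noteq> 0 \<Longrightarrow> poly q x = 0 \<Longrightarrow> \<not> Polynomial.degree q < Polynomial.degree p"
    using \<open>\<exists>p. _\<close> by metis
  then have "min_poly_over F x p" by (auto simp: min_poly_over_def not_less)
  then show thesis using that by blast
qed

lemma min_poly_over_dvd:
  assumes F: "csubfield F" and p: "min_poly_over F x p" and q: "q \<in> polys_over F" "poly q x = 0"
  obtains s where "s \<in> polys_over F" "q = p * s"
proof -
  obtain s r where sr: "s \<in> polys_over F" "r \<in> polys_over F" "q = p * s + r"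
    "r = 0 \<or> Polynomial.degree r < Polynomial.degree p"
    using polys_over_division[OF F _ _ q(1), of p] p unfolding min_poly_over_def by metis
  have "poly r x = 0" using sr(3) q(2) p by (simp add: min_poly_over_def)
  then have "r = 0" using p sr(2,4) unfolding min_poly_over_def by force
  with sr show thesis using that by simp
qed

text \<open>A field embedding, given by its graph so that Zorn's lemma applies directly.\<close>

definition embedding_graph :: "(complex \<times> complex) set \<Rightarrow> bool" where
  "embedding_graph G \<longleftrightarrow> (1, 1) \<in> G \<and> (\<forall>y. (0, y) \<in> G \<longrightarrow> y = 0) \<and>
     (\<forall>x y x' y'. (x, y) \<in> G \<longrightarrow> (x', y') \<in> G \<longrightarrow> (x + x', y + y') \<in> G \<and> (x * x', y * y') \<in> G) \<and>
     (\<forall>x y. (x, y) \<in> G \<longrightarrow> (- x, - y) \<in> G \<and> (inverse x, inverse y) \<in> G)"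

text \<open>Values outside \<open>F\<close> are unconstrained. Preservation of 0, negatives and
  inverses, and injectivity, follow from additivity, multiplicativity and
  \<open>\<sigma> 1 = 1\<close>.\<close>

definition embedding :: "complex set \<Rightarrow> (complex \<Rightarrow> complex) \<Rightarrow> bool" where
  "embedding F \<sigma> \<longleftrightarrow> csubfield F \<and> \<sigma> 1 = 1 \<and>
     (\<forall>x\<in>F. \<forall>y\<in>F. \<sigma> (x + y) = \<sigma> x + \<sigma> y \<and> \<sigma> (x * y) = \<sigma> x * \<sigma> y)"

lemma embeddingD:
  assumes "embedding F \<sigma>"
  shows "csubfield F" "\<sigma> 0 = 0" "\<sigma> 1 = 1" "x \<in> F \<Longrightarrow> y \<in> F \<Longrightarrow> \<sigma> (x + y) = \<sigma> x + \<sigma> y"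
    "x \<in> F \<Longrightarrow> y \<in> F \<Longrightarrow> \<sigma> (x * y) = \<sigma> x * \<sigma> y" "x \<in> F \<Longrightarrow> \<sigma> (- x) = - \<sigma> x"
    "x \<in> F \<Longrightarrow> \<sigma> (inverse x) = inverse (\<sigma> x)" "x \<in> F \<Longrightarrow> y \<in> F \<Longrightarrow> \<sigma> (x - y) = \<sigma> x - \<sigma> y"
proof -
  show F: "csubfield F" and 1: "\<sigma> 1 = 1" using assms by (auto simp: embedding_def)
  have add: "\<sigma> (x + y) = \<sigma> x + \<sigma> y" and mult: "\<sigma> (x * y) = \<sigma> x * \<sigma> y" if "x \<in> F" "y \<in> F" for x y
    using that assms by (auto simp: embedding_def)
  then show "x \<in> F \<Longrightarrow> y \<in> F \<Longrightarrow> \<sigma> (x + y) = \<sigma> x + \<sigma> y"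
    "x \<in> F \<Longrightarrow> y \<in> F \<Longrightarrow> \<sigma> (x * y) = \<sigma> x * \<sigma> y" by auto
  show 0: "\<sigma> 0 = 0" using add[of 0 0] csubfieldD(1)[OF F] by simp
  show neg: "\<sigma> (- x) = - \<sigma> x" if "x \<in> F" for x
    using add[of x "- x"] csubfieldD(5)[OF F] that 0 by (simp add: add_eq_0_iff)
  show "\<sigma> (x - y) = \<sigma> x - \<sigma> y" if "x \<in> F" "y \<in> F" for x y
    using add[of x "- y"] csubfieldD(5)[OF F] that neg by simp
  show "\<sigma> (inverse x) = inverse (\<sigma> x)" if "x \<in> F" for x
  proof (cases "x = 0")
    case False
    then have "\<sigma> x * \<sigma> (inverse x) = 1"
      using mult[of x "inverse x"] csubfieldD(6)[OF F] that 1 by simp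
    then show ?thesis by (metis inverse_unique)
  qed (simp add: 0)
qed

lemma embedding_inj:
  assumes "embedding F \<sigma>"
  shows "inj_on \<sigma> F"
proof (rule inj_onI)
  fix x y assume xy: "x \<in> F" "y \<in> F" "\<sigma> x = \<sigma> y"
  note F = embeddingD(1)[OF assms]
  have xyF: "x - y \<in> F" using xy csubfieldD(7)[OF F] by simp
  have "\<sigma> (x - y) = 0" using embeddingD(8)[OF assms] xy by simp
  then have "\<sigma> ((x - y) * inverse (x - y)) = 0"
    using embeddingD(5)[OF assms xyF] csubfieldD(6)[OF F xyF] by simp
  then show "x = y" using embeddingD(3)[OF assms] by (cases "x - y = 0") auto
qed

lemma embedding_sum:
  "embedding F \<sigma> \<Longrightarrow> (\<And>i. i \<in> A \<Longrightarrow> f i \<in> F) \<Longrightarrow> \<sigma> (sum f A) = (\<Sum>i\<in>A. \<sigma> (f i))"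
  by (induction A rule: infinite_finite_induct)
    (auto simp: embeddingD csubfield_sum[OF embeddingD(1)])

lemma embedding_power: "embedding F \<sigma> \<Longrightarrow> x \<in> F \<Longrightarrow> \<sigma> (x ^ n) = \<sigma> x ^ n"
  by (induction n) (auto simp: embeddingD csubfield_power[OF embeddingD(1)])

lemma embedding_mono: "embedding F \<sigma> \<Longrightarrow> csubfield E \<Longrightarrow> E \<subseteq> F \<Longrightarrow> embedding E \<sigma>"
  by (auto simp: embedding_def)

lemma embedding_cong: "embedding F \<sigma> \<Longrightarrow> (\<And>x. x \<in> F \<Longrightarrow> \<tau> x = \<sigma> x) \<Longrightarrow> embedding F \<tau>"
  by (auto simp: embedding_def csubfield_def)

lemma embedding_of_int: "embedding F \<sigma> \<Longrightarrow> \<sigma> (of_int n) = of_int n"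
proof -
  assume s: "embedding F \<sigma>"
  have "\<sigma> (of_nat k) = of_nat k \<and> of_nat k \<in> F" for k
    by (induction k) (auto simp: embeddingD[OF s] csubfieldD[OF embeddingD(1)[OF s]])
  then show ?thesis by (cases n) (auto simp: embeddingD[OF s] simp del: of_nat_Suc)
qed

lemma embedding_Rats: "embedding F \<sigma> \<Longrightarrow> x \<in> \<rat> \<Longrightarrow> \<sigma> x = x"
  by (auto elim!: Rats_cases' simp: divide_inverse embeddingD embedding_of_int
      csubfield_of_int[OF embeddingD(1)] csubfieldD(6)[OF embeddingD(1)])

lemma coeff_map_embedding:
  "embedding F \<sigma> \<Longrightarrow> Polynomial.coeff (map_poly \<sigma> p) i = \<sigma> (Polynomial.coeff p i)"
  by (simp add: coeff_map_poly embeddingD)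

lemma map_poly_embedding:
  assumes s: "embedding F \<sigma>" and "p \<in> polys_over F" "q \<in> polys_over F"
  shows "map_poly \<sigma> (p + q) = map_poly \<sigma> p + map_poly \<sigma> q"
    "map_poly \<sigma> (p * q) = map_poly \<sigma> p * map_poly \<sigma> q"
  using assms
  by (auto simp: poly_eq_iff coeff_map_embedding[OF s] coeff_mult polys_over_def embeddingD[OF s]
      embedding_sum[OF s] csubfieldD[OF embeddingD(1)[OF s]])

lemma map_poly_embedding_prod:
  assumes s: "embedding F \<sigma>"
  shows "(\<And>i. i \<in> A \<Longrightarrow> f i \<in> polys_over F) \<Longrightarrow> map_poly \<sigma> (prod f A) = (\<Prod>i\<in>A. map_poly \<sigma> (f i))"
  by (induction A rule: infinite_finite_induct)
    (auto simp: map_poly_embedding[OF s] polys_over_prod[OF embeddingD(1)[OF s]] map_poly_1 embeddingD[OF s])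

lemma degree_map_embedding:
  assumes s: "embedding F \<sigma>" and "p \<in> polys_over F"
  shows "Polynomial.degree (map_poly \<sigma> p) = Polynomial.degree p"
proof (cases "p = 0")
  case False
  have "Polynomial.lead_coeff p \<in> F" "Polynomial.lead_coeff p \<noteq> 0"
    using assms(2) False by (auto simp: polys_over_def)
  then have "\<sigma> (Polynomial.lead_coeff p) \<noteq> 0"
    using inj_onD[OF embedding_inj[OF s], of "Polynomial.lead_coeff p" 0]
      embeddingD(2)[OF s] csubfieldD(1)[OF embeddingD(1)[OF s]] by auto
  then show ?thesis
    by (intro antisym degree_map_poly_le le_degree) (simp add: coeff_map_embedding[OF s])
qed simp

lemma embedding_poly:
  assumes s: "embedding F \<sigma>" and "p \<in> polys_over F" "x \<in> F"
  shows "\<sigma> (poly p x) = poly (map_poly \<sigma> p) (\<sigma> x)"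
  using assms(2,3) unfolding poly_altdef degree_map_embedding[OF s assms(2)]
  by (subst embedding_sum[OF s])
     (auto simp: coeff_map_embedding[OF s] polys_over_def embeddingD[OF s] embedding_power[OF s]
      csubfieldD[OF embeddingD(1)[OF s]] csubfield_power[OF embeddingD(1)[OF s]])

lemma map_poly_embedding_Rats:
  assumes s: "embedding F \<sigma>" and "p \<in> polys_over \<rat>"
  shows "map_poly \<sigma> p = p"
  using assms(2) by (auto simp: poly_eq_iff coeff_map_embedding[OF s] polys_over_def embedding_Rats[OF s])

section \<open>Extending embeddings to all algebraic numbers\<close>

lemma embedding_graphD:
  assumes "embedding_graph G"
  shows "csubfield (Domain G)" "single_valued G"
proof -
  have neg: "(- x, - y) \<in> G" and inv: "(inverse x, inverse y) \<in> G" if "(x, y) \<in> G" for x y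
    using assms that unfolding embedding_graph_def by blast+
  have add: "(x + x', y + y') \<in> G" and mult: "(x * x', y * y') \<in> G"
    if "(x, y) \<in> G" "(x', y') \<in> G" for x y x' y'
    using assms that unfolding embedding_graph_def by blast+
  have one: "(1, 1) \<in> G" using assms by (simp add: embedding_graph_def)
  have zero: "(0, 0) \<in> G" using add[OF one neg[OF one]] by simp
  show "csubfield (Domain G)"
    unfolding csubfield_def by (auto intro: zero one dest: add mult neg inv)
  show "single_valued G"
  proof (rule single_valuedI)
    fix x y z assume "(x, y) \<in> G" "(x, z) \<in> G"
    then have "(x + - x, y + - z) \<in> G" by (intro add neg)
    then show "y = z" using assms by (auto simp: embedding_graph_def)
  qed
qed

lemma embedding_of_graph:
  assumes "embedding_graph G"
  obtains \<sigma> where "embedding (Domain G) \<sigma>" "\<And>x y. (x, y) \<in> G \<Longrightarrow> \<sigma> x = y"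
proof -
  define \<sigma> where "\<sigma> x = (THE y. (x, y) \<in> G)" for x
  have eq: "\<sigma> x = y" if "(x, y) \<in> G" for x y
    unfolding \<sigma>_def using that embedding_graphD(2)[OF assms]
    by (intro the_equality) (auto dest: single_valuedD)
  have "\<sigma> (x + x') = \<sigma> x + \<sigma> x' \<and> \<sigma> (x * x') = \<sigma> x * \<sigma> x'" if "x \<in> Domain G" "x' \<in> Domain G" for x x'
  proof -
    obtain y y' where "(x, y) \<in> G" "(x', y') \<in> G" using \<open>x \<in> Domain G\<close> \<open>x' \<in> Domain G\<close> by blast
    then have "(x + x', y + y') \<in> G" "(x * x', y * y') \<in> G" "(x, y) \<in> G" "(x', y') \<in> G"
      using assms unfolding embedding_graph_def by blast+
    then show ?thesis using eq by simp
  qed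
  moreover have "\<sigma> 1 = 1" using eq assms by (simp add: embedding_graph_def)
  ultimately have "embedding (Domain G) \<sigma>"
    using embedding_graphD(1)[OF assms] by (simp add: embedding_def)
  then show thesis using that eq by blast
qed

lemma embedding_graph_of_embedding:
  assumes "embedding F \<sigma>"
  shows "embedding_graph {(x, \<sigma> x) | x. x \<in> F}"
  using csubfieldD[OF embeddingD(1)[OF assms]]
  by (auto simp: embedding_graph_def embeddingD[OF assms])

text \<open>The Euclidean algorithm as an induction on the degree: dividing \<open>p\<close> by
  \<open>q\<close> gives p = q s + r, so q(\<alpha>) s(\<alpha>) = - r(\<alpha>), and the inverse of
  q(\<alpha>) is obtained from that of the smaller remainder. Minimality of \<open>p\<close> keeps
  all values that are inverted nonzero.\<close>

lemma inverse_in_adjunction: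
  assumes F: "csubfield F" and p: "min_poly_over F \<alpha> p" and q: "q \<in> polys_over F"
  obtains s where "s \<in> polys_over F" "inverse (poly q \<alpha>) = poly s \<alpha>"
proof -
  have pF: "p \<in> polys_over F" "p \<noteq> 0" "poly p \<alpha> = 0"
    and min: "\<And>q. q \<in> polys_over F \<Longrightarrow> poly q \<alpha> = 0 \<Longrightarrow> q \<noteq> 0 \<Longrightarrow> Polynomial.degree p \<le> Polynomial.degree q"
    using p by (auto simp: min_poly_over_def)
  have reduced: "\<exists>s\<in>polys_over F. inverse (poly q \<alpha>) = poly s \<alpha>"
    if "q \<in> polys_over F" "q \<noteq> 0" "Polynomial.degree q < Polynomial.degree p" for q
    using that
  proof (induction "Polynomial.degree q" arbitrary: q rule: less_induct)
    case less
    obtain s r where sr: "s \<in> polys_over F" "r \<in> polys_over F" "p = q * s + r"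
      "r = 0 \<or> Polynomial.degree r < Polynomial.degree q"
      using polys_over_division[OF F less.prems(1,2) pF(1)] by blast
    have eq: "poly q \<alpha> * poly s \<alpha> = - poly r \<alpha>"
      using pF(3) sr(3) by (simp add: add_eq_0_iff)
    have nz: "poly q \<alpha> \<noteq> 0"
      using min[OF less.prems(1)] less.prems by auto
    show ?case
    proof (cases "r = 0")
      \<comment> \<open>If \<open>q\<close> divides \<open>p\<close>, the cofactor \<open>s\<close>
        vanishes at \<alpha> and so has at least the degree of \<open>p\<close>; this leaves only a
        constant \<open>q\<close>.\<close>
      case True
      have "s \<noteq> 0" using pF sr(3) True by auto
      moreover have "poly s \<alpha> = 0" using eq nz True by simp
      ultimately have "Polynomial.degree p \<le> Polynomial.degree s" using min sr(1) by blast
      moreover have "Polynomial.degree p = Polynomial.degree q + Polynomial.degree s"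
        using sr(3) True \<open>s \<noteq> 0\<close> less.prems(2) by (simp add: degree_mult_eq)
      ultimately have "Polynomial.degree q = 0" by simp
      then obtain c where c: "q = [:c:]" by (rule degree_eq_zeroE)
      then have "c \<in> F" using less.prems(1) by (simp add: polys_over_simps[OF F])
      then show ?thesis
        by (intro bexI[of _ "[:inverse c:]"]) (auto simp: polys_over_simps[OF F] c csubfieldD[OF F])
    next
      case False
      then have deg: "Polynomial.degree r < Polynomial.degree q" using sr(4) by simp
      then have deg': "Polynomial.degree r < Polynomial.degree p" using less.prems(3) by simp
      from less.hyps[OF deg sr(2) False deg'] obtain t where
        t: "t \<in> polys_over F" "inverse (poly r \<alpha>) = poly t \<alpha>" by blast
      have "poly r \<alpha> \<noteq> 0" using min[OF sr(2)] deg' False by auto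
      then have "inverse (poly q \<alpha>) = poly s \<alpha> * (- inverse (poly r \<alpha>))"
        using eq nz by (simp add: field_simps)
      then have "inverse (poly q \<alpha>) = poly (- (s * t)) \<alpha>" using t(2) by simp
      then show ?thesis using sr(1) t(1) polys_over_arith[OF F] by blast
    qed
  qed
  obtain s r where sr: "r \<in> polys_over F" "q = p * s + r"
    "r = 0 \<or> Polynomial.degree r < Polynomial.degree p"
    using polys_over_division[OF F pF(1,2) q] by blast
  then have "poly q \<alpha> = poly r \<alpha>" using pF(3) by simp
  moreover have "\<exists>s\<in>polys_over F. inverse (poly r \<alpha>) = poly s \<alpha>"
    using sr reduced by (cases "r = 0") (auto intro!: bexI[of _ 0] simp: polys_over_simps[OF F])
  ultimately show thesis using that by metis
qed

text \<open>The extension sends q(\<alpha>) to the value at \<beta> of the polynomial with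
  transported coefficients. It is well defined because q(\<alpha>) = 0 makes \<open>p\<close> divide
  \<open>q\<close>, and the transported \<open>p\<close> vanishes at \<beta>. The values q(\<alpha>)
  already form a field by \<open>inverse_in_adjunction\<close>.\<close>

lemma embedding_extend_simple:
  assumes \<sigma>: "embedding F \<sigma>" and p: "min_poly_over F \<alpha> p" and \<beta>: "poly (map_poly \<sigma> p) \<beta> = 0"
  obtains F' \<tau> where "embedding F' \<tau>" "F \<subseteq> F'" "\<alpha> \<in> F'" "\<tau> \<alpha> = \<beta>" "\<And>x. x \<in> F \<Longrightarrow> \<tau> x = \<sigma> x"
proof -
  note F = embeddingD(1)[OF \<sigma>]
  note ar = polys_over_arith[OF F] and si = polys_over_simps[OF F]
  define G where "G = {(poly q \<alpha>, poly (map_poly \<sigma> q) \<beta>) | q. q \<in> polys_over F}"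
  have GI: "(poly q \<alpha>, poly (map_poly \<sigma> q) \<beta>) \<in> G" if "q \<in> polys_over F" for q
    using that by (auto simp: G_def)
  have vanish: "poly (map_poly \<sigma> q) \<beta> = 0" if q: "q \<in> polys_over F" "poly q \<alpha> = 0" for q
  proof -
    obtain s where "s \<in> polys_over F" "q = p * s"
      using min_poly_over_dvd[OF F p q] by blast
    then show ?thesis
      using \<beta> p by (simp add: map_poly_embedding[OF \<sigma>] min_poly_over_def)
  qed
  have \<sigma>C: "map_poly \<sigma> [:c:] = [:\<sigma> c:]" for c
    by (simp add: poly_eq_iff coeff_map_embedding[OF \<sigma>] coeff_pCons embeddingD[OF \<sigma>] split: nat.split)
  have neg: "map_poly \<sigma> (- q) = - map_poly \<sigma> q" if "q \<in> polys_over F" for q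
    using that by (auto simp: poly_eq_iff coeff_map_embedding[OF \<sigma>] embeddingD[OF \<sigma>] polys_over_def)
  have "embedding_graph G"
    unfolding embedding_graph_def
  proof (intro conjI allI impI)
    have "(poly [:1:] \<alpha>, poly (map_poly \<sigma> [:1:]) \<beta>) \<in> G"
      by (rule GI) (simp add: si csubfieldD[OF F])
    then show "(1, 1) \<in> G" by (simp add: \<sigma>C embeddingD[OF \<sigma>])
  next
    fix y assume "(0, y) \<in> G"
    then show "y = 0" using vanish by (auto simp: G_def)
  next
    fix x y x' y' assume "(x, y) \<in> G" "(x', y') \<in> G"
    then obtain q q' where q: "q \<in> polys_over F" "x = poly q \<alpha>" "y = poly (map_poly \<sigma> q) \<beta>"
      and q': "q' \<in> polys_over F" "x' = poly q' \<alpha>" "y' = poly (map_poly \<sigma> q') \<beta>"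
      by (auto simp: G_def)
    show "(x + x', y + y') \<in> G" "(x * x', y * y') \<in> G"
      using GI[OF ar(1)[OF q(1) q'(1)]] GI[OF ar(2)[OF q(1) q'(1)]]
      by (simp_all add: q q' map_poly_embedding[OF \<sigma>])
  next
    fix x y assume "(x, y) \<in> G"
    then obtain q where q: "q \<in> polys_over F" "x = poly q \<alpha>" "y = poly (map_poly \<sigma> q) \<beta>"
      by (auto simp: G_def)
    show "(- x, - y) \<in> G" using GI[OF ar(3)[OF q(1) q(1)]] by (simp add: q neg)
    show "(inverse x, inverse y) \<in> G"
    proof (cases "x = 0")
      case True
      then have "y = 0" using vanish q by simp
      then show ?thesis using True \<open>(x, y) \<in> G\<close> by simp
    next
      case False
      obtain s where s: "s \<in> polys_over F" "inverse x = poly s \<alpha>"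
        using inverse_in_adjunction[OF F p q(1)] q(2) by metis
      have m1: "[:- 1:] \<in> polys_over F"
        using csubfieldD(5)[OF F csubfieldD(2)[OF F]] by (simp add: si)
      have qs: "q * s + [:- 1:] \<in> polys_over F"
        by (rule ar(1)[OF ar(2)[OF q(1) s(1)] m1])
      have "poly q \<alpha> * poly s \<alpha> = 1" using s(2) q(2) False by (metis right_inverse)
      then have "poly (q * s + [:- 1:]) \<alpha> = 0" by simp
      then have "poly (map_poly \<sigma> (q * s + [:- 1:])) \<beta> = 0" using vanish qs by blast
      moreover have "map_poly \<sigma> (q * s + [:- 1:]) = map_poly \<sigma> q * map_poly \<sigma> s + [:- 1:]"
        unfolding map_poly_embedding(1)[OF \<sigma> ar(2)[OF q(1) s(1)] m1]
          map_poly_embedding(2)[OF \<sigma> q(1) s(1)] \<sigma>C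
        using embeddingD(3,6)[OF \<sigma>] csubfieldD(2)[OF F] by simp
      ultimately have "y * poly (map_poly \<sigma> s) \<beta> = 1" using q(3) by simp
      then have "inverse y = poly (map_poly \<sigma> s) \<beta>" by (rule inverse_unique)
      then show ?thesis using GI[OF s(1)] s(2) by simp
    qed
  qed
  then obtain \<tau> where \<tau>: "embedding (Domain G) \<tau>" "\<And>x y. (x, y) \<in> G \<Longrightarrow> \<tau> x = y"
    using embedding_of_graph by blast
  have FG: "(x, \<sigma> x) \<in> G" if "x \<in> F" for x
    using GI[of "[:x:]"] that by (simp add: si \<sigma>C)
  have "(poly [:0, 1:] \<alpha>, poly (map_poly \<sigma> [:0, 1:]) \<beta>) \<in> G"
    by (rule GI) (simp add: si csubfieldD[OF F])
  moreover have "map_poly \<sigma> [:0, 1:] = [:0, 1:]"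
    by (simp add: poly_eq_iff coeff_map_embedding[OF \<sigma>] coeff_pCons embeddingD[OF \<sigma>] split: nat.split)
  ultimately have "(\<alpha>, \<beta>) \<in> G" by simp
  then show thesis using that[OF \<tau>(1)] \<tau>(2) FG by blast
qed

lemma embedding_graph_chain_Union:
  assumes "C \<noteq> {}" "\<And>G. G \<in> C \<Longrightarrow> embedding_graph G" "\<And>G H. G \<in> C \<Longrightarrow> H \<in> C \<Longrightarrow> G \<subseteq> H \<or> H \<subseteq> G"
  shows "embedding_graph (\<Union>C)"
  unfolding embedding_graph_def
proof (intro conjI allI impI)
  show "(1, 1) \<in> \<Union>C" using assms(1,2) by (auto simp: embedding_graph_def)
  show "y = 0" if "(0, y) \<in> \<Union>C" for y using that assms(2) by (auto simp: embedding_graph_def)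
next
  fix x y x' y' assume "(x, y) \<in> \<Union>C" "(x', y') \<in> \<Union>C"
  then obtain G where G: "G \<in> C" "(x, y) \<in> G" "(x', y') \<in> G" using assms(3) by blast
  then have "(x + x', y + y') \<in> G \<and> (x * x', y * y') \<in> G"
    using assms(2)[OF G(1)] unfolding embedding_graph_def by simp
  then show "(x + x', y + y') \<in> \<Union>C" "(x * x', y * y') \<in> \<Union>C" using G(1) by auto
next
  fix x y assume "(x, y) \<in> \<Union>C"
  then obtain G where G: "G \<in> C" "(x, y) \<in> G" by blast
  then have "(- x, - y) \<in> G \<and> (inverse x, inverse y) \<in> G"
    using assms(2)[OF G(1)] unfolding embedding_graph_def by simp
  then show "(- x, - y) \<in> \<Union>C" "(inverse x, inverse y) \<in> \<Union>C" using G(1) by auto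
qed

text \<open>The automorphisms of the field of algebraic numbers; values elsewhere are irrelevant.\<close>

definition galois_aut :: "(complex \<Rightarrow> complex) \<Rightarrow> bool" where
  "galois_aut \<sigma> \<longleftrightarrow> embedding {x. algebraic x} \<sigma>"

text \<open>In a maximal extension every algebraic number belongs to the domain: otherwise its
  minimal polynomial over the domain, transported by the embedding, has a complex root, and the
  embedding extends further. The domain may also contain transcendental numbers if \<open>F\<close>
  does, hence the restriction at the end.\<close>

lemma embedding_extends_to_galois_aut:
  assumes "embedding F \<sigma>"
  obtains \<tau> where "galois_aut \<tau>" "\<And>x. x \<in> F \<Longrightarrow> \<tau> x = \<sigma> x"
proof -
  define G0 where "G0 = {(x, \<sigma> x) | x. x \<in> F}"
  define A where "A = {G. embedding_graph G \<and> G0 \<subseteq> G}"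
  have "\<exists>M\<in>A. \<forall>N\<in>A. M \<subseteq> N \<longrightarrow> N = M"
  proof (rule subset_Zorn_nonempty)
    show "A \<noteq> {}"
      using embedding_graph_of_embedding[OF assms] by (auto simp: A_def G0_def)
    show "\<Union>C \<in> A" if "C \<noteq> {}" "subset.chain A C" for C
    proof -
      have "embedding_graph (\<Union>C)"
        using that by (intro embedding_graph_chain_Union) (auto simp: A_def subset_chain_def)
      then show ?thesis using that by (fastforce simp: A_def subset_chain_def)
    qed
  qed
  then obtain G where GA: "G \<in> A" and maxA: "\<And>N. N \<in> A \<Longrightarrow> G \<subseteq> N \<Longrightarrow> N = G" by blast
  have G: "embedding_graph G" "G0 \<subseteq> G" using GA by (auto simp: A_def)
  have max: "H = G" if "embedding_graph H" "G \<subseteq> H" for H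
    using maxA[of H] that G(2) by (auto simp: A_def)
  obtain \<tau> where \<tau>: "embedding (Domain G) \<tau>" "\<And>x y. (x, y) \<in> G \<Longrightarrow> \<tau> x = y"
    using embedding_of_graph[OF G(1)] by blast
  have "x \<in> Domain G" if x: "algebraic x" for x
  proof -
    obtain p where p: "min_poly_over (Domain G) x p"
      using min_poly_over_exists[OF embeddingD(1)[OF \<tau>(1)] x] .
    have "Polynomial.degree p \<noteq> 0"
      using p by (auto simp: min_poly_over_def elim!: degree_eq_zeroE)
    then have "\<not> constant (poly (map_poly \<tau> p))"
      using p by (simp add: constant_degree degree_map_embedding[OF \<tau>(1)] min_poly_over_def)
    then obtain \<beta> where "poly (map_poly \<tau> p) \<beta> = 0"
      using fundamental_theorem_of_algebra by blast
    then obtain F' \<upsilon> where F': "embedding F' \<upsilon>" "Domain G \<subseteq> F'" "x \<in> F'" "\<And>x. x \<in> Domain G \<Longrightarrow> \<upsilon> x = \<tau> x"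
      using embedding_extend_simple[OF \<tau>(1) p] by metis
    have "G \<subseteq> {(x, \<upsilon> x) | x. x \<in> F'}"
    proof
      fix z assume "z \<in> G"
      then obtain u v where z: "z = (u, v)" "(u, v) \<in> G" by (cases z) auto
      then have "u \<in> Domain G" by blast
      then show "z \<in> {(x, \<upsilon> x) | x. x \<in> F'}" using z \<tau>(2)[OF z(2)] F'(2,4) by auto
    qed
    then have "{(x, \<upsilon> x) | x. x \<in> F'} = G"
      using max embedding_graph_of_embedding[OF F'(1)] by blast
    then show ?thesis using F'(3) by blast
  qed
  then have "galois_aut \<tau>"
    unfolding galois_aut_def by (intro embedding_mono[OF \<tau>(1) csubfield_algebraic]) auto
  moreover have "\<tau> x = \<sigma> x" if "x \<in> F" for x
    using \<tau>(2) G(2) that by (auto simp: G0_def)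
  ultimately show thesis using that by blast
qed

lemma embedding_id: "csubfield F \<Longrightarrow> embedding F (\<lambda>x. x)"
  by (auto simp: embedding_def)

text \<open>The minimal polynomial of \<open>x\<close> over \<open>F\<close> has a second root: in
  characteristic 0 a multiple root would also be a root of the derivative, which has smaller degree.
  Sending \<open>x\<close> to this second root fixes \<open>F\<close> and extends to all algebraic
  numbers.\<close>

lemma galois_aut_moves:
  assumes F: "csubfield F" and x: "algebraic x" "x \<notin> F"
  obtains \<tau> where "galois_aut \<tau>" "\<And>y. y \<in> F \<Longrightarrow> \<tau> y = y" "\<tau> x \<noteq> x"
proof -
  obtain p where p: "min_poly_over F x p"
    using min_poly_over_exists[OF F x(1)] .
  have "\<exists>\<beta>. poly p \<beta> = 0 \<and> \<beta> \<noteq> x"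
  proof -
    have pF: "p \<in> polys_over F" "p \<noteq> 0" "poly p x = 0"
      and min: "\<And>q. q \<in> polys_over F \<Longrightarrow> poly q x = 0 \<Longrightarrow> q \<noteq> 0 \<Longrightarrow> Polynomial.degree p \<le> Polynomial.degree q"
      using p by (auto simp: min_poly_over_def)
    obtain q where q: "p = [:- x, 1:] * q" using pF(3) by (auto simp: poly_eq_0_iff_dvd)
    have q0: "q \<noteq> 0" using pF(2) q by auto
    then have deg: "Polynomial.degree p = Suc (Polynomial.degree q)"
      unfolding q by (subst degree_mult_eq) auto
    \<comment> \<open>A linear minimal polynomial would have its root \<open>x\<close> in
      \<open>F\<close>.\<close>
    have "Polynomial.degree q \<noteq> 0"
    proof
      assume "Polynomial.degree q = 0"
      then obtain c where c: "q = [:c:]" by (rule degree_eq_zeroE)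
      then have "p = [:- x * c, c:]" by (simp add: q)
      then have "- x * c \<in> F" "c \<in> F" using pF(1) by (simp_all add: polys_over_simps[OF F])
      then have "- ((- x * c) / c) \<in> F" by (intro csubfieldD(5,8)[OF F])
      then show False using x(2) c q0 by simp
    qed
    then have "\<not> constant (poly q)" by (simp add: constant_degree)
    then obtain \<beta> where \<beta>: "poly q \<beta> = 0" using fundamental_theorem_of_algebra by blast
    have "poly q x \<noteq> 0"
    proof
      assume "poly q x = 0"
      then have "poly (pderiv p) x = 0" by (simp add: q pderiv_mult pderiv_pCons del: mult_pCons_left)
      moreover have "pderiv p \<in> polys_over F"
        unfolding polys_over_def
      proof (intro CollectI allI)
        fix i
        have "of_int (int (Suc i)) * Polynomial.coeff p (Suc i) \<in> F"
          using pF(1) by (intro csubfieldD(4)[OF F] csubfield_of_int[OF F]) (auto simp: polys_over_def)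
        then show "Polynomial.coeff (pderiv p) i \<in> F" by (simp add: coeff_pderiv)
      qed
      moreover have "pderiv p \<noteq> 0" using deg by (simp add: pderiv_eq_0_iff)
      ultimately have "Polynomial.degree p \<le> Polynomial.degree (pderiv p)" using min by blast
      then show False using deg by (simp add: degree_pderiv)
    qed
    then have "\<beta> \<noteq> x" using \<beta> by blast
    moreover have "poly p \<beta> = 0" unfolding q using \<beta> by (simp only: poly_mult mult_zero_right)
    ultimately show ?thesis by blast
  qed
  then obtain \<beta> where \<beta>: "poly p \<beta> = 0" "\<beta> \<noteq> x" by blast
  have "map_poly (\<lambda>x. x) p = p" by (simp add: map_poly_idI)
  then obtain F' \<tau> where \<tau>: "embedding F' \<tau>" "F \<subseteq> F'" "x \<in> F'" "\<tau> x = \<beta>" "\<And>y. y \<in> F \<Longrightarrow> \<tau> y = y"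
    using embedding_extend_simple[OF embedding_id[OF F] p, of \<beta>] \<beta>(1) by metis
  obtain \<upsilon> where \<upsilon>: "galois_aut \<upsilon>" "\<And>y. y \<in> F' \<Longrightarrow> \<upsilon> y = \<tau> y"
    using embedding_extends_to_galois_aut[OF \<tau>(1)] by blast
  show thesis
    by (rule that[OF \<upsilon>(1)]) (use \<upsilon>(2) \<tau> \<beta>(2) in auto)
qed

section \<open>Galois groups of normal number fields\<close>

lemma galois_aut_embedding: "galois_aut \<sigma> \<Longrightarrow> csubfield F \<Longrightarrow> F \<subseteq> {x. algebraic x} \<Longrightarrow> embedding F \<sigma>"
  unfolding galois_aut_def by (rule embedding_mono)

lemma polys_over_Rats_subset: "p \<in> polys_over \<rat> \<Longrightarrow> p \<in> polys_over {x. algebraic x}"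
  by (rule polys_over_mono[OF Rats_subset_csubfield[OF csubfield_algebraic]])

lemma galois_aut_poly:
  assumes "galois_aut \<sigma>" "p \<in> polys_over \<rat>" "algebraic x"
  shows "\<sigma> (poly p x) = poly p (\<sigma> x)"
  using embedding_poly[of "{x. algebraic x}" \<sigma> p x] assms polys_over_Rats_subset
    map_poly_embedding_Rats[of "{x. algebraic x}" \<sigma> p]
  by (simp add: galois_aut_def)

lemma of_int_poly_in_polys_over: "map_poly of_int f \<in> polys_over \<rat>"
  by (auto simp: polys_over_def coeff_map_poly)

lemma galois_aut_root:
  assumes "galois_aut \<sigma>" "p \<in> polys_over \<rat>" "p \<noteq> 0" "poly p x = 0"
  shows "poly p (\<sigma> x) = 0"
proof -
  have "algebraic x" using assms unfolding algebraic_altdef polys_over_def by blast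
  then show ?thesis
    using galois_aut_poly[OF assms(1,2)] assms(4) embeddingD(2) assms(1)
    unfolding galois_aut_def by metis
qed

lemma galois_aut_algebraic:
  assumes "galois_aut \<sigma>" "algebraic x"
  shows "algebraic (\<sigma> x)"
proof -
  obtain p where p: "\<forall>i. Polynomial.coeff p i \<in> \<rat>" "p \<noteq> 0" "poly p x = 0"
    using assms(2) unfolding algebraic_altdef by blast
  then have "poly p (\<sigma> x) = 0"
    using galois_aut_root[OF assms(1)] by (auto simp: polys_over_def)
  with p show ?thesis unfolding algebraic_altdef by blast
qed

lemma galois_aut_algebraic_int:
  assumes "galois_aut \<sigma>" "algebraic_int x"
  shows "algebraic_int (\<sigma> x)"
proof -
  obtain p where p: "poly (map_poly of_int p) x = 0" "Polynomial.lead_coeff p = 1"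
    using assms(2) unfolding algebraic_int_altdef_ipoly by blast
  then have "map_poly of_int p \<noteq> (0 :: complex poly)" by auto
  then have "poly (map_poly of_int p) (\<sigma> x) = 0"
    using galois_aut_root[OF assms(1) of_int_poly_in_polys_over] p(1) by blast
  with p(2) show ?thesis unfolding algebraic_int_altdef_ipoly by blast
qed

lemma galois_aut_inj: "galois_aut \<sigma> \<Longrightarrow> algebraic x \<Longrightarrow> algebraic y \<Longrightarrow> \<sigma> x = \<sigma> y \<Longrightarrow> x = y"
  using embedding_inj[of "{x. algebraic x}" \<sigma>] unfolding galois_aut_def inj_on_def by blast

lemma galois_aut_id: "galois_aut (\<lambda>x. x)"
  unfolding galois_aut_def by (rule embedding_id[OF csubfield_algebraic])

lemma galois_aut_comp:
  assumes "galois_aut \<sigma>" "galois_aut \<tau>"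
  shows "galois_aut (\<lambda>x. \<sigma> (\<tau> x))"
proof -
  note s = embeddingD[OF assms(1)[unfolded galois_aut_def]]
    and t = embeddingD[OF assms(2)[unfolded galois_aut_def]]
  show ?thesis
    unfolding galois_aut_def embedding_def
    using s(1,3) t(3) s(4,5) t(4,5) galois_aut_algebraic[OF assms(2)] by simp
qed

text \<open>Surjectivity holds because \<sigma> maps the finite root set of a rational polynomial
  injectively into itself, hence onto itself, and every algebraic number lies in such a set.\<close>

lemma galois_aut_inverse:
  assumes \<sigma>: "galois_aut \<sigma>"
  obtains \<tau> where "galois_aut \<tau>" "\<And>x. algebraic x \<Longrightarrow> \<tau> (\<sigma> x) = x" "\<And>x. algebraic x \<Longrightarrow> \<sigma> (\<tau> x) = x"
proof -
  let ?A = "{x :: complex. algebraic x}"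
  note s = embeddingD[OF \<sigma>[unfolded galois_aut_def]]
  have inj: "inj_on \<sigma> ?A" using embedding_inj \<sigma> by (simp add: galois_aut_def)
  have surj: "y \<in> \<sigma> ` ?A" if y: "algebraic y" for y
  proof -
    obtain p where p: "\<forall>i. Polynomial.coeff p i \<in> \<rat>" "p \<noteq> 0" "poly p y = 0"
      using y unfolding algebraic_altdef by blast
    let ?Z = "{x. poly p x = 0}"
    have Z: "?Z \<subseteq> ?A" using p unfolding algebraic_altdef by blast
    have "finite ?Z" using p(2) by (rule poly_roots_finite)
    moreover have "\<sigma> ` ?Z \<subseteq> ?Z"
      using galois_aut_root[OF \<sigma>, of p] p by (auto simp: polys_over_def)
    moreover have "inj_on \<sigma> ?Z" using inj Z by (rule inj_on_subset)
    ultimately have "\<sigma> ` ?Z = ?Z" by (rule endo_inj_surj)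
    then have "y \<in> \<sigma> ` ?Z" using p(3) by simp
    then show ?thesis using Z by blast
  qed
  define \<tau> where "\<tau> = inv_into ?A \<sigma>"
  have \<tau>1: "\<tau> (\<sigma> x) = x" if "algebraic x" for x
    using inj that by (simp add: \<tau>_def)
  have \<tau>2: "\<sigma> (\<tau> x) = x" and \<tau>A: "algebraic (\<tau> x)" if "algebraic x" for x
    using f_inv_into_f[OF surj[OF that]] inv_into_into[OF surj[OF that]] by (simp_all add: \<tau>_def)
  have "galois_aut \<tau>"
    unfolding galois_aut_def embedding_def
  proof (intro conjI ballI)
    show "csubfield ?A" by (rule csubfield_algebraic)
    show "\<tau> 1 = 1" using \<tau>1[of 1] s(3) by simp
    fix x y assume "x \<in> ?A" "y \<in> ?A"
    then have xy: "algebraic x" "algebraic y" by auto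
    have "\<sigma> (\<tau> x + \<tau> y) = x + y" "\<sigma> (\<tau> x * \<tau> y) = x * y"
      using xy \<tau>2 \<tau>A by (auto simp: s(4,5))
    then show "\<tau> (x + y) = \<tau> x + \<tau> y" "\<tau> (x * y) = \<tau> x * \<tau> y"
      using \<tau>1[of "\<tau> x + \<tau> y"] \<tau>1[of "\<tau> x * \<tau> y"] \<tau>A[OF xy(1)] \<tau>A[OF xy(2)]
      by (simp_all add: algebraic_plus_times)
  qed
  then show thesis using that \<tau>1 \<tau>2 by blast
qed

lemma csubfield_equalizer:
  assumes "galois_aut \<sigma>" "galois_aut \<tau>"
  shows "csubfield {x. algebraic x \<and> \<sigma> x = \<tau> x}"
  unfolding csubfield_def
  using embeddingD[OF assms(1)[unfolded galois_aut_def]] embeddingD[OF assms(2)[unfolded galois_aut_def]]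
    csubfieldD[OF csubfield_algebraic]
  by simp

lemma galois_aut_eq_on_generate:
  assumes "galois_aut \<sigma>" "galois_aut \<tau>" "\<And>x. x \<in> S \<Longrightarrow> algebraic x" "\<And>x. x \<in> S \<Longrightarrow> \<sigma> x = \<tau> x"
    "y \<in> generate_field CC S"
  shows "\<sigma> y = \<tau> y"
  using generate_field_least[OF csubfield_equalizer[OF assms(1,2)], of S] assms(3-5) by blast

lemma galois_aut_generate_subset:
  assumes "galois_aut \<sigma>" "\<And>x. x \<in> S \<Longrightarrow> algebraic x" "\<And>x. x \<in> S \<Longrightarrow> \<sigma> x \<in> F"
    "csubfield F" "y \<in> generate_field CC S"
  shows "algebraic y" "\<sigma> y \<in> F"
proof -
  have "csubfield {x. algebraic x \<and> \<sigma> x \<in> F}"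
    unfolding csubfield_def
    using embeddingD[OF assms(1)[unfolded galois_aut_def]]
      csubfieldD[OF csubfield_algebraic] csubfieldD[OF assms(4)]
    by simp
  from generate_field_least[OF this, of S] assms show "algebraic y" "\<sigma> y \<in> F" by blast+
qed

section \<open>Normal fields and their automorphism groups\<close>

definition normal_field :: "complex set \<Rightarrow> bool" where
  "normal_field K \<longleftrightarrow> csubfield K \<and> K \<subseteq> {x. algebraic x} \<and> (\<forall>\<sigma>. galois_aut \<sigma> \<longrightarrow> \<sigma> ` K \<subseteq> K)"

lemma normal_fieldD:
  assumes "normal_field K"
  shows "csubfield K" "x \<in> K \<Longrightarrow> algebraic x" "galois_aut \<sigma> \<Longrightarrow> x \<in> K \<Longrightarrow> \<sigma> x \<in> K"
  using assms unfolding normal_field_def by blast+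

lemma normal_field_generate:
  assumes "\<And>x. x \<in> S \<Longrightarrow> algebraic x" "\<And>\<sigma> x. galois_aut \<sigma> \<Longrightarrow> x \<in> S \<Longrightarrow> \<sigma> x \<in> generate_field CC S"
  shows "normal_field (generate_field CC S)"
  unfolding normal_field_def
proof (intro conjI allI impI subsetI)
  show "csubfield (generate_field CC S)" by (rule csubfield_generate)
  show "x \<in> {x. algebraic x}" if "x \<in> generate_field CC S" for x
    using galois_aut_generate_subset(1)[OF galois_aut_id, of S "generate_field CC S"] assms(1) that
      galois_aut_id csubfield_generate subset_generate_field by blast
  show "y \<in> generate_field CC S" if "galois_aut \<sigma>" "y \<in> \<sigma> ` generate_field CC S" for \<sigma> y
    using galois_aut_generate_subset(2)[OF that(1), of S "generate_field CC S"] assms that csubfield_generate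
    by blast
qed

lemma normal_field_bij:
  assumes K: "normal_field K" and \<sigma>: "galois_aut \<sigma>"
  shows "bij_betw \<sigma> K K"
proof -
  obtain \<tau> where \<tau>: "galois_aut \<tau>" "\<And>x. algebraic x \<Longrightarrow> \<tau> (\<sigma> x) = x" "\<And>x. algebraic x \<Longrightarrow> \<sigma> (\<tau> x) = x"
    using galois_aut_inverse[OF \<sigma>] by blast
  show ?thesis
    by (rule bij_betw_byWitness[where f' = \<tau>]) (use \<tau> \<sigma> normal_fieldD[OF K] in auto)
qed

text \<open>Every automorphism of \<open>K\<close> extends to the field of algebraic numbers, and
  normality makes every restriction an automorphism of \<open>K\<close>. From here on elements of
  the group are handled through representatives satisfying \<open>galois_aut\<close>.\<close>

lemma galois_group_carrier:
  assumes K: "normal_field K"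
  shows "carrier (galois_group K) = {restrict \<sigma> K | \<sigma>. galois_aut \<sigma>}"
proof (intro equalityI subsetI)
  fix f assume "f \<in> carrier (galois_group K)"
  then have f: "f \<in> Bij K" "f \<in> Ring.ring_hom (CC\<lparr>carrier := K\<rparr>) (CC\<lparr>carrier := K\<rparr>)"
    by (auto simp: galois_group_def)
  have "embedding K f"
    unfolding embedding_def using f(2) normal_fieldD(1)[OF K] by (auto simp: Ring.ring_hom_def)
  then obtain \<sigma> where \<sigma>: "galois_aut \<sigma>" "\<And>x. x \<in> K \<Longrightarrow> \<sigma> x = f x"
    using embedding_extends_to_galois_aut by blast
  have "f = restrict \<sigma> K"
    using f(1) \<sigma>(2) by (intro ext) (auto simp: Bij_def extensional_def)
  then show "f \<in> {restrict \<sigma> K | \<sigma>. galois_aut \<sigma>}" using \<sigma>(1) by blast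
next
  fix f assume "f \<in> {restrict \<sigma> K | \<sigma>. galois_aut \<sigma>}"
  then obtain \<sigma> where \<sigma>: "galois_aut \<sigma>" and f: "f = restrict \<sigma> K" by blast
  have e: "embedding K \<sigma>"
    by (rule galois_aut_embedding[OF \<sigma>]) (use normal_fieldD[OF K] in auto)
  have "restrict \<sigma> K \<in> Bij K" using normal_field_bij[OF K \<sigma>] by (simp add: Bij_def)
  moreover have "restrict \<sigma> K \<in> Ring.ring_hom (CC\<lparr>carrier := K\<rparr>) (CC\<lparr>carrier := K\<rparr>)"
    using normal_fieldD[OF K] csubfieldD[OF normal_fieldD(1)[OF K]] embeddingD(3-5)[OF e] \<sigma>
    by (auto simp: Ring.ring_hom_def)
  moreover have "restrict \<sigma> K q = q" if "q \<in> \<rat>" for q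
    using that embedding_Rats[OF e that] Rats_subset_csubfield[OF normal_fieldD(1)[OF K]] by auto
  ultimately show "f \<in> carrier (galois_group K)" by (simp add: galois_group_def f)
qed

lemma galois_group_mult:
  assumes K: "normal_field K" and "galois_aut \<sigma>" "galois_aut \<tau>"
  shows "restrict \<sigma> K \<otimes>\<^bsub>galois_group K\<^esub> restrict \<tau> K = restrict (\<lambda>x. \<sigma> (\<tau> x)) K"
  using normal_field_bij[OF K assms(2)] normal_field_bij[OF K assms(3)] normal_fieldD(3)[OF K assms(3)]
  by (auto simp: galois_group_def BijGroup_def Bij_def compose_def)

lemma galois_group_one: "\<one>\<^bsub>galois_group K\<^esub> = restrict (\<lambda>x. x) K"
  by (simp add: galois_group_def BijGroup_def)

lemma galois_group_is_group:
  assumes K: "normal_field K"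
  shows "group (galois_group K)"
proof (rule groupI)
  show "\<one>\<^bsub>galois_group K\<^esub> \<in> carrier (galois_group K)"
    unfolding galois_group_one galois_group_carrier[OF K] using galois_aut_id by blast
next
  fix f g h assume "f \<in> carrier (galois_group K)" "g \<in> carrier (galois_group K)"
    "h \<in> carrier (galois_group K)"
  then obtain \<sigma> \<tau> \<upsilon> where e: "galois_aut \<sigma>" "f = restrict \<sigma> K" "galois_aut \<tau>" "g = restrict \<tau> K"
    "galois_aut \<upsilon>" "h = restrict \<upsilon> K"
    unfolding galois_group_carrier[OF K] by blast
  show "f \<otimes>\<^bsub>galois_group K\<^esub> g \<otimes>\<^bsub>galois_group K\<^esub> h = f \<otimes>\<^bsub>galois_group K\<^esub> (g \<otimes>\<^bsub>galois_group K\<^esub> h)"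
    unfolding e by (simp add: galois_group_mult[OF K] e galois_aut_comp)
next
  fix f g assume "f \<in> carrier (galois_group K)" "g \<in> carrier (galois_group K)"
  then obtain \<sigma> \<tau> where e: "galois_aut \<sigma>" "f = restrict \<sigma> K" "galois_aut \<tau>" "g = restrict \<tau> K"
    unfolding galois_group_carrier[OF K] by blast
  show "f \<otimes>\<^bsub>galois_group K\<^esub> g \<in> carrier (galois_group K)"
    unfolding e galois_group_carrier[OF K]
    using galois_group_mult[OF K e(1,3)] galois_aut_comp[OF e(1,3)] by blast
next
  fix f assume "f \<in> carrier (galois_group K)"
  then obtain \<sigma> where e: "galois_aut \<sigma>" "f = restrict \<sigma> K"
    unfolding galois_group_carrier[OF K] by blast
  show "\<one>\<^bsub>galois_group K\<^esub> \<otimes>\<^bsub>galois_group K\<^esub> f = f"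
    unfolding e galois_group_one by (simp add: galois_group_mult[OF K galois_aut_id e(1)])
  obtain \<tau> where \<tau>: "galois_aut \<tau>" "\<And>x. algebraic x \<Longrightarrow> \<tau> (\<sigma> x) = x"
    by (rule galois_aut_inverse[OF e(1)]) blast
  have "restrict \<tau> K \<otimes>\<^bsub>galois_group K\<^esub> f = \<one>\<^bsub>galois_group K\<^esub>"
    unfolding e galois_group_one galois_group_mult[OF K \<tau>(1) e(1)]
    by (rule restrict_ext) (use \<tau>(2) normal_fieldD(2)[OF K] in auto)
  then show "\<exists>g\<in>carrier (galois_group K). g \<otimes>\<^bsub>galois_group K\<^esub> f = \<one>\<^bsub>galois_group K\<^esub>"
    unfolding galois_group_carrier[OF K] using \<tau>(1) by blast
qed

lemma galois_group_fixed_field: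
  assumes K: "normal_field K"
  shows "{x \<in> K. \<forall>\<sigma> \<in> carrier (galois_group K). \<sigma> x = x} = \<rat>"
proof (intro equalityI subsetI)
  fix x assume x: "x \<in> {x \<in> K. \<forall>\<sigma> \<in> carrier (galois_group K). \<sigma> x = x}"
  show "x \<in> \<rat>"
  proof (rule ccontr)
    assume "x \<notin> \<rat>"
    moreover have "algebraic x" using x normal_fieldD(2)[OF K] by simp
    ultimately obtain \<sigma> where \<sigma>: "galois_aut \<sigma>" "\<sigma> x \<noteq> x"
      using galois_aut_moves[OF csubfield_Rats, of x] by blast
    then have "restrict \<sigma> K \<in> carrier (galois_group K)"
      unfolding galois_group_carrier[OF K] by blast
    then have "restrict \<sigma> K x = x" using x by blast
    then show False using x \<sigma>(2) by simp
  qed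
next
  fix x :: complex assume x: "x \<in> \<rat>"
  then have "x \<in> K" using Rats_subset_csubfield[OF normal_fieldD(1)[OF K]] by blast
  moreover have "\<sigma> x = x" if "\<sigma> \<in> carrier (galois_group K)" for \<sigma>
    using that x by (simp add: galois_group_def)
  ultimately show "x \<in> {x \<in> K. \<forall>\<sigma> \<in> carrier (galois_group K). \<sigma> x = x}" by blast
qed

lemma rational_if_fixed:
  assumes "algebraic x" "\<And>\<sigma>. galois_aut \<sigma> \<Longrightarrow> \<sigma> x = x"
  shows "x \<in> \<rat>"
  using galois_aut_moves[OF csubfield_Rats assms(1)] assms(2) by blast

lemma root_of_int_poly_algebraic:
  "f \<noteq> 0 \<Longrightarrow> poly (map_poly of_int f) (z :: complex) = 0 \<Longrightarrow> algebraic z"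
  unfolding algebraic_def by (intro exI[of _ "map_poly of_int f"]) (auto simp: coeff_map_poly)

lemma normal_field_splitting_field:
  assumes "f \<noteq> 0"
  shows "normal_field (splitting_field f)"
  unfolding splitting_field_def
proof (rule normal_field_generate)
  have f: "map_poly of_int f \<noteq> (0 :: complex poly)" using assms by simp
  show "algebraic x" if "x \<in> {z. poly (map_poly of_int f) z = 0}" for x :: complex
    using root_of_int_poly_algebraic[OF assms] that by simp
  show "\<sigma> x \<in> generate_field CC {z. poly (map_poly of_int f) z = 0}"
    if "galois_aut \<sigma>" "x \<in> {z. poly (map_poly of_int f) z = 0}" for \<sigma> x
  proof -
    have "poly (map_poly of_int f) (\<sigma> x) = 0"
      using galois_aut_root[OF that(1) of_int_poly_in_polys_over f] that(2) by simp
    then show ?thesis by (intro subsetD[OF subset_generate_field]) simp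
  qed
qed

text \<open>\<open>ring.eval\<close> lists coefficients from the leading one down,
  \<open>Poly\<close> from the constant term up; hence the reversal.\<close>

lemma CC_eval: "ring.eval CC p x = poly (Poly (rev p)) x"
proof (induction p)
  case (Cons a p)
  have "x [^]\<^bsub>CC\<^esub> n = x ^ n" for n :: nat
    by (induction n) (auto simp: monoid.nat_pow_Suc nat_pow_def mult.commute)
  then show ?case
    using Cons by (simp add: ring.eval.simps[OF ring_CC] Poly_append poly_monom mult.commute)
qed (simp add: ring.eval.simps[OF ring_CC])

lemma algebraic_over_Rats:
  assumes "algebraic x"
  shows "(ring.algebraic CC over \<rat>) x"
proof -
  obtain p where p: "\<forall>i. Polynomial.coeff p i \<in> \<rat>" "p \<noteq> 0" "poly p x = 0"
    using assms unfolding algebraic_altdef by blast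
  have "set (coeffs p) \<subseteq> \<rat>"
    using p(1) by (auto simp: coeffs_def)
  moreover have "hd (rev (coeffs p)) \<noteq> 0"
    using p(2) by (simp add: hd_rev last_coeffs_eq_coeff_degree)
  ultimately have "rev (coeffs p) \<in> carrier (univ_poly CC \<rat>)"
    by (auto simp: univ_poly_def polynomial_def)
  then show ?thesis
    by (rule ring.algebraicI[OF ring_CC]) (use p in \<open>auto simp: CC_eval\<close>)
qed

text \<open>Adjoining the elements of \<open>S\<close> to \<rat> one at a time gives a
  finite-dimensional field, which coincides with the generated field. The fixed field is \<rat> by
  normality.\<close>

lemma finite_galois_extension_generate:
  assumes "finite S" "\<And>x. x \<in> S \<Longrightarrow> algebraic x" "normal_field (generate_field CC S)"
  shows "finite_galois_extension (generate_field CC S)"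
proof -
  obtain xs where xs: "set xs = S" using finite_list[OF assms(1)] by blast
  have Q: "subfield \<rat> CC" by (simp add: subfield_CC_iff csubfield_Rats)
  define E where "E = ring.finite_extension CC \<rat> xs"
  have alg: "(ring.algebraic CC over \<rat>) x" if "x \<in> set xs" for x
    using that assms(2) xs algebraic_over_Rats by blast
  have dim: "ring.finite_dimension CC \<rat> E"
    unfolding E_def using domain.finite_extension_finite_dimension(1)[OF domain_CC Q _ alg] by simp
  have "csubfield E"
    unfolding E_def using domain.finite_extension_is_subfield[OF domain_CC Q _ alg]
    by (simp add: subfield_CC_iff)
  moreover have "S \<subseteq> E"
    unfolding E_def using domain.finite_extension_mem[OF domain_CC subfieldE(1)[OF Q], of xs] xs by simp
  ultimately have "generate_field CC S \<subseteq> E" by (rule generate_field_least)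
  moreover have "E \<subseteq> generate_field CC S"
    unfolding E_def
  proof (rule ring.finite_extension_subring_incl[OF ring_CC])
    show "subring (generate_field CC S) CC"
      using csubfield_generate subfield_CC_iff subfieldE(1) by blast
    show "\<rat> \<subseteq> generate_field CC S" by (rule Rats_subset_csubfield[OF csubfield_generate])
    show "set xs \<subseteq> generate_field CC S" using xs subset_generate_field by blast
  qed
  ultimately have "generate_field CC S = E" by blast
  then show ?thesis
    unfolding finite_galois_extension_def
    using dim galois_group_fixed_field[OF assms(3)] csubfield_generate subfield_CC_iff by metis
qed

section \<open>The alternating group of degree five\<close>

text \<open>For g outside \<open>H\<close> the group is the disjoint union of \<open>H\<close> and g
  \<open>H\<close>; a square g g in the coset g \<open>H\<close> would put g itself into
  \<open>H\<close>.\<close>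

lemma (in group) square_in_index_two_subgroup:
  assumes H: "subgroup H G" and "finite (carrier G)" "Coset.order G = 2 * card H" and g: "g \<in> carrier G"
  shows "g \<otimes> g \<in> H"
proof (rule ccontr)
  assume ng: "g \<otimes> g \<notin> H"
  have gH: "g \<notin> H" using ng subgroup.m_closed[OF H] by blast
  have Hc: "H \<subseteq> carrier G" by (rule subgroup.subset[OF H])
  have fH: "finite H" using finite_subset[OF Hc assms(2)] .
  define T where "T = (\<lambda>h. g \<otimes> h) ` H"
  have inj: "inj_on (\<lambda>h. g \<otimes> h) H" using g Hc by (intro inj_onI) (metis l_cancel subsetD)
  have disj: "T \<inter> H = {}"
  proof -
    have False if "h \<in> H" "g \<otimes> h \<in> H" for h
    proof -
      have "g \<otimes> h \<otimes> inv h \<in> H" using that H by (simp add: subgroup.m_closed subgroup.m_inv_closed)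
      moreover have "g \<otimes> h \<otimes> inv h = g" using that(1) Hc g by (simp add: m_assoc subset_iff)
      ultimately show False using gH by simp
    qed
    then show ?thesis by (auto simp: T_def)
  qed
  have "card (T \<union> H) = Coset.order G"
    using card_Un_disjoint[of T H] fH disj card_image[OF inj] assms(3) by (simp add: T_def)
  moreover have "T \<union> H \<subseteq> carrier G" using Hc g by (auto simp: T_def)
  ultimately have "T \<union> H = carrier G"
    using card_subset_eq[OF assms(2)] by (simp add: Coset.order_def)
  moreover have "g \<otimes> g \<in> carrier G" using g by simp
  ultimately have "g \<otimes> g \<in> T" using ng by blast
  then obtain h where "h \<in> H" "g \<otimes> g = g \<otimes> h" by (auto simp: T_def)
  then have "g = h" using g Hc by (metis l_cancel subsetD)
  with \<open>h \<in> H\<close> gH show False by simp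
qed

section \<open>Three-cycles and subgroups of order divisible by 30\<close>

lemma finite_alt_group: "finite (carrier (alt_group n))"
  by (rule finite_subset[OF _ finite_permutations[of "{1..n}"]]) (auto simp: alt_group_carrier)

lemma order_alt_group_5: "Coset.order (alt_group 5) = 60"
  using alt_group_card_carrier[of 5] by (simp add: Coset.order_def fact_numeral)

abbreviation cyc3 :: "nat \<Rightarrow> nat \<Rightarrow> nat \<Rightarrow> nat \<Rightarrow> nat" where
  "cyc3 a b c \<equiv> cycle_of_list [a, b, c]"

lemma cyc3_apply:
  assumes "distinct [a, b, c]"
  shows "cyc3 a b c x = (if x = a then b else if x = b then c else if x = c then a else x)"
  using assms by (auto simp: transpose_def)

lemma three_cycles_iff:
  "f \<in> three_cycles n \<longleftrightarrow> (\<exists>a b c. distinct [a, b, c] \<and> {a, b, c} \<subseteq> {1..n} \<and> f = cyc3 a b c)"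
proof
  assume "f \<in> three_cycles n"
  then obtain cs where cs: "cycle cs" "length cs = 3" "set cs \<subseteq> {1..n}" "f = cycle_of_list cs" by auto
  obtain a b c where "cs = [a, b, c]" using stupid_lemma[OF cs(2)] by auto
  with cs show "\<exists>a b c. distinct [a, b, c] \<and> {a, b, c} \<subseteq> {1..n} \<and> f = cyc3 a b c"
    by (intro exI[of _ a] exI[of _ b] exI[of _ c]) auto
next
  assume "\<exists>a b c. distinct [a, b, c] \<and> {a, b, c} \<subseteq> {1..n} \<and> f = cyc3 a b c"
  then obtain a b c where "distinct [a, b, c]" "{a, b, c} \<subseteq> {1..n}" "f = cyc3 a b c" by blast
  then show "f \<in> three_cycles n"
    by (intro CollectI exI[of _ "[a, b, c]"]) auto
qed

lemma cyc3_in_alt_group: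
  "distinct [a, b, c] \<Longrightarrow> {a, b, c} \<subseteq> {1..n} \<Longrightarrow> cyc3 a b c \<in> carrier (alt_group n)"
  by (rule subsetD[OF three_cycles_incl]) (unfold three_cycles_iff, blast)

lemma subgroup_with_three_cycles:
  assumes "subgroup H (alt_group n)" "three_cycles n \<subseteq> H"
  shows "H = carrier (alt_group n)"
  using group.generate_subgroup_incl[OF alt_group_is_group assms(2,1)] alt_group_carrier_as_three_cycles[of n]
    subgroup.subset[OF assms(1)] by blast

text \<open>The order is 30 or 60. A subgroup of order 30 has index two and contains all squares;
  every three-cycle is the square of its inverse, and the three-cycles generate.\<close>

lemma subgroup_alt_group_5_full:
  assumes H: "subgroup H (alt_group 5)" and "30 dvd card H"
  shows "H = carrier (alt_group 5)"
proof -
  interpret A: group "alt_group 5" by (rule alt_group_is_group)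
  have Hc: "H \<subseteq> carrier (alt_group 5)" by (rule subgroup.subset[OF H])
  have fin: "finite (carrier (alt_group 5))" by (rule finite_alt_group)
  have "card H dvd 60"
    using A.lagrange[OF H] order_alt_group_5 by (metis dvd_triv_right)
  then obtain k where k: "60 = card H * k" by (elim dvdE)
  obtain l where l: "card H = 30 * l" using assms(2) by (elim dvdE)
  have "l * k = 2" using k l by (simp add: mult.commute)
  then have "l dvd 2" by (metis dvd_triv_left)
  moreover have "l \<noteq> 0" using \<open>l * k = 2\<close> by (cases l) auto
  ultimately have "l = 1 \<or> l = 2" using dvd_imp_le[of l 2] by linarith
  then show ?thesis
  proof
    assume "l = 2"
    then have "card H = Coset.order (alt_group 5)" using l order_alt_group_5 by simp
    then show ?thesis using card_subset_eq[OF fin Hc] by (simp add: Coset.order_def)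
  next
    assume "l = 1"
    then have two: "Coset.order (alt_group 5) = 2 * card H" using l order_alt_group_5 by simp
    show ?thesis
    proof (rule subgroup_with_three_cycles[OF H], rule subsetI)
      fix f assume "f \<in> three_cycles 5"
      then obtain a b c where abc: "distinct [a, b, c]" "{a, b, c} \<subseteq> {1..5}" "f = cyc3 a b c"
        unfolding three_cycles_iff by blast
      have d: "distinct [a, c, b]" using abc(1) by auto
      have "cyc3 a c b \<in> carrier (alt_group 5)"
        by (rule cyc3_in_alt_group) (use abc in auto)
      from A.square_in_index_two_subgroup[OF H fin two this]
      have "cyc3 a c b \<circ> cyc3 a c b \<in> H" by (simp only: alt_group_mult)
      moreover have "cyc3 a c b \<circ> cyc3 a c b = f"
        using d by (auto simp: abc(3) cyc3_apply[OF d] cyc3_apply[OF abc(1)] fun_eq_iff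
            simp del: cycle_of_list.simps)
      ultimately show "f \<in> H" by simp
    qed
  qed
qed

section \<open>Simplicity of the alternating group\<close>

lemma obtain_rest_of_five:
  assumes "distinct [a, b, c]" "{a, b, c} \<subseteq> {1..5 :: nat}"
  obtains d e where "distinct [a, b, c, d, e]" "{1..5} = {a, b, c, d, e}"
proof -
  have "card ({1..5} - {a, b, c}) = 2"
    using assms by (subst card_Diff_subset) auto
  then obtain d e where de: "{1..5} - {a, b, c} = {d, e}" "d \<noteq> e" by (auto simp: card_2_iff)
  then have "d \<notin> {a, b, c}" "e \<notin> {a, b, c}" by blast+
  moreover have "{1..5} = {a, b, c, d, e}" using de(1) assms(2) by blast
  moreover have "distinct [a, b, c, d, e]"
    using assms(1) de(2) \<open>d \<notin> {a, b, c}\<close> \<open>e \<notin> {a, b, c}\<close> by auto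
  ultimately show thesis using that[of d e] by blast
qed

lemma obtain_two_of_five:
  assumes "a \<noteq> b" "{a, b} \<subseteq> {1..5 :: nat}"
  obtains c d e where "distinct [a, b, c, d, e]" "{1..5} = {a, b, c, d, e}"
proof -
  have "card ({1..5} - {a, b}) = 3"
    using assms by (subst card_Diff_subset) auto
  then have "{1..5} - {a, b} \<noteq> {}" by (metis card.empty zero_neq_numeral)
  then obtain c where "c \<in> {1..5} - {a, b}" by blast
  then obtain d e where "distinct [a, b, c, d, e]" "{1..5} = {a, b, c, d, e}"
    using obtain_rest_of_five[of a b c] assms by auto
  then show thesis using that by blast
qed

text \<open>For a three-cycle c the commutator of c with \<sigma> lies in \<open>N\<close> and is a
  product of two three-cycles, c and the conjugate of its inverse under \<sigma>. Following a moved
  point along its orbit shows how to choose c so that the product is again a three-cycle; for some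
  cycle types the square of \<sigma> serves instead.\<close>

lemma normal_alt_group_5_contains_cyc3:
  assumes N: "N \<lhd> alt_group 5" and \<sigma>: "\<sigma> \<in> N" "\<sigma> \<noteq> id"
  obtains a b c where "distinct [a, b, c]" "{a, b, c} \<subseteq> {1..5}" "cyc3 a b c \<in> N"
proof -
  interpret A: group "alt_group 5" by (rule alt_group_is_group)
  have sub: "subgroup N (alt_group 5)" using N by (rule normal_imp_subgroup)
  have \<sigma>c: "\<sigma> \<in> carrier (alt_group 5)" using \<sigma>(1) subgroup.subset[OF sub] by blast
  then have \<sigma>p: "\<sigma> permutes {1..5}" by (simp add: alt_group_carrier)
  have \<sigma>out: "\<sigma> x = x" if "x \<notin> {1..5}" for x using \<sigma>p that by (rule permutes_not_in)
  have \<sigma>in: "\<sigma> x \<in> {1..5} \<longleftrightarrow> x \<in> {1..5}" for x using permutes_in_image[OF \<sigma>p] .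
  have \<sigma>inj: "\<sigma> x = \<sigma> y \<longleftrightarrow> x = y" for x y using permutes_inj[OF \<sigma>p] by (simp add: inj_eq)
  have sq: "\<sigma> \<circ> \<sigma> \<in> N" using subgroup.m_closed[OF sub \<sigma>(1) \<sigma>(1)] by (simp only: alt_group_mult)
  \<comment> \<open>This is c \<sigma> c' \<sigma>' with c = (x y z) and primes for inverses:
    conjugation by \<sigma> carries the inverse (z y x) of c to (\<sigma> z, \<sigma> y, \<sigma>
    x).\<close>
  have comm: "cyc3 x y z \<circ> cyc3 (\<sigma> z) (\<sigma> y) (\<sigma> x) \<in> N"
    if xyz: "distinct [x, y, z]" "{x, y, z} \<subseteq> {1..5}" for x y z
  proof -
    let ?c = "cyc3 x y z"
    have d': "distinct [z, y, x]" using xyz(1) by auto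
    have c: "?c \<in> carrier (alt_group 5)" by (rule cyc3_in_alt_group[OF xyz])
    have inv_c: "inv\<^bsub>alt_group 5\<^esub> ?c = cyc3 z y x"
    proof (rule A.inv_equality)
      show "cyc3 z y x \<otimes>\<^bsub>alt_group 5\<^esub> ?c = \<one>\<^bsub>alt_group 5\<^esub>"
        unfolding alt_group_mult alt_group_one using xyz(1)
        by (auto simp: fun_eq_iff cyc3_apply[OF xyz(1)] cyc3_apply[OF d'] simp del: cycle_of_list.simps)
      show "cyc3 z y x \<in> carrier (alt_group 5)" by (rule cyc3_in_alt_group[OF d']) (use xyz in auto)
    qed (rule c)
    have "?c \<otimes>\<^bsub>alt_group 5\<^esub> \<sigma> \<otimes>\<^bsub>alt_group 5\<^esub> inv\<^bsub>alt_group 5\<^esub> ?c \<in> N"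
      using N c \<sigma>(1) by (rule normal.inv_op_closed2)
    moreover have "inv\<^bsub>alt_group 5\<^esub> \<sigma> \<in> N" using sub \<sigma>(1) by (rule subgroup.m_inv_closed)
    ultimately have "(?c \<otimes>\<^bsub>alt_group 5\<^esub> \<sigma> \<otimes>\<^bsub>alt_group 5\<^esub> inv\<^bsub>alt_group 5\<^esub> ?c)
        \<otimes>\<^bsub>alt_group 5\<^esub> inv\<^bsub>alt_group 5\<^esub> \<sigma> \<in> N"
      using subgroup.m_closed[OF sub] by blast
    then have "?c \<circ> \<sigma> \<circ> cyc3 z y x \<circ> inv' \<sigma> \<in> N"
      unfolding inv_c alt_group_mult alt_group_inv_equality[OF \<sigma>c] .
    moreover have "\<sigma> \<circ> cyc3 z y x \<circ> inv' \<sigma> = cycle_of_list (map \<sigma> [z, y, x])"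
      using conjugation_of_cycle[of "[z, y, x]" \<sigma>] d' permutes_bij[OF \<sigma>p] by simp
    moreover have "?c \<circ> \<sigma> \<circ> cyc3 z y x \<circ> inv' \<sigma> = ?c \<circ> (\<sigma> \<circ> cyc3 z y x \<circ> inv' \<sigma>)"
      by (simp only: o_assoc)
    ultimately show ?thesis by (simp only: list.map)
  qed
  obtain i where i: "\<sigma> i \<noteq> i" using \<sigma>(2) by (metis eq_id_iff)
  define j where "j = \<sigma> i"
  have ij: "i \<noteq> j" "i \<in> {1..5}" "j \<in> {1..5}" using i \<sigma>out[of i] \<sigma>in[of i] by (auto simp: j_def)
  note ca = cyc3_apply and del = cycle_of_list.simps
  show thesis
  proof (cases "\<sigma> j = i")
    case True
    obtain k l m where klm: "distinct [i, j, k, l, m]" "{1..5} = {i, j, k, l, m}"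
      using obtain_two_of_five[of i j] ij by auto
    have out: "x \<noteq> i \<Longrightarrow> x \<noteq> j \<Longrightarrow> x \<noteq> k \<Longrightarrow> x \<noteq> l \<Longrightarrow> x \<noteq> m \<Longrightarrow> \<sigma> x = x" for x
      using \<sigma>out[of x] unfolding klm(2) by auto
    have im: "\<sigma> x \<in> {k, l, m}" if "x \<in> {k, l, m}" for x
      using \<sigma>in[of x] \<sigma>inj[of x i] \<sigma>inj[of x j] that klm(1) True unfolding klm(2) j_def[symmetric] by auto
    show thesis
    proof (cases "\<exists>x\<in>{k, l, m}. \<sigma> x = x")
      case fixed: True
      then obtain x where x: "x \<in> {k, l, m}" "\<sigma> x = x" by blast
      have d: "distinct [i, j, x]" "distinct [x, i, j]" "distinct [i, x, j]" using klm(1) x(1) by auto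
      have ijx: "{i, j, x} \<subseteq> {1..5}" unfolding klm(2) using x(1) by auto
      have "cyc3 i j x \<circ> cyc3 x i j \<in> N"
        using comm[OF d(1) ijx] by (simp only: x(2) True j_def[symmetric])
      moreover have "cyc3 i j x \<circ> cyc3 x i j = cyc3 i x j"
        using d(1) by (auto simp: fun_eq_iff ca[OF d(1)] ca[OF d(2)] ca[OF d(3)] simp del: del)
      ultimately have "cyc3 i x j \<in> N" by simp
      then show thesis by (rule that[OF d(3), rotated]) (use ijx in blast)
    next
      \<comment> \<open>Here \<sigma> swaps i and j and rotates the other three points. Parity would
        exclude this, but it is simpler to observe that its square is a three-cycle.\<close>
      case False
      have "\<sigma> k \<in> {l, m}" using im[of k] False by auto
      then obtain l' m' where lm: "{l', m'} = {l, m}" "\<sigma> k = l'" by blast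
      have d: "distinct [k, l', m']" using klm(1) lm(1) by (auto simp: doubleton_eq_iff)
      have s: "{k, l, m} = {k, l', m'}" using lm(1) by auto
      have l'm: "\<sigma> l' = m'"
      proof -
        have "\<sigma> l' \<in> {k, l', m'}" using im[of l'] unfolding s by simp
        moreover have "\<sigma> l' \<noteq> l'" using False unfolding s by simp
        moreover have "\<sigma> l' \<noteq> k"
        proof
          assume "\<sigma> l' = k"
          have "\<sigma> m' \<in> {k, l', m'}" using im[of m'] unfolding s by simp
          moreover have "\<sigma> m' \<noteq> m'" using False unfolding s by simp
          moreover have "\<sigma> m' \<noteq> k" using \<sigma>inj[of m' l'] \<open>\<sigma> l' = k\<close> d by auto
          moreover have "\<sigma> m' \<noteq> l'" using \<sigma>inj[of m' k] lm(2) d by auto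
          ultimately show False by blast
        qed
        ultimately show ?thesis by blast
      qed
      have m'k: "\<sigma> m' = k"
      proof -
        have "\<sigma> m' \<in> {k, l', m'}" using im[of m'] unfolding s by simp
        then show ?thesis using \<sigma>inj[of m' k] \<sigma>inj[of m' l'] lm(2) l'm d by auto
      qed
      have d2: "distinct [k, m', l']" using d by auto
      have "\<sigma> \<circ> \<sigma> = cyc3 k m' l'"
      proof
        fix x
        have "x \<in> {i, j, k, l', m'} \<or> \<sigma> x = x" using out[of x] lm(1) by (auto simp: doubleton_eq_iff)
        moreover have "i \<notin> {k, l', m'}" "j \<notin> {k, l', m'}" using klm(1) unfolding s[symmetric] by auto
        moreover have "x \<notin> {k, l', m'}" if "\<sigma> x = x" using False that unfolding s by blast
        ultimately show "(\<sigma> \<circ> \<sigma>) x = cyc3 k m' l' x"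
          using True lm(2) l'm m'k d j_def by (auto simp: ca[OF d2] simp del: del)
      qed
      then have "cyc3 k m' l' \<in> N" using sq by simp
      moreover have "{k, m', l'} \<subseteq> {1..5}" unfolding klm(2) using lm(1) by blast
      ultimately show thesis using that[OF d2] by blast
    qed
  next
    case False
    define k where "k = \<sigma> j"
    have k: "k \<in> {1..5}" "k \<noteq> i" "k \<noteq> j"
      using \<sigma>in[of j] ij(3) False \<sigma>inj[of j i] ij(1) by (auto simp: k_def j_def)
    have d1: "distinct [i, j, k]" using ij k by auto
    show thesis
    proof (cases "\<sigma> k = i")
      \<comment> \<open>The orbit is a triangle, and \<sigma> fixes or swaps the two remaining
        points, so its square is the inverse of the triangle.\<close>
      case True
      obtain l m where lm: "distinct [i, j, k, l, m]" "{1..5} = {i, j, k, l, m}"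
        using obtain_rest_of_five[of i j k] d1 ij k by auto
      have im: "\<sigma> x \<in> {l, m}" if "x \<in> {l, m}" for x
        using \<sigma>in[of x] \<sigma>inj[of x i] \<sigma>inj[of x j] \<sigma>inj[of x k] that lm(1) True
        unfolding lm(2) j_def[symmetric] k_def[symmetric] by auto
      have inv2: "\<sigma> (\<sigma> x) = x" if "x \<in> {l, m}" for x
        using im[of l] im[of m] that \<sigma>inj[of l m] lm(1) by auto
      have d2: "distinct [i, k, j]" using d1 by auto
      have "\<sigma> \<circ> \<sigma> = cyc3 i k j"
      proof
        fix x
        have "x \<in> {i, j, k} \<or> x \<in> {l, m} \<or> x \<notin> {1..5}" unfolding lm(2) by blast
        moreover have "i \<in> {1..5}" "j \<in> {1..5}" "k \<in> {1..5}" using ij k by auto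
        moreover have "x \<notin> {i, j, k}" if "x \<in> {l, m}" using that lm(1) by auto
        ultimately show "(\<sigma> \<circ> \<sigma>) x = cyc3 i k j x"
          unfolding ca[OF d2] comp_apply
          using True j_def k_def inv2[of x] \<sigma>out[of x] d1 by auto
      qed
      then have "cyc3 i k j \<in> N" using sq by simp
      then show thesis using that[OF d2] ij k by auto
    next
      \<comment> \<open>The orbit has at least four points i, j, k, l, and the commutator with (i j
        k) collapses to (l i j).\<close>
      case nk: False
      define l where "l = \<sigma> k"
      have l: "l \<in> {1..5}" "l \<noteq> i" "l \<noteq> j" "l \<noteq> k"
        using \<sigma>in[of k] k \<sigma>inj[of k i] \<sigma>inj[of k j] nk by (auto simp: l_def j_def k_def)
      have d: "distinct [l, k, j]" "distinct [l, i, j]" using d1 l by auto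
      have "cyc3 i j k \<circ> cyc3 l k j \<in> N"
        using comm[OF d1] ij k by (simp add: j_def[symmetric] k_def[symmetric] l_def[symmetric] del: del)
      moreover have "cyc3 i j k \<circ> cyc3 l k j = cyc3 l i j"
        using d1 l by (auto simp: fun_eq_iff ca[OF d1] ca[OF d(1)] ca[OF d(2)] simp del: del)
      ultimately show thesis using that[OF d(2)] l ij by auto
    qed
  qed
qed

text \<open>One three-cycle yields all of them: conjugation by (c d e) replaces the entry c of (a b
  c) by d, squaring exchanges two entries up to rotation, and these moves reach every
  triple.\<close>

lemma normal_subgroup_alt_group_5:
  assumes N: "N \<lhd> alt_group 5" and "N \<noteq> {id}"
  shows "N = carrier (alt_group 5)"
proof -
  interpret A: group "alt_group 5" by (rule alt_group_is_group)
  have sub: "subgroup N (alt_group 5)" using N by (rule normal_imp_subgroup)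
  have "id \<in> N" using subgroup.one_closed[OF sub] by (simp only: alt_group_one)
  then obtain \<sigma> where \<sigma>: "\<sigma> \<in> N" "\<sigma> \<noteq> id" using assms(2) by blast
  define Q where "Q a b c \<longleftrightarrow> distinct [a, b, c] \<and> {a, b, c} \<subseteq> {1..5} \<and> cyc3 a b c \<in> N" for a b c
  have rot: "Q b c a" if "Q a b c" for a b c
  proof -
    have d: "distinct [a, b, c]" "distinct [b, c, a]" using that by (auto simp: Q_def)
    have "cyc3 b c a = cyc3 a b c"
      using d by (auto simp: fun_eq_iff cyc3_apply[OF d(1)] cyc3_apply[OF d(2)] simp del: cycle_of_list.simps)
    then show ?thesis using that by (auto simp: Q_def)
  qed
  have swap: "Q b a c" if "Q a b c" for a b c
  proof -
    have d: "distinct [a, b, c]" "distinct [b, a, c]" using that by (auto simp: Q_def)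
    have "cyc3 a b c \<circ> cyc3 a b c \<in> N"
      using subgroup.m_closed[OF sub, of "cyc3 a b c" "cyc3 a b c"] that by (simp only: alt_group_mult Q_def)
    moreover have "cyc3 a b c \<circ> cyc3 a b c = cyc3 b a c"
      using d by (auto simp: fun_eq_iff cyc3_apply[OF d(1)] cyc3_apply[OF d(2)] simp del: cycle_of_list.simps)
    ultimately show ?thesis using that by (auto simp: Q_def)
  qed
  have change: "Q a b d" if Q: "Q a b c" and d: "d \<in> {1..5}" "d \<noteq> a" "d \<noteq> b" for a b c d
  proof (cases "d = c")
    case False
    have dd: "distinct [a, b, c]" "{a, b, c} \<subseteq> {1..5}" using Q by (auto simp: Q_def)
    obtain u v where uv: "distinct [a, b, c, u, v]" "{1..5} = {a, b, c, u, v}"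
      using obtain_rest_of_five[OF dd] by blast
    then obtain e where e: "distinct [a, b, c, d, e]" "e \<in> {1..5}"
    proof -
      have "u \<in> {1..5}" "v \<in> {1..5}" unfolding uv(2) by auto
      moreover have "d = u \<or> d = v" using d False unfolding uv(2) by auto
      ultimately show thesis using that[of v] that[of u] uv(1) by auto
    qed
    have p: "cyc3 c d e \<in> carrier (alt_group 5)"
      by (rule cyc3_in_alt_group) (use e d Q in \<open>auto simp: Q_def\<close>)
    have "cyc3 c d e \<otimes>\<^bsub>alt_group 5\<^esub> cyc3 a b c \<otimes>\<^bsub>alt_group 5\<^esub> inv\<^bsub>alt_group 5\<^esub> cyc3 c d e \<in> N"
      by (rule normal.inv_op_closed2[OF N p]) (use Q in \<open>simp add: Q_def\<close>)
    then have "cyc3 c d e \<circ> cyc3 a b c \<circ> inv' (cyc3 c d e) \<in> N"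
      unfolding alt_group_mult alt_group_inv_equality[OF p] .
    moreover have "cyc3 c d e \<circ> cyc3 a b c \<circ> inv' (cyc3 c d e) = cycle_of_list (map (cyc3 c d e) [a, b, c])"
      using p dd(1) by (intro conjugation_of_cycle) (auto simp: alt_group_carrier permutes_bij simp del: cycle_of_list.simps)
    moreover have "map (cyc3 c d e) [a, b, c] = [a, b, d]"
      using e cyc3_apply[of c d e] by (simp del: cycle_of_list.simps)
    ultimately show ?thesis using Q d by (auto simp: Q_def simp del: cycle_of_list.simps)
  qed (use Q in simp)
  obtain a b c where abc: "Q a b c"
    by (rule normal_alt_group_5_contains_cyc3[OF N \<sigma>]) (unfold Q_def, blast)
  have "three_cycles 5 \<subseteq> N"
  proof
    fix f assume "f \<in> three_cycles 5"
    then obtain x y z where xyz: "distinct [x, y, z]" "{x, y, z} \<subseteq> {1..5}" "f = cyc3 x y z"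
      unfolding three_cycles_iff by blast
    have "\<exists>b c. Q x b c"
    proof (cases "x \<in> {a, b, c}")
      case True
      then show ?thesis using abc rot[OF abc] rot[OF rot[OF abc]] by blast
    next
      case False
      then have "Q a b x" by (intro change[OF abc]) (use xyz in auto)
      from rot[OF rot[OF this]] show ?thesis by blast
    qed
    then obtain b c where xbc: "Q x b c" by blast
    have "\<exists>c. Q x y c"
    proof (cases "y \<in> {b, c}")
      case True
      then show ?thesis using xbc swap[OF rot[OF rot[OF xbc]]] by blast
    next
      case False
      then have "Q x b y" by (intro change[OF xbc]) (use xyz in auto)
      from swap[OF rot[OF rot[OF this]]] show ?thesis by blast
    qed
    then obtain c where "Q x y c" by blast
    then have "Q x y z" by (rule change) (use xyz in auto)
    then show "f \<in> N" using xyz(3) by (simp add: Q_def)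
  qed
  then show ?thesis by (rule subgroup_with_three_cycles[OF sub])
qed

section \<open>Conjugate subgroups and the covering number\<close>

lemma conjugates_iff:
  "M \<in> conjugates G H \<longleftrightarrow> (\<exists>g\<in>carrier G. M = (\<lambda>h. g \<otimes>\<^bsub>G\<^esub> h \<otimes>\<^bsub>G\<^esub> inv\<^bsub>G\<^esub> g) ` H)"
  unfolding conjugates_def l_coset_def r_coset_def by auto

lemma (in group) ord_prime_eqI:
  assumes "x \<in> carrier G" "x [^] (p::nat) = \<one>" "x \<noteq> \<one>" "Factorial_Ring.prime p"
  shows "ord x = p"
proof -
  have "ord x dvd p" using assms(1,2) pow_eq_id by blast
  then have "ord x = 1 \<or> ord x = p" using assms(4) by (auto simp: prime_nat_iff)
  moreover have "ord x \<noteq> 1" using assms(1,3) ord_eq_1 by blast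
  ultimately show ?thesis by blast
qed

lemma (in group) ord_dvd_card_if_conjugate:
  assumes H: "subgroup H G" "finite H" and "g \<in> carrier G" "h \<in> H" and x: "x = g \<otimes> h \<otimes> inv g"
  shows "ord x dvd card H"
proof -
  have hc: "h \<in> carrier G" using subgroup.subset[OF H(1)] assms(4) by blast
  interpret H: group "G\<lparr>carrier := H\<rparr>" by (rule subgroup_imp_group[OF H(1)])
  have "h [^]\<^bsub>G\<lparr>carrier := H\<rparr>\<^esub> card H = \<one>"
    using H.pow_order_eq_1[of h] assms(4) by (simp add: Coset.order_def)
  then have hn: "h [^] card H = \<one>" by (simp add: nat_pow_consistent[symmetric])
  have "(g \<otimes> h \<otimes> inv g) [^] n = g \<otimes> h [^] n \<otimes> inv g" for n :: nat
  proof (induction n)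
    case 0
    then show ?case using assms(3) by simp
  next
    case (Suc n)
    have cancel: "inv g \<otimes> (g \<otimes> z) = z" if "z \<in> carrier G" for z
      using that assms(3) by (simp add: m_assoc[symmetric])
    have "g \<otimes> h [^] n \<otimes> inv g \<otimes> (g \<otimes> h \<otimes> inv g) = g \<otimes> (h [^] n \<otimes> h) \<otimes> inv g"
      using assms(3) hc by (simp add: m_assoc cancel)
    then show ?case using Suc by simp
  qed
  then have "x [^] card H = \<one>" using hn assms(3) x by simp
  then show ?thesis using pow_eq_id[of x "card H"] x assms(3) hc by simp
qed

lemma alt_group_pow: "p [^]\<^bsub>alt_group n\<^esub> (k :: nat) = p ^^ k"
  by (induction k) (simp_all add: nat_pow_def alt_group_mult alt_group_one funpow_swap1 comp_def fun_eq_iff)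

abbreviation cyc5 :: "nat \<Rightarrow> nat" where
  "cyc5 \<equiv> cycle_of_list [1, 2, 3, 4, 5]"

lemma cyc5_apply: "cyc5 x = (if x \<in> {1..4} then Suc x else if x = 5 then 1 else x)"
  by (auto simp: transpose_def)

lemma evenperm_cycle: "evenperm (cycle_of_list [a, b, c, d, e])" if "distinct [a, b, c, d, e]"
  using that by (auto simp: evenperm_comp evenperm_swap permutation_swap_id permutation_compose comp_assoc)

lemma five_cycle_in_alt_group:
  assumes "distinct [a, b, c, d, e]" "{a, b, c, d, e} \<subseteq> {1..n}"
  shows "cycle_of_list [a, b, c, d, e] \<in> carrier (alt_group n)"
  unfolding alt_group_carrier
proof
  show "cycle_of_list [a, b, c, d, e] permutes {1..n}"
    by (rule permutes_subset[OF cycle_permutes]) (use assms(2) in simp)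
qed (rule evenperm_cycle[OF assms(1)])

text \<open>Every proper subgroup misses a conjugacy class: meeting the elements of orders 2, 3 and 5
  would make its order divisible by 30.\<close>

lemma alt_group_5_not_union_of_conjugates:
  assumes H: "subgroup H (alt_group 5)" "H \<noteq> carrier (alt_group 5)"
  shows "\<Union>(conjugates (alt_group 5) H) \<noteq> carrier (alt_group 5)"
proof
  assume all: "\<Union>(conjugates (alt_group 5) H) = carrier (alt_group 5)"
  interpret A: group "alt_group 5" by (rule alt_group_is_group)
  have fin: "finite H" using finite_subset[OF subgroup.subset[OF H(1)] finite_alt_group] .
  have dvd: "q dvd card H" if "x \<in> carrier (alt_group 5)" "x ^^ q = id" "x \<noteq> id" "Factorial_Ring.prime q" for x q
  proof -
    have "A.ord x = q"
      by (rule A.ord_prime_eqI) (use that in \<open>simp_all add: alt_group_pow alt_group_one\<close>)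
    moreover have "x \<in> \<Union>(conjugates (alt_group 5) H)" using that(1) all by simp
    then obtain M where M: "M \<in> conjugates (alt_group 5) H" "x \<in> M" by (rule UnionE)
    then obtain g h where "g \<in> carrier (alt_group 5)" "h \<in> H"
      "x = g \<otimes>\<^bsub>alt_group 5\<^esub> h \<otimes>\<^bsub>alt_group 5\<^esub> inv\<^bsub>alt_group 5\<^esub> g"
      unfolding conjugates_iff by blast
    then have "A.ord x dvd card H" using A.ord_dvd_card_if_conjugate[OF H(1) fin] by blast
    ultimately show ?thesis by simp
  qed
  have "2 dvd card H"
  proof (rule dvd)
    let ?t = "Transposition.transpose 1 2 \<circ> Transposition.transpose 3 (4::nat)"
    show "?t \<in> carrier (alt_group 5)"
      unfolding alt_group_carrier
      by (auto simp: evenperm_comp evenperm_swap permutation_swap_id intro!: permutes_compose permutes_swap_id)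
    show "?t ^^ 2 = id" by (auto simp: fun_eq_iff numeral_2_eq_2 transpose_def)
    have "?t 1 \<noteq> id 1" by (simp add: transpose_def)
    then show "?t \<noteq> id" by metis
  qed simp
  moreover have "3 dvd card H"
  proof (rule dvd)
    have d: "distinct [1, 2, 3 :: nat]" by simp
    show "cyc3 1 2 3 \<in> carrier (alt_group 5)" by (rule cyc3_in_alt_group) auto
    have f3: "f ^^ 3 = f \<circ> f \<circ> f" for f :: "nat \<Rightarrow> nat" by (simp add: numeral_3_eq_3 o_assoc)
    show "cyc3 1 2 3 ^^ 3 = id"
      unfolding f3 fun_eq_iff comp_apply cyc3_apply[OF d] by simp
    have "cyc3 1 2 3 1 \<noteq> id 1" using cyc3_apply[OF d, of 1] by (simp del: cycle_of_list.simps)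
    then show "cyc3 1 2 3 \<noteq> id" by metis
  qed simp
  moreover have "5 dvd card H"
  proof (rule dvd)
    show "cyc5 \<in> carrier (alt_group 5)" by (rule five_cycle_in_alt_group) auto
    show "cyc5 ^^ 5 = id"
    proof
      fix x
      have "(cyc5 ^^ 5) x = cyc5 (cyc5 (cyc5 (cyc5 (cyc5 x))))" by (simp add: numeral_eq_Suc del: cycle_of_list.simps)
      also have "\<dots> = x"
      proof -
        consider "x = 0" | "x = 1" | "x = 2" | "x = 3" | "x = 4" | "x = 5" | "x > 5" by linarith
        then show ?thesis by cases (unfold cyc5_apply, auto)
      qed
      finally show "(cyc5 ^^ 5) x = id x" by simp
    qed
    have "cyc5 1 \<noteq> id 1" using cyc5_apply[of 1] by (simp del: cycle_of_list.simps)
    then show "cyc5 \<noteq> id" by metis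
  qed simp
  ultimately have "30 dvd card H" by presburger
  then show False using subgroup_alt_group_5_full[OF H(1)] H(2) by blast
qed

text \<open>A permutation of five points without fixed points has cycle type (5) or (2, 3), and the
  latter is odd. The orbit of the point 1 decides which case occurs.\<close>

lemma even_perm_five_without_fixed_point:
  assumes p: "p permutes {1..5 :: nat}" "evenperm p" and nofix: "\<And>x. x \<in> {1..5} \<Longrightarrow> p x \<noteq> x"
  obtains a b c d e where "distinct [a, b, c, d, e]" "{1..5} = {a, b, c, d, e}"
    "p = cycle_of_list [a, b, c, d, e]"
proof -
  define a :: nat where "a = 1"
  define b where "b = p a"
  define c where "c = p b"
  have a: "a \<in> {1..5}" by (simp add: a_def)
  have pin: "p x \<in> {1..5} \<longleftrightarrow> x \<in> {1..5}" for x by (rule permutes_in_image[OF p(1)])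
  have pinj: "p x = p y \<longleftrightarrow> x = y" for x y using permutes_inj[OF p(1)] by (simp add: inj_eq)
  have pout: "p x = x" if "x \<notin> {1..5}" for x using p(1) that by (rule permutes_not_in)
  have ab: "a \<noteq> b" "b \<in> {1..5}" using a nofix[of a] pin[of a] by (auto simp: b_def)
  have bc: "b \<noteq> c" "c \<in> {1..5}" using nofix[of b] pin[of b] ab by (auto simp: c_def)
  note perm = permutation_swap_id permutation_compose
  \<comment> \<open>The type (2, 3) written as three transpositions: one for the pair, two for the
    triangle.\<close>
  have odd: False if q: "p = Transposition.transpose u v \<circ> (Transposition.transpose x y \<circ> Transposition.transpose y z)"
    "distinct [u, v, x, y, z]" for u v x y z
    using p(2) q(2) unfolding q(1)
    by (auto simp: evenperm_comp evenperm_swap perm)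
  show thesis
  proof (cases "c = a")
    case True
    obtain x y z where xyz: "distinct [a, b, x, y, z]" "{1..5} = {a, b, x, y, z}"
      using obtain_two_of_five[of a b] a ab by auto
    have in3: "p t \<in> {x, y, z}" "p t \<noteq> t" if "t \<in> {x, y, z}" for t
      using pin[of t] nofix[of t] pinj[of t a] pinj[of t b] that xyz(1) True
      unfolding xyz(2) b_def[symmetric] c_def[symmetric] by auto
    have out: "p t = t" if "t \<notin> {a, b, x, y, z}" for t using pout that unfolding xyz(2) by blast
    have pab: "p a = b" "p b = a" using True by (simp_all add: b_def c_def)
    have "p x = y \<or> p x = z" using in3[of x] by auto
    then have "(p x = y \<and> p y = z \<and> p z = x) \<or> (p x = z \<and> p z = y \<and> p y = x)"
      using in3[of y] in3[of z] pinj[of x y] pinj[of x z] pinj[of y z] xyz(1) by auto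
    then show thesis
    proof
      assume xs: "p x = y \<and> p y = z \<and> p z = x"
      have "p = Transposition.transpose a b \<circ> (Transposition.transpose x y \<circ> Transposition.transpose y z)"
      proof
        fix t
        show "p t = (Transposition.transpose a b \<circ> (Transposition.transpose x y \<circ> Transposition.transpose y z)) t"
        proof (cases "t \<in> {a, b, x, y, z}")
          case tin: True
          then show ?thesis using xs pab xyz(1) distinct_rev[THEN iffD2, OF xyz(1)] by (elim insertE emptyE) (simp_all add: transpose_def)
        qed (use out[of t] in \<open>auto simp: transpose_def\<close>)
      qed
      then show thesis using odd xyz(1) by blast
    next
      assume xs: "p x = z \<and> p z = y \<and> p y = x"
      have "p = Transposition.transpose a b \<circ> (Transposition.transpose x z \<circ> Transposition.transpose z y)"
      proof
        fix t
        show "p t = (Transposition.transpose a b \<circ> (Transposition.transpose x z \<circ> Transposition.transpose z y)) t"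
        proof (cases "t \<in> {a, b, x, y, z}")
          case tin: True
          then show ?thesis using xs pab xyz(1) distinct_rev[THEN iffD2, OF xyz(1)] by (elim insertE emptyE) (simp_all add: transpose_def)
        qed (use out[of t] in \<open>auto simp: transpose_def\<close>)
      qed
      moreover have "distinct [a, b, x, z, y]" using xyz(1) by auto
      ultimately show thesis using odd by blast
    qed
  next
    case ca: False
    define d where "d = p c"
    have d: "d \<in> {1..5}" "d \<noteq> b" "d \<noteq> c"
      using pin[of c] bc nofix[of c] pinj[of c a] ca by (auto simp: d_def b_def)
    have abc: "distinct [a, b, c]" using ab bc ca by auto
    obtain u v where uv: "distinct [a, b, c, u, v]" "{1..5} = {a, b, c, u, v}"
      using obtain_rest_of_five[OF abc] a ab bc by auto
    have out: "p t = t" if "t \<notin> {a, b, c, u, v}" for t using pout that unfolding uv(2) by blast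
    have pabc: "p a = b" "p b = c" "p c = d" by (simp_all add: b_def c_def d_def)
    show thesis
    proof (cases "d = a")
      case True
      have in2: "p t \<in> {u, v}" "p t \<noteq> t" if "t \<in> {u, v}" for t
        using pin[of t] nofix[of t] pinj[of t a] pinj[of t b] pinj[of t c] that uv(1) True
        unfolding uv(2) b_def[symmetric] c_def[symmetric] d_def[symmetric] by auto
      have puv: "p u = v" "p v = u" using in2[of u] in2[of v] by auto
      have "p = Transposition.transpose u v \<circ> (Transposition.transpose a b \<circ> Transposition.transpose b c)"
      proof
        fix t
        show "p t = (Transposition.transpose u v \<circ> (Transposition.transpose a b \<circ> Transposition.transpose b c)) t"
        proof (cases "t \<in> {a, b, c, u, v}")
          case tin: True
          then show ?thesis using puv pabc True uv(1) distinct_rev[THEN iffD2, OF uv(1)] by (elim insertE emptyE) (simp_all add: transpose_def)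
        qed (use out[of t] in \<open>auto simp: transpose_def\<close>)
      qed
      moreover have "distinct [u, v, a, b, c]" using uv(1) by auto
      ultimately show thesis using odd by blast
    next
      case False
      have duv: "d = u \<or> d = v" using d False unfolding uv(2) by auto
      obtain e where e: "distinct [a, b, c, d, e]" "{1..5} = {a, b, c, d, e}"
        using duv uv that[of u] by (elim disjE) (auto simp: insert_commute)
      have pd: "p d \<in> {a, e}"
        using pin[of d] nofix[of d] pinj[of d a] pinj[of d b] pinj[of d c] e(1) d(1)
        unfolding e(2) b_def[symmetric] c_def[symmetric] d_def[symmetric] by auto
      have pe: "p e \<in> {a, d}"
        using pin[of e] nofix[of e] pinj[of e a] pinj[of e b] pinj[of e c] e(1)
        unfolding e(2) b_def[symmetric] c_def[symmetric] d_def[symmetric] by auto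
      have pde: "p d = e" "p e = a"
        using pd pe pinj[of d e] pinj[of e c] e(1) unfolding d_def[symmetric] by auto
      have out': "p t = t" if "t \<notin> {a, b, c, d, e}" for t using pout that unfolding e(2) by blast
      have "p = cycle_of_list [a, b, c, d, e]"
      proof
        fix t
        show "p t = cycle_of_list [a, b, c, d, e] t"
        proof (cases "t \<in> {a, b, c, d, e}")
          case tin: True
          then show ?thesis using pde pabc e(1) distinct_rev[THEN iffD2, OF e(1)] by (elim insertE emptyE) (simp_all add: transpose_def)
        qed (use out'[of t] in \<open>auto simp: transpose_def\<close>)
      qed
      then show thesis using that e by blast
    qed
  qed
qed

lemma conj_alt_group:
  assumes "g \<in> carrier (alt_group n)"
  shows "g \<otimes>\<^bsub>alt_group n\<^esub> h \<otimes>\<^bsub>alt_group n\<^esub> inv\<^bsub>alt_group n\<^esub> g = g \<circ> h \<circ> inv' g"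
  unfolding alt_group_mult alt_group_inv_equality[OF assms] ..

lemma in_conjugateI:
  assumes g: "g \<in> carrier (alt_group n)" and "h \<in> H" "p \<circ> g = g \<circ> h"
  shows "p \<in> \<Union>(conjugates (alt_group n) H)"
proof
  have "bij g" using g permutes_bij by (auto simp: alt_group_carrier)
  then have gg: "g \<circ> inv' g = id" by (rule surj_iff[THEN iffD1, OF bij_is_surj])
  have "g \<circ> h \<circ> inv' g = p \<circ> (g \<circ> inv' g)" using assms(3) by (simp add: o_assoc)
  then show "p \<in> (\<lambda>h. g \<otimes>\<^bsub>alt_group n\<^esub> h \<otimes>\<^bsub>alt_group n\<^esub> inv\<^bsub>alt_group n\<^esub> g) ` H"
    using assms(2) by (intro image_eqI[of _ _ h]) (simp_all only: conj_alt_group[OF g] gg comp_id)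
  show "(\<lambda>h. g \<otimes>\<^bsub>alt_group n\<^esub> h \<otimes>\<^bsub>alt_group n\<^esub> inv\<^bsub>alt_group n\<^esub> g) ` H \<in> conjugates (alt_group n) H"
    unfolding conjugates_iff using g by blast
qed

lemma permutation_of_five:
  assumes "distinct [a, b, c, d, e]" "{1..5 :: nat} = {a, b, c, d, e}"
  obtains g where "g permutes {1..5}" "g 1 = a" "g 2 = b" "g 3 = c" "g 4 = d" "g 5 = e"
proof -
  define g where "g x = (if x = 1 then a else if x = 2 then b else if x = 3 then c
      else if x = 4 then d else if x = 5 then e else x)" for x :: nat
  have dom: "{1..5 :: nat} = {1, 2, 3, 4, 5}" by auto
  have "g ` {1..5} = {a, b, c, d, e}" unfolding dom by (auto simp: g_def)
  then have im: "g ` {1..5} = {1..5}" using assms(2) by simp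
  then have "inj_on g {1..5}" by (intro eq_card_imp_inj_on) auto
  with im have "bij_betw g {1..5} {1..5}" by (simp add: bij_betw_def)
  then have "g permutes {1..5}"
    by (rule bij_imp_permutes) (auto simp: g_def)
  then show thesis by (rule that) (simp_all add: g_def)
qed

text \<open>A five-cycle \<open>p\<close> is conjugate to \<open>cyc5\<close> in the symmetric group. If the conjugating permutation
  is odd, correcting it by the odd permutation \<open>x \<mapsto> 2x - 1\<close> (modulo 5) makes it conjugate
  \<open>cyc5\<close> to \<open>p\<^sup>2\<close>; in both cases \<open>p\<close> is carried into the centralizer of \<open>cyc5\<close>.\<close>

lemma even_conjugator_into_centralizer:
  assumes "distinct [a, b, c, d, e]" "{1..5 :: nat} = {a, b, c, d, e}"
  defines "p \<equiv> cycle_of_list [a, b, c, d, e]"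
  obtains g where "g \<in> carrier (alt_group 5)" "p \<circ> p \<circ> g = g \<circ> cyc5 \<or> p \<circ> g = g \<circ> cyc5"
proof -
  have p: "p a = b" "p b = c" "p c = d" "p d = e" "p e = a"
    using assms(1) by (auto simp: p_def transpose_def)
  have pout: "p x = x" if "x \<notin> {1..5}" for x
    using that unfolding assms(2) by (auto simp: p_def transpose_def)
  note perm = permutation_swap_id permutation_compose
  obtain g where g: "g permutes {1..5}" "g 1 = a" "g 2 = b" "g 3 = c" "g 4 = d" "g 5 = e"
    using permutation_of_five[OF assms(1,2)] .
  obtain h where h: "h permutes {1..5}" "h 1 = 1" "h 2 = 3" "h 3 = 5" "h 4 = 2" "h 5 = (4::nat)"
    by (rule permutation_of_five[of 1 3 5 2 4]) auto
  have gout: "g x = x" "h x = x" if "x \<notin> {1..5}" for x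
    using permutes_not_in[OF g(1) that] permutes_not_in[OF h(1) that] .
  have cases5: "x = 1 \<or> x = 2 \<or> x = 3 \<or> x = 4 \<or> x = 5 \<or> x \<notin> {1..5}" for x :: nat by auto
  have c5: "cyc5 1 = 2" "cyc5 2 = 3" "cyc5 3 = 4" "cyc5 4 = 5" "cyc5 5 = 1" "x \<notin> {1..5} \<Longrightarrow> cyc5 x = x" for x
    unfolding cyc5_apply by auto
  have pg: "p \<circ> g = g \<circ> cyc5"
  proof
    fix x
    show "(p \<circ> g) x = (g \<circ> cyc5) x"
      using cases5[of x] by (elim disjE) (simp_all only: comp_apply c5 g p gout pout not_False_eq_True simp_thms)
  qed
  \<comment> \<open>The permutation \<open>h\<close> doubles differences modulo 5, so it turns the
    shift by one into the shift by two.\<close>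
  have hc: "cyc5 \<circ> cyc5 \<circ> h = h \<circ> cyc5"
  proof
    fix x
    show "(cyc5 \<circ> cyc5 \<circ> h) x = (h \<circ> cyc5) x"
      using cases5[of x] by (elim disjE) (simp_all only: comp_apply c5 h gout not_False_eq_True simp_thms)
  qed
  have "h = Transposition.transpose 2 3 \<circ> (Transposition.transpose 3 5 \<circ> Transposition.transpose 5 4)"
  proof
    fix x
    show "h x = (Transposition.transpose 2 3 \<circ> (Transposition.transpose 3 5 \<circ> Transposition.transpose 5 4)) x"
      using cases5[of x] by (elim disjE) (use h gout in \<open>auto simp: transpose_def\<close>)
  qed
  then have hodd: "\<not> evenperm h" by (auto simp: evenperm_comp evenperm_swap perm)
  show thesis
  proof (cases "evenperm g")
    case True
    then show thesis using that[of g] g(1) pg by (simp add: alt_group_carrier)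
  next
    case False
    have fin: "finite {1..5::nat}" by simp
    have "evenperm (g \<circ> h)"
      using evenperm_comp[of g h] permutation_permutes fin g(1) h(1) hodd False by blast
    then have gh: "g \<circ> h \<in> carrier (alt_group 5)"
      using permutes_compose[OF h(1) g(1)] by (simp add: alt_group_carrier)
    have "p \<circ> p \<circ> (g \<circ> h) = p \<circ> (p \<circ> g) \<circ> h" by (simp only: o_assoc)
    also have "\<dots> = (p \<circ> g) \<circ> cyc5 \<circ> h" by (simp only: pg o_assoc)
    also have "\<dots> = g \<circ> (cyc5 \<circ> cyc5 \<circ> h)" by (simp only: pg o_assoc)
    also have "\<dots> = g \<circ> h \<circ> cyc5" by (simp only: hc o_assoc)
    finally show thesis using that[OF gh] by blast
  qed
qed

lemma subgroup_alt_groupI: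
  assumes "H \<subseteq> carrier (alt_group n)" "id \<in> H" "\<And>p q. p \<in> H \<Longrightarrow> q \<in> H \<Longrightarrow> p \<circ> q \<in> H"
    "\<And>p. p \<in> H \<Longrightarrow> inv' p \<in> H"
  shows "subgroup H (alt_group n)"
  by (rule group.subgroupI[OF alt_group_is_group])
     (use assms alt_group_inv_equality in \<open>auto simp: alt_group_mult subset_iff\<close>)

lemma point_stabilizer_conjugates:
  assumes "i \<in> {1..5 :: nat}"
  obtains g where "g \<in> carrier (alt_group 5)" "g 5 = i"
proof (cases "i = 5")
  case True
  then show thesis using that[of id] by (simp add: alt_group_carrier)
next
  case False
  obtain j k l where "distinct [5, i, j, k, l]" "{1..5} = {5, i, j, k, l}"
    using obtain_two_of_five[of 5 i] assms False by auto
  then have d: "distinct [5, i, j]" "{5, i, j} \<subseteq> {1..5}" by auto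
  then show thesis
    using that[OF cyc3_in_alt_group[OF d]] cyc3_apply[OF d(1), of 5] by (simp del: cycle_of_list.simps)
qed

text \<open>One subgroup never suffices, by \<open>alt_group_5_not_union_of_conjugates\<close>. Two
  do: the point stabilizer \<open>S\<close> takes care of every element with a fixed point, and the
  group \<open>C\<close> of elements commuting with \<open>cyc5\<close> takes care of the
  five-cycles. The intersection is trivial already for the conjugates of \<open>S\<close>.\<close>

lemma covering_number_alt_group_5: "covering_number (alt_group 5) = 2"
proof -
  let ?G = "alt_group 5"
  let ?P = "\<lambda>m. \<exists>H :: nat \<Rightarrow> (nat \<Rightarrow> nat) set.
     (\<forall>i\<in>{1..m}. subgroup (H i) ?G \<and> H i \<noteq> carrier ?G) \<and>
     \<Union>(\<Union>i\<in>{1..m}. conjugates ?G (H i)) = carrier ?G \<and>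
     \<Inter>(\<Union>i\<in>{1..m}. conjugates ?G (H i)) = {\<one>\<^bsub>?G\<^esub>}"
  interpret A: group ?G by (rule alt_group_is_group)
  have not0: "\<not> ?P 0"
  proof
    assume "?P 0"
    then have "carrier ?G = {}" by auto
    then show False using A.one_closed by simp
  qed
  have not1: "\<not> ?P 1"
  proof
    assume "?P 1"
    then obtain H :: "nat \<Rightarrow> (nat \<Rightarrow> nat) set" where "subgroup (H 1) ?G" "H 1 \<noteq> carrier ?G"
      "\<Union>(conjugates ?G (H 1)) = carrier ?G" by auto
    then show False using alt_group_5_not_union_of_conjugates by blast
  qed
  define S where "S = {p \<in> carrier ?G. p 5 = 5}"
  \<comment> \<open>The centralizer of \<open>cyc5\<close> is the cyclic group it generates;
    describing it by commutation avoids an enumeration of powers.\<close>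
  define C where "C = {p \<in> carrier ?G. p \<circ> cyc5 = cyc5 \<circ> p}"
  have c123: "cyc3 3 4 5 \<in> carrier ?G" by (rule cyc3_in_alt_group) auto
  have bij: "bij p" if "p \<in> carrier ?G" for p using that permutes_bij by (auto simp: alt_group_carrier)
  have inv_in: "inv' p \<in> carrier ?G" if "p \<in> carrier ?G" for p
    using A.inv_closed[OF that] alt_group_inv_equality[OF that] by simp
  have comp_in: "p \<circ> q \<in> carrier ?G" if "p \<in> carrier ?G" "q \<in> carrier ?G" for p q
    using A.m_closed[OF that] by (simp only: alt_group_mult)
  have id_in: "id \<in> carrier ?G" using A.one_closed by (simp only: alt_group_one)
  have S: "subgroup S ?G"
  proof (rule subgroup_alt_groupI)
    show "inv' p \<in> S" if "p \<in> S" for p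
      using that inv_in inv_f_eq[OF bij_is_inj[OF bij], of p 5 5] by (auto simp: S_def)
  qed (auto simp: S_def comp_in id_in)
  have C: "subgroup C ?G"
  proof (rule subgroup_alt_groupI)
    show "p \<circ> q \<in> C" if "p \<in> C" "q \<in> C" for p q
    proof -
      have "p \<circ> q \<circ> cyc5 = p \<circ> (q \<circ> cyc5)" by (simp only: o_assoc)
      also have "\<dots> = (p \<circ> cyc5) \<circ> q" using that by (simp only: C_def mem_Collect_eq o_assoc)
      also have "\<dots> = cyc5 \<circ> (p \<circ> q)" using that by (simp only: C_def mem_Collect_eq o_assoc)
      finally show ?thesis using that comp_in by (simp add: C_def)
    qed
    show "inv' p \<in> C" if "p \<in> C" for p
    proof -
      have p: "p \<in> carrier ?G" "p \<circ> cyc5 = cyc5 \<circ> p" using that by (auto simp: C_def)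
      have ip: "inv' p \<circ> p = id" "p \<circ> inv' p = id"
        using inj_iff[THEN iffD1, OF bij_is_inj[OF bij[OF p(1)]]]
            surj_iff[THEN iffD1, OF bij_is_surj[OF bij[OF p(1)]]] by blast+
      have "inv' p \<circ> cyc5 = inv' p \<circ> (cyc5 \<circ> p) \<circ> inv' p" by (simp only: o_assoc[symmetric] ip comp_id)
      also have "\<dots> = (inv' p \<circ> p) \<circ> cyc5 \<circ> inv' p" by (simp only: p(2)[symmetric] o_assoc)
      also have "\<dots> = cyc5 \<circ> inv' p" by (simp only: ip id_comp)
      finally show ?thesis using inv_in[OF p(1)] by (simp add: C_def)
    qed
  qed (auto simp: C_def id_in)
  have d345: "distinct [3, 4, 5 :: nat]" by simp
  have "cyc3 3 4 5 \<notin> S" using cyc3_apply[OF d345, of 5] by (simp add: S_def del: cycle_of_list.simps)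
  then have S_ne: "S \<noteq> carrier ?G" using c123 by blast
  have "cyc3 3 4 5 \<notin> C"
  proof
    assume "cyc3 3 4 5 \<in> C"
    then have "(cyc3 3 4 5 \<circ> cyc5) 2 = (cyc5 \<circ> cyc3 3 4 5) 2" by (simp only: C_def mem_Collect_eq)
    then show False
      using cyc3_apply[OF d345] cyc5_apply by (simp del: cycle_of_list.simps)
  qed
  then have C_ne: "C \<noteq> carrier ?G" using c123 by blast
  define H where "H i = (if i = (1::nat) then S else C)" for i
  have two: "{1..2::nat} = {1, 2}" by auto
  have U: "(\<Union>i\<in>{1..2}. conjugates ?G (H i)) = conjugates ?G S \<union> conjugates ?G C"
    unfolding two by (simp add: H_def)
  have "?P 2"
  proof (intro exI[of _ H] conjI ballI)
    fix i show "subgroup (H i) ?G" "H i \<noteq> carrier ?G" using S C S_ne C_ne by (auto simp: H_def)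
  next
    show "\<Union>(\<Union>i\<in>{1..2}. conjugates ?G (H i)) = carrier ?G"
    proof (intro equalityI subsetI)
      fix p assume "p \<in> \<Union>(\<Union>i\<in>{1..2}. conjugates ?G (H i))"
      then obtain M where "M \<in> conjugates ?G S \<or> M \<in> conjugates ?G C" "p \<in> M"
        unfolding U by blast
      then obtain g T where "g \<in> carrier ?G" "T \<subseteq> carrier ?G"
        "p \<in> (\<lambda>h. g \<otimes>\<^bsub>?G\<^esub> h \<otimes>\<^bsub>?G\<^esub> inv\<^bsub>?G\<^esub> g) ` T"
        unfolding conjugates_iff using subgroup.subset[OF S] subgroup.subset[OF C] by blast
      then show "p \<in> carrier ?G" by auto
    next
      fix p assume p: "p \<in> carrier ?G"
      then have pp: "p permutes {1..5}" "evenperm p" by (auto simp: alt_group_carrier)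
      have "p \<in> \<Union>(conjugates ?G S) \<or> p \<in> \<Union>(conjugates ?G C)"
      proof (cases "\<exists>i\<in>{1..5}. p i = i")
        case True
        then obtain i where i: "i \<in> {1..5}" "p i = i" by blast
        obtain g where g: "g \<in> carrier ?G" "g 5 = i" using point_stabilizer_conjugates[OF i(1)] .
        have ip: "inv' g \<circ> g = id" "g \<circ> inv' g = id"
          using inj_iff[THEN iffD1, OF bij_is_inj[OF bij[OF g(1)]]]
            surj_iff[THEN iffD1, OF bij_is_surj[OF bij[OF g(1)]]] by blast+
        have "(inv' g \<circ> (p \<circ> g)) 5 = 5" using g(2) i(2) inv_f_f[OF bij_is_inj[OF bij[OF g(1)]], of 5] by simp
        then have "inv' g \<circ> (p \<circ> g) \<in> S" using comp_in inv_in g(1) p by (simp add: S_def)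
        moreover have "p \<circ> g = g \<circ> (inv' g \<circ> (p \<circ> g))" by (simp only: o_assoc ip id_comp)
        ultimately show ?thesis using in_conjugateI[OF g(1)] by blast
      next
        case False
        then obtain a b c d e where abc: "distinct [a, b, c, d, e]" "{1..5} = {a, b, c, d, e}"
          "p = cycle_of_list [a, b, c, d, e]"
          using even_perm_five_without_fixed_point[OF pp] by blast
        obtain g where g: "g \<in> carrier ?G" "p \<circ> p \<circ> g = g \<circ> cyc5 \<or> p \<circ> g = g \<circ> cyc5"
          using even_conjugator_into_centralizer[OF abc(1,2)] unfolding abc(3)[symmetric] by blast
        have ip: "inv' g \<circ> g = id" "g \<circ> inv' g = id"
          using inj_iff[THEN iffD1, OF bij_is_inj[OF bij[OF g(1)]]]
            surj_iff[THEN iffD1, OF bij_is_surj[OF bij[OF g(1)]]] by blast+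
        \<comment> \<open>Five-cycles form two classes in A5, so \<open>p\<close> itself need not be
          conjugate to \<open>cyc5\<close>. In either case \<open>cyc5\<close> is q or q^2 for this
          conjugate q of \<open>p\<close>, so q commutes with it.\<close>
        define q where "q = inv' g \<circ> (p \<circ> g)"
        have pg: "p \<circ> g = g \<circ> q" by (simp only: q_def o_assoc ip id_comp)
        have "g \<circ> cyc5 = g \<circ> q \<circ> q \<or> g \<circ> cyc5 = g \<circ> q"
          using g(2) pg by (metis o_assoc)
        then have "inv' g \<circ> (g \<circ> cyc5) = inv' g \<circ> (g \<circ> (q \<circ> q)) \<or> inv' g \<circ> (g \<circ> cyc5) = inv' g \<circ> (g \<circ> q)"
          by (metis o_assoc)
        then have "cyc5 = q \<circ> q \<or> cyc5 = q" by (simp only: o_assoc ip id_comp)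
        then have "q \<circ> cyc5 = cyc5 \<circ> q" by (elim disjE) (simp_all only: o_assoc)
        then have "q \<in> C" using comp_in inv_in g(1) p by (simp add: C_def q_def)
        then show ?thesis using in_conjugateI[OF g(1) _ pg] by blast
      qed
      then show "p \<in> \<Union>(\<Union>i\<in>{1..2}. conjugates ?G (H i))" unfolding U by blast
    qed
  next
    have one_in: "\<one>\<^bsub>?G\<^esub> \<in> M" if M0: "M \<in> conjugates ?G S \<union> conjugates ?G C" for M
    proof -
      obtain g T where M: "g \<in> carrier ?G" "T = S \<or> T = C" "M = (\<lambda>h. g \<otimes>\<^bsub>?G\<^esub> h \<otimes>\<^bsub>?G\<^esub> inv\<^bsub>?G\<^esub> g) ` T"
        using M0 unfolding Un_iff conjugates_iff by blast
      have "\<one>\<^bsub>?G\<^esub> \<in> T" using M(2) subgroup.one_closed[OF S] subgroup.one_closed[OF C] by blast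
      moreover have "\<one>\<^bsub>?G\<^esub> = g \<otimes>\<^bsub>?G\<^esub> \<one>\<^bsub>?G\<^esub> \<otimes>\<^bsub>?G\<^esub> inv\<^bsub>?G\<^esub> g" using M(1) by simp
      ultimately show ?thesis unfolding M(3) by (intro image_eqI[where x = "\<one>\<^bsub>?G\<^esub>"])
    qed
    \<comment> \<open>The conjugates of \<open>S\<close> are the stabilizers of the five points, so
      a common element fixes every point.\<close>
    have "p = id" if p: "p \<in> \<Inter>(conjugates ?G S \<union> conjugates ?G C)" for p
    proof -
      have fx: "p i = i" "p \<in> carrier ?G" if i: "i \<in> {1..5}" for i
      proof -
        obtain g where g: "g \<in> carrier ?G" "g 5 = i" using point_stabilizer_conjugates[OF i] .
        have "(\<lambda>h. g \<otimes>\<^bsub>?G\<^esub> h \<otimes>\<^bsub>?G\<^esub> inv\<^bsub>?G\<^esub> g) ` S \<in> conjugates ?G S"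
          unfolding conjugates_iff using g(1) by blast
        then have "p \<in> (\<lambda>h. g \<otimes>\<^bsub>?G\<^esub> h \<otimes>\<^bsub>?G\<^esub> inv\<^bsub>?G\<^esub> g) ` S" using p by blast
        then obtain h where h: "h \<in> S" "p = g \<circ> h \<circ> inv' g" unfolding conj_alt_group[OF g(1)] by blast
        have "inv' g i = 5" using inv_f_f[OF bij_is_inj[OF bij[OF g(1)]], of 5] g(2) by simp
        then show "p i = i" using h g(2) by (simp add: S_def)
        show "p \<in> carrier ?G" using h comp_in inv_in g(1) by (simp add: S_def)
      qed
      have "p permutes {1..5}" using fx(2)[of 1] by (simp add: alt_group_carrier)
      then have "p x = id x" for x using fx(1)[of x] permutes_not_in[of p "{1..5}" x] by (cases "x \<in> {1..5}") auto
      then show "p = id" by (rule ext)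
    qed
    then show "\<Inter>(\<Union>i\<in>{1..2}. conjugates ?G (H i)) = {\<one>\<^bsub>?G\<^esub>}"
      unfolding U alt_group_one using one_in[unfolded alt_group_one] by blast
  qed
  then have "(LEAST m. ?P m) = 2"
  proof (rule Least_equality)
    fix m assume m: "?P m"
    have "m \<noteq> 0" using m not0 by metis
    moreover have "m \<noteq> 1" using m not1 by metis
    ultimately show "2 \<le> m" by linarith
  qed
  then show ?thesis unfolding covering_number_def .
qed

section \<open>Linear disjointness of simple Galois extensions\<close>

lemma iso_normal_image:
  assumes G: "group G" and H: "group H" and f: "f \<in> iso G H" and N: "N \<lhd> G"
  shows "f ` N \<lhd> H"
proof -
  interpret G: group G by (rule G)
  interpret H: group H by (rule H)
  have hom: "f \<in> hom G H" and bij: "bij_betw f (carrier G) (carrier H)"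
    using f by (auto simp: iso_def)
  interpret gh: group_hom G H f by unfold_locales (rule hom)
  have sub: "subgroup N G" using N by (rule normal_imp_subgroup)
  have Nc: "N \<subseteq> carrier G" by (rule subgroup.subset[OF sub])
  show ?thesis
    unfolding H.normal_inv_iff
  proof (intro conjI ballI)
    show "subgroup (f ` N) H" by (rule gh.subgroup_img_is_subgroup[OF sub])
    fix x h assume x: "x \<in> carrier H" and "h \<in> f ` N"
    then obtain n where n: "n \<in> N" "h = f n" by blast
    obtain g where g: "g \<in> carrier G" "x = f g" using x bij by (auto simp: bij_betw_def)
    have "x \<otimes>\<^bsub>H\<^esub> h \<otimes>\<^bsub>H\<^esub> inv\<^bsub>H\<^esub> x = f (g \<otimes>\<^bsub>G\<^esub> n \<otimes>\<^bsub>G\<^esub> inv\<^bsub>G\<^esub> g)"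
      using n g Nc by (simp add: subset_iff)
    moreover have "g \<otimes>\<^bsub>G\<^esub> n \<otimes>\<^bsub>G\<^esub> inv\<^bsub>G\<^esub> g \<in> N" by (rule normal.inv_op_closed2[OF N g(1) n(1)])
    ultimately show "x \<otimes>\<^bsub>H\<^esub> h \<otimes>\<^bsub>H\<^esub> inv\<^bsub>H\<^esub> x \<in> f ` N" by simp
  qed
qed

lemma normal_subgroup_of_A5_copy:
  assumes G: "group G" and iso: "G \<cong> alt_group 5" and N: "N \<lhd> G" "N \<noteq> {\<one>\<^bsub>G\<^esub>}"
  shows "N = carrier G"
proof -
  interpret G: group G by (rule G)
  obtain f where f: "f \<in> iso G (alt_group 5)" using iso by (auto simp: is_iso_def)
  have bij: "bij_betw f (carrier G) (carrier (alt_group 5))" using f by (simp add: iso_def)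
  have hom: "f \<in> hom G (alt_group 5)" using f by (simp add: iso_def)
  have one: "f \<one>\<^bsub>G\<^esub> = id"
    using hom_one[OF hom G alt_group_is_group] by (simp only: alt_group_one)
  have sub: "subgroup N G" using N(1) by (rule normal_imp_subgroup)
  have Nc: "N \<subseteq> carrier G" and oneN: "\<one>\<^bsub>G\<^esub> \<in> N"
    using subgroup.subset[OF sub] subgroup.one_closed[OF sub] by auto
  have inj: "inj_on f (carrier G)" using bij by (simp add: bij_betw_def)
  obtain n where n: "n \<in> N" "n \<noteq> \<one>\<^bsub>G\<^esub>" using N(2) oneN by blast
  have "f n \<noteq> id"
  proof
    assume "f n = id"
    then have "f n = f \<one>\<^bsub>G\<^esub>" using one by simp
    then show False using inj_onD[OF inj, of n "\<one>\<^bsub>G\<^esub>"] n Nc by auto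
  qed
  then have "f ` N \<noteq> {id}" using n(1) by blast
  then have "f ` N = carrier (alt_group 5)"
    by (intro normal_subgroup_alt_group_5 iso_normal_image[OF G alt_group_is_group f N(1)])
  then have "f ` N = f ` carrier G" using bij by (simp add: bij_betw_def)
  then show ?thesis using inj_on_image_eq_iff[OF inj Nc subset_refl] by simp
qed

lemma alt_group_5_noncommuting:
  obtains p q where "p \<in> carrier (alt_group 5)" "q \<in> carrier (alt_group 5)" "p \<circ> q \<noteq> q \<circ> p"
proof -
  have d: "distinct [1, 2, 3 :: nat]" "distinct [3, 4, 5 :: nat]" by simp_all
  have "(cyc3 1 2 3 \<circ> cyc3 3 4 5) 2 \<noteq> (cyc3 3 4 5 \<circ> cyc3 1 2 3) 2"
    unfolding comp_apply cyc3_apply[OF d(1)] cyc3_apply[OF d(2)] by simp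
  then have "cyc3 1 2 3 \<circ> cyc3 3 4 5 \<noteq> cyc3 3 4 5 \<circ> cyc3 1 2 3" by metis
  then show thesis by (intro that[of "cyc3 1 2 3" "cyc3 3 4 5"] cyc3_in_alt_group) auto
qed

text \<open>The centre is a normal subgroup. If it contained \<open>z\<close>, it would be the whole
  group by simplicity, and A5 is not abelian.\<close>

lemma A5_copy_noncentral:
  assumes G: "group G" and iso: "G \<cong> alt_group 5" and z: "z \<in> carrier G" "z \<noteq> \<one>\<^bsub>G\<^esub>"
  obtains g where "g \<in> carrier G" "g \<otimes>\<^bsub>G\<^esub> z \<noteq> z \<otimes>\<^bsub>G\<^esub> g"
proof (rule ccontr)
  assume not: "\<not> thesis"
  interpret G: group G by (rule G)
  obtain f where f: "f \<in> iso G (alt_group 5)" using iso by (auto simp: is_iso_def)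
  have bij: "bij_betw f (carrier G) (carrier (alt_group 5))" and hom: "f \<in> hom G (alt_group 5)"
    using f by (auto simp: iso_def)
  have all: "g \<otimes>\<^bsub>G\<^esub> z = z \<otimes>\<^bsub>G\<^esub> g" if "g \<in> carrier G" for g using not that \<open>\<And>g. g \<in> carrier G \<Longrightarrow> g \<otimes>\<^bsub>G\<^esub> z \<noteq> z \<otimes>\<^bsub>G\<^esub> g \<Longrightarrow> thesis\<close> by blast
  define Z where "Z = {x \<in> carrier G. \<forall>g\<in>carrier G. g \<otimes>\<^bsub>G\<^esub> x = x \<otimes>\<^bsub>G\<^esub> g}"
  have inv_comm: "g \<otimes>\<^bsub>G\<^esub> inv\<^bsub>G\<^esub> x = inv\<^bsub>G\<^esub> x \<otimes>\<^bsub>G\<^esub> g"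
    if "x \<in> carrier G" "g \<in> carrier G" "g \<otimes>\<^bsub>G\<^esub> x = x \<otimes>\<^bsub>G\<^esub> g" for x g
    using that by (metis G.inv_closed G.inv_solve_left G.inv_solve_right G.m_assoc G.m_closed)
  have "subgroup Z G"
  proof (rule G.subgroupI)
    show "x \<otimes>\<^bsub>G\<^esub> y \<in> Z" if "x \<in> Z" "y \<in> Z" for x y
    proof -
      have xy: "x \<in> carrier G" "y \<in> carrier G" using that by (auto simp: Z_def)
      have "g \<otimes>\<^bsub>G\<^esub> (x \<otimes>\<^bsub>G\<^esub> y) = x \<otimes>\<^bsub>G\<^esub> y \<otimes>\<^bsub>G\<^esub> g" if g: "g \<in> carrier G" for g
      proof -
        have zx: "g \<otimes>\<^bsub>G\<^esub> x = x \<otimes>\<^bsub>G\<^esub> g" "g \<otimes>\<^bsub>G\<^esub> y = y \<otimes>\<^bsub>G\<^esub> g"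
          using \<open>x \<in> Z\<close> \<open>y \<in> Z\<close> g by (simp_all add: Z_def)
        have "g \<otimes>\<^bsub>G\<^esub> (x \<otimes>\<^bsub>G\<^esub> y) = (g \<otimes>\<^bsub>G\<^esub> x) \<otimes>\<^bsub>G\<^esub> y" using xy g by (simp add: G.m_assoc)
        also have "\<dots> = x \<otimes>\<^bsub>G\<^esub> (g \<otimes>\<^bsub>G\<^esub> y)" using xy g unfolding zx(1) by (simp add: G.m_assoc)
        also have "\<dots> = x \<otimes>\<^bsub>G\<^esub> (y \<otimes>\<^bsub>G\<^esub> g)" unfolding zx(2) ..
        finally show ?thesis using xy g by (simp add: G.m_assoc)
      qed
      then show ?thesis using xy by (simp add: Z_def)
    qed
    show "inv\<^bsub>G\<^esub> x \<in> Z" if "x \<in> Z" for x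
      using that inv_comm by (simp add: Z_def)
    show "Z \<noteq> {}" using z(1) all by (auto simp: Z_def)
  qed (auto simp: Z_def)
  moreover have "x \<otimes>\<^bsub>G\<^esub> h \<otimes>\<^bsub>G\<^esub> inv\<^bsub>G\<^esub> x \<in> Z" if "x \<in> carrier G" "h \<in> Z" for x h
  proof -
    have "x \<otimes>\<^bsub>G\<^esub> h \<otimes>\<^bsub>G\<^esub> inv\<^bsub>G\<^esub> x = h \<otimes>\<^bsub>G\<^esub> (x \<otimes>\<^bsub>G\<^esub> inv\<^bsub>G\<^esub> x)"
      using that by (simp add: Z_def G.m_assoc del: G.r_inv)
    then show ?thesis using that by (simp add: Z_def)
  qed
  ultimately have "Z \<lhd> G" unfolding G.normal_inv_iff by blast
  moreover have "Z \<noteq> {\<one>\<^bsub>G\<^esub>}" using z all by (auto simp: Z_def)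
  ultimately have ZG: "Z = carrier G" by (rule normal_subgroup_of_A5_copy[OF G iso])
  obtain p q where pq: "p \<in> carrier (alt_group 5)" "q \<in> carrier (alt_group 5)" "p \<circ> q \<noteq> q \<circ> p"
    by (rule alt_group_5_noncommuting)
  obtain x y where xy: "x \<in> carrier G" "y \<in> carrier G" "p = f x" "q = f y"
    using pq(1,2) bij unfolding bij_betw_def by (metis imageE)
  have "y \<in> Z" using xy(2) ZG by blast
  then have "x \<otimes>\<^bsub>G\<^esub> y = y \<otimes>\<^bsub>G\<^esub> x" using xy(1) by (simp add: Z_def)
  then have "f x \<otimes>\<^bsub>alt_group 5\<^esub> f y = f y \<otimes>\<^bsub>alt_group 5\<^esub> f x"
    using hom_mult[OF hom xy(1,2)] hom_mult[OF hom xy(2,1)] by simp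
  then show False using pq(3) xy(3,4) by (simp only: alt_group_mult)
qed

section \<open>Fields with Galois group A5 and their composita\<close>

definition A5_field :: "complex set \<Rightarrow> bool" where
  "A5_field K \<longleftrightarrow> normal_field K \<and> galois_group K \<cong> alt_group 5"

lemma A5_field_card:
  assumes "A5_field K"
  shows "card (carrier (galois_group K)) = 60" "finite (carrier (galois_group K))"
proof -
  obtain f where "f \<in> iso (galois_group K) (alt_group 5)"
    using assms by (auto simp: A5_field_def is_iso_def)
  then have bij: "bij_betw f (carrier (galois_group K)) (carrier (alt_group 5))" by (simp add: iso_def)
  show "card (carrier (galois_group K)) = 60"
    using bij_betw_same_card[OF bij] order_alt_group_5 by (simp add: Coset.order_def)
  then show "finite (carrier (galois_group K))" by (simp add: card_ge_0_finite)
qed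

text \<open>The restrictions of \<open>T\<close> to \<open>K\<close> form a normal subgroup of a
  simple group, and this subgroup is nontrivial because \<open>\<sigma>0\<close> moves
  \<open>x0\<close>. In the applications \<open>T\<close> is the set of automorphisms fixing a
  family of other normal fields.\<close>

lemma A5_field_image_full:
  assumes K: "A5_field K" and T: "\<And>\<sigma>. \<sigma> \<in> T \<Longrightarrow> galois_aut \<sigma>"
    and comp: "\<And>\<sigma> \<tau>. \<sigma> \<in> T \<Longrightarrow> \<tau> \<in> T \<Longrightarrow> (\<lambda>x. \<sigma> (\<tau> x)) \<in> T"
    and conj: "\<And>\<sigma> \<upsilon> \<upsilon>'. \<sigma> \<in> T \<Longrightarrow> galois_aut \<upsilon> \<Longrightarrow> galois_aut \<upsilon>' \<Longrightarrow>
      (\<And>x. algebraic x \<Longrightarrow> \<upsilon> (\<upsilon>' x) = x) \<Longrightarrow> (\<lambda>x. \<upsilon> (\<sigma> (\<upsilon>' x))) \<in> T"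
    and \<sigma>0: "\<sigma>0 \<in> T" "x0 \<in> K" "\<sigma>0 x0 \<noteq> x0"
    and \<tau>: "galois_aut \<tau>"
  obtains \<sigma> where "\<sigma> \<in> T" "\<And>x. x \<in> K \<Longrightarrow> \<sigma> x = \<tau> x"
proof -
  have n: "normal_field K" and iso: "galois_group K \<cong> alt_group 5" using K by (auto simp: A5_field_def)
  note gm = galois_group_mult[OF n]
  interpret G: group "galois_group K" by (rule galois_group_is_group[OF n])
  define N where "N = {restrict \<sigma> K | \<sigma>. \<sigma> \<in> T}"
  have Nc: "N \<subseteq> carrier (galois_group K)"
    unfolding N_def galois_group_carrier[OF n] using T by blast
  have Nm: "f \<otimes>\<^bsub>galois_group K\<^esub> g \<in> N" if fg: "f \<in> N" "g \<in> N" for f g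
  proof -
    obtain \<sigma> \<tau> where e: "\<sigma> \<in> T" "f = restrict \<sigma> K" "\<tau> \<in> T" "g = restrict \<tau> K"
      using fg unfolding N_def by blast
    show ?thesis unfolding e(2,4) gm[OF T[OF e(1)] T[OF e(3)]] N_def using comp[OF e(1,3)] by blast
  qed
  have "restrict \<sigma>0 K \<in> N" using \<sigma>0(1) by (auto simp: N_def)
  have "subgroup N (galois_group K)"
  proof (rule G.subgroupI[OF Nc])
    show "N \<noteq> {}" using \<open>restrict \<sigma>0 K \<in> N\<close> by blast
    \<comment> \<open>In a group of order 60 the inverse of \<open>x\<close> is \<open>x\<close> to
      the power 59. The powers are indexed by \<open>Suc k\<close> because the neutral element is
      not yet known to lie in \<open>N\<close>.\<close>
    show inv_N: "inv\<^bsub>galois_group K\<^esub> x \<in> N" if x: "x \<in> N" for x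
    proof -
      have xc: "x \<in> carrier (galois_group K)" using x Nc by blast
      have pow: "x [^]\<^bsub>galois_group K\<^esub> Suc k \<in> N" for k
        by (induction k) (use x xc Nm in auto)
      have "x [^]\<^bsub>galois_group K\<^esub> (60::nat) = \<one>\<^bsub>galois_group K\<^esub>"
        using G.pow_order_eq_1[OF xc] A5_field_card(1)[OF K] by (simp add: Coset.order_def)
      moreover have "x [^]\<^bsub>galois_group K\<^esub> (60::nat) = x [^]\<^bsub>galois_group K\<^esub> (59::nat) \<otimes>\<^bsub>galois_group K\<^esub> x"
        using G.nat_pow_Suc[of x 59] by simp
      ultimately have "inv\<^bsub>galois_group K\<^esub> x = x [^]\<^bsub>galois_group K\<^esub> (59::nat)"
        using xc by (intro G.inv_equality) auto
      then show ?thesis using pow[of 58] by simp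
    qed
  qed (rule Nm)
  moreover have "x \<otimes>\<^bsub>galois_group K\<^esub> h \<otimes>\<^bsub>galois_group K\<^esub> inv\<^bsub>galois_group K\<^esub> x \<in> N"
    if xh: "x \<in> carrier (galois_group K)" "h \<in> N" for x h
  proof -
    obtain \<sigma> \<upsilon> where e: "galois_aut \<upsilon>" "x = restrict \<upsilon> K" "\<sigma> \<in> T" "h = restrict \<sigma> K"
      using xh unfolding N_def galois_group_carrier[OF n] by blast
    obtain \<upsilon>' where v: "galois_aut \<upsilon>'" "\<And>x. algebraic x \<Longrightarrow> \<upsilon>' (\<upsilon> x) = x" "\<And>x. algebraic x \<Longrightarrow> \<upsilon> (\<upsilon>' x) = x"
      by (rule galois_aut_inverse[OF e(1)]) blast
    have "inv\<^bsub>galois_group K\<^esub> x = restrict \<upsilon>' K"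
    proof (rule G.inv_equality)
      show "restrict \<upsilon>' K \<otimes>\<^bsub>galois_group K\<^esub> x = \<one>\<^bsub>galois_group K\<^esub>"
        unfolding e galois_group_one gm[OF v(1) e(1)]
        by (rule restrict_ext) (use v(2) normal_fieldD(2)[OF n] in auto)
      show "restrict \<upsilon>' K \<in> carrier (galois_group K)"
        unfolding galois_group_carrier[OF n] using v(1) by blast
    qed (rule xh(1))
    then have "x \<otimes>\<^bsub>galois_group K\<^esub> h \<otimes>\<^bsub>galois_group K\<^esub> inv\<^bsub>galois_group K\<^esub> x
        = restrict (\<lambda>x. \<upsilon> (\<sigma> (\<upsilon>' x))) K"
      unfolding e(2,4) by (simp only: gm e(1) T[OF e(3)] v(1) galois_aut_comp)
    then show ?thesis unfolding N_def using conj[OF e(3,1) v(1,3)] by blast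
  qed
  ultimately have "N \<lhd> galois_group K" unfolding G.normal_inv_iff by blast
  moreover have "N \<noteq> {\<one>\<^bsub>galois_group K\<^esub>}"
  proof
    assume "N = {\<one>\<^bsub>galois_group K\<^esub>}"
    then have "restrict \<sigma>0 K = restrict (\<lambda>x. x) K"
      using \<open>restrict \<sigma>0 K \<in> N\<close> unfolding galois_group_one by blast
    then show False using \<sigma>0(2,3) by (metis restrict_apply')
  qed
  ultimately have "N = carrier (galois_group K)"
    by (rule normal_subgroup_of_A5_copy[OF G.is_group iso])
  then have "restrict \<tau> K \<in> N" unfolding galois_group_carrier[OF n] using \<tau> by blast
  then obtain \<sigma> where s: "\<sigma> \<in> T" "restrict \<tau> K = restrict \<sigma> K" unfolding N_def by blast
  have "\<sigma> x = \<tau> x" if "x \<in> K" for x using fun_cong[OF s(2), of x] that by simp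
  then show thesis using that s(1) by blast
qed

text \<open>For fields of algebraic numbers this is the absolute Galois group of their compositum,
  described without forming the compositum.\<close>

definition fixing :: "complex set set \<Rightarrow> (complex \<Rightarrow> complex) set" where
  "fixing \<F> = {\<sigma>. galois_aut \<sigma> \<and> (\<forall>K\<in>\<F>. \<forall>x\<in>K. \<sigma> x = x)}"

lemma fixing_comp: "\<sigma> \<in> fixing \<F> \<Longrightarrow> \<tau> \<in> fixing \<F> \<Longrightarrow> (\<lambda>x. \<sigma> (\<tau> x)) \<in> fixing \<F>"
  by (auto simp: fixing_def galois_aut_comp)

lemma fixing_conj:
  assumes "\<And>K. K \<in> \<F> \<Longrightarrow> normal_field K" "\<sigma> \<in> fixing \<F>" "galois_aut \<upsilon>" "galois_aut \<upsilon>'"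
    "\<And>x. algebraic x \<Longrightarrow> \<upsilon> (\<upsilon>' x) = x"
  shows "(\<lambda>x. \<upsilon> (\<sigma> (\<upsilon>' x))) \<in> fixing \<F>"
proof -
  have "galois_aut (\<lambda>x. \<upsilon> (\<sigma> (\<upsilon>' x)))"
    using galois_aut_comp[OF assms(3) galois_aut_comp[of \<sigma> \<upsilon>']] assms(2,4) by (simp add: fixing_def)
  moreover have "\<upsilon> (\<sigma> (\<upsilon>' x)) = x" if "K \<in> \<F>" "x \<in> K" for K x
  proof -
    have "\<upsilon>' x \<in> K" using normal_fieldD(3)[OF assms(1)[OF that(1)] assms(4) that(2)] .
    then have "\<sigma> (\<upsilon>' x) = \<upsilon>' x" using assms(2) that(1) by (auto simp: fixing_def)
    then show ?thesis using assms(5) normal_fieldD(2)[OF assms(1)[OF that(1)] that(2)] by simp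
  qed
  ultimately show ?thesis by (simp add: fixing_def)
qed

text \<open>If \<open>K\<close> is not contained in \<open>K'\<close>, an element of
  \<open>K\<close> outside \<open>K'\<close> is moved over \<open>K'\<close>. If \<open>K\<close>
  were a proper subfield of \<open>K'\<close>, restriction from the group of \<open>K'\<close> to
  that of \<open>K\<close> would be a surjection between groups of order 60, hence injective; yet an
  automorphism over \<open>K\<close> that moves an element of \<open>K'\<close> lies in its
  kernel.\<close>

lemma A5_fields_moved:
  assumes K: "A5_field K" and K': "A5_field K'" and ne: "K \<noteq> K'"
  obtains \<tau> x where "\<tau> \<in> fixing {K'}" "x \<in> K" "\<tau> x \<noteq> x"
proof (cases "K \<subseteq> K'")
  case False
  have n: "normal_field K" "normal_field K'" using K K' by (auto simp: A5_field_def)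
  from False obtain x where x: "x \<in> K" "x \<notin> K'" by blast
  obtain \<tau> where "galois_aut \<tau>" "\<And>y. y \<in> K' \<Longrightarrow> \<tau> y = y" "\<tau> x \<noteq> x"
    using galois_aut_moves[OF normal_fieldD(1)[OF n(2)] normal_fieldD(2)[OF n(1) x(1)] x(2)] by blast
  then show thesis using that[of \<tau> x] x(1) by (simp add: fixing_def)
next
  case True
  have n: "normal_field K" "normal_field K'" using K K' by (auto simp: A5_field_def)
  obtain x where x: "x \<in> K'" "x \<notin> K" using True ne by blast
  obtain \<tau> where \<tau>: "galois_aut \<tau>" "\<And>y. y \<in> K \<Longrightarrow> \<tau> y = y" "\<tau> x \<noteq> x"
    using galois_aut_moves[OF normal_fieldD(1)[OF n(1)] normal_fieldD(2)[OF n(2) x(1)] x(2)] by blast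
  define R where "R f = restrict f K" for f :: "complex \<Rightarrow> complex"
  have R: "R (restrict \<sigma> K') = restrict \<sigma> K" for \<sigma>
    unfolding R_def using True by (intro ext) (auto simp: restrict_def)
  have "R ` carrier (galois_group K') = carrier (galois_group K)"
  proof
    show "R ` carrier (galois_group K') \<subseteq> carrier (galois_group K)"
      unfolding galois_group_carrier[OF n(1)] galois_group_carrier[OF n(2)] using R by blast
    show "carrier (galois_group K) \<subseteq> R ` carrier (galois_group K')"
    proof
      fix f assume "f \<in> carrier (galois_group K)"
      then obtain \<sigma> where "galois_aut \<sigma>" "f = R (restrict \<sigma> K')"
        unfolding galois_group_carrier[OF n(1)] R by blast
      then show "f \<in> R ` carrier (galois_group K')"
        unfolding galois_group_carrier[OF n(2)] by blast
    qed
  qed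
  then have "card (R ` carrier (galois_group K')) = card (carrier (galois_group K'))"
    using A5_field_card[OF K] A5_field_card[OF K'] by simp
  then have inj: "inj_on R (carrier (galois_group K'))"
    by (rule eq_card_imp_inj_on[OF A5_field_card(2)[OF K']])
  have "R (restrict \<tau> K') = R (restrict (\<lambda>x. x) K')"
    unfolding R by (rule restrict_ext) (rule \<tau>(2))
  moreover have "restrict \<tau> K' \<in> carrier (galois_group K')"
    "restrict (\<lambda>x. x) K' \<in> carrier (galois_group K')"
    unfolding galois_group_carrier[OF n(2)] using \<tau>(1) galois_aut_id by blast+
  ultimately have "restrict \<tau> K' = restrict (\<lambda>x. x) K'" using inj by (auto dest: inj_onD)
  from fun_cong[OF this, of x] show thesis using x(1) \<tau>(3) by simp
qed

text \<open>Induction on the family by commutators. If \<tau> fixes \<open>K'\<close>, \<sigma>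
  fixes the earlier fields, and their actions on \<open>K\<close> do not commute, then the
  commutator of \<sigma> and \<tau> fixes all these fields, by normality, and still moves
  \<open>K\<close>. Pairwise distinctness thus becomes joint independence.\<close>

lemma A5_fields_joint_fixing:
  assumes "finite \<F>" "\<And>K. K \<in> \<F> \<Longrightarrow> A5_field K" "A5_field K" "K \<notin> \<F>"
  obtains \<sigma> x where "\<sigma> \<in> fixing \<F>" "x \<in> K" "\<sigma> x \<noteq> x"
proof -
  have n: "normal_field K" and A5_iso: "galois_group K \<cong> alt_group 5"
    using assms(3) by (auto simp: A5_field_def)
  have "\<exists>\<sigma>\<in>fixing \<F>. \<exists>x\<in>K. \<sigma> x \<noteq> x"
    using assms(1,2,4)
  proof (induction \<F> rule: finite_induct)
    case empty
    have "card (carrier (galois_group K)) \<noteq> 1" using A5_field_card(1)[OF assms(3)] by simp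
    then have "carrier (galois_group K) \<noteq> {\<one>\<^bsub>galois_group K\<^esub>}" by (metis card_1_singleton_iff One_nat_def)
    moreover have "\<one>\<^bsub>galois_group K\<^esub> \<in> carrier (galois_group K)"
      using group.is_monoid[OF galois_group_is_group[OF n]] by (rule monoid.one_closed)
    ultimately obtain f where f: "f \<in> carrier (galois_group K)" "f \<noteq> \<one>\<^bsub>galois_group K\<^esub>" by blast
    then obtain \<sigma> where "galois_aut \<sigma>" "f = restrict \<sigma> K" unfolding galois_group_carrier[OF n] by blast
    moreover from this have "\<exists>x\<in>K. \<sigma> x \<noteq> x" using f(2) unfolding galois_group_one by (metis restrict_ext)
    ultimately show ?case by (auto simp: fixing_def)
  next
    case (insert K' \<F>)
    have K': "A5_field K'" "K \<noteq> K'" using insert.prems by auto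
    have n': "normal_field K''" if "K'' \<in> insert K' \<F>" for K''
      using insert.prems(1)[OF that] by (simp add: A5_field_def)
    obtain \<sigma>0 x0 where s0: "\<sigma>0 \<in> fixing \<F>" "x0 \<in> K" "\<sigma>0 x0 \<noteq> x0"
      using insert.IH insert.prems by auto
    obtain \<tau> x where t: "\<tau> \<in> fixing {K'}" "x \<in> K" "\<tau> x \<noteq> x"
      by (rule A5_fields_moved[OF assms(3) K'])
    have ta: "galois_aut \<tau>" using t(1) by (simp add: fixing_def)
    have tc: "restrict \<tau> K \<in> carrier (galois_group K)" unfolding galois_group_carrier[OF n] using ta by blast
    moreover have "restrict \<tau> K \<noteq> \<one>\<^bsub>galois_group K\<^esub>"
      unfolding galois_group_one using t(2,3) by (metis restrict_apply')
    ultimately obtain g where g: "g \<in> carrier (galois_group K)"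
      "g \<otimes>\<^bsub>galois_group K\<^esub> restrict \<tau> K \<noteq> restrict \<tau> K \<otimes>\<^bsub>galois_group K\<^esub> g"
      by (rule A5_copy_noncentral[OF galois_group_is_group[OF n] A5_iso])
    obtain \<upsilon> where v: "galois_aut \<upsilon>" "g = restrict \<upsilon> K" using g(1) unfolding galois_group_carrier[OF n] by blast
    \<comment> \<open>Simplicity allows the noncommuting partner of \<tau> on \<open>K\<close> to be
      realized by an automorphism that fixes all earlier fields.\<close>
    obtain \<sigma> where s: "\<sigma> \<in> fixing \<F>" "\<And>x. x \<in> K \<Longrightarrow> \<sigma> x = \<upsilon> x"
    proof (rule A5_field_image_full[OF assms(3), of "fixing \<F>" \<sigma>0 x0 \<upsilon>])
      show "galois_aut \<sigma>" if "\<sigma> \<in> fixing \<F>" for \<sigma> using that by (simp add: fixing_def)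
      show "(\<lambda>x. \<sigma> (\<tau> x)) \<in> fixing \<F>" if "\<sigma> \<in> fixing \<F>" "\<tau> \<in> fixing \<F>" for \<sigma> \<tau>
        by (rule fixing_comp[OF that])
      show "(\<lambda>x. \<upsilon> (\<sigma> (\<upsilon>' x))) \<in> fixing \<F>"
        if "\<sigma> \<in> fixing \<F>" "galois_aut \<upsilon>" "galois_aut \<upsilon>'" "\<And>x. algebraic x \<Longrightarrow> \<upsilon> (\<upsilon>' x) = x" for \<sigma> \<upsilon> \<upsilon>'
        using fixing_conj[OF _ that] n' by blast
    qed (use s0 v(1) in blast)+
    have sa: "galois_aut \<sigma>" using s(1) by (simp add: fixing_def)
    have "\<exists>y\<in>K. \<sigma> (\<tau> y) \<noteq> \<tau> (\<sigma> y)"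
    proof (rule ccontr)
      assume "\<not> (\<exists>y\<in>K. \<sigma> (\<tau> y) \<noteq> \<tau> (\<sigma> y))"
      then have "restrict (\<lambda>x. \<upsilon> (\<tau> x)) K = restrict (\<lambda>x. \<tau> (\<upsilon> x)) K"
        using s(2) normal_fieldD(3)[OF n ta] by (intro restrict_ext) metis
      then show False using g(2) unfolding v(2) galois_group_mult[OF n v(1) ta] galois_group_mult[OF n ta v(1)] by blast
    qed
    then obtain y where y: "y \<in> K" "\<sigma> (\<tau> y) \<noteq> \<tau> (\<sigma> y)" by blast
    obtain \<sigma>' where s': "galois_aut \<sigma>'" "\<And>x. algebraic x \<Longrightarrow> \<sigma>' (\<sigma> x) = x" "\<And>x. algebraic x \<Longrightarrow> \<sigma> (\<sigma>' x) = x"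
      by (rule galois_aut_inverse[OF sa]) blast
    obtain \<tau>' where t': "galois_aut \<tau>'" "\<And>x. algebraic x \<Longrightarrow> \<tau>' (\<tau> x) = x" "\<And>x. algebraic x \<Longrightarrow> \<tau> (\<tau>' x) = x"
      by (rule galois_aut_inverse[OF ta]) blast
    have s'F: "\<sigma>' \<in> fixing \<F>"
      unfolding fixing_def
    proof (intro CollectI conjI ballI)
      fix L x assume L: "L \<in> \<F>" "x \<in> L"
      then have "algebraic x" using normal_fieldD(2)[OF n'[of L]] by blast
      then have "\<sigma>' (\<sigma> x) = x" by (rule s'(2))
      then show "\<sigma>' x = x" using s(1) L by (auto simp: fixing_def)
    qed (rule s'(1))
    have t'F: "\<tau>' \<in> fixing {K'}"
      unfolding fixing_def
    proof (intro CollectI conjI ballI)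
      fix L x assume L: "L \<in> {K'}" "x \<in> L"
      then have "algebraic x" using normal_fieldD(2)[OF n'[of L]] by blast
      then have "\<tau>' (\<tau> x) = x" by (rule t'(2))
      then show "\<tau>' x = x" using t(1) L by (auto simp: fixing_def)
    qed (rule t'(1))
    \<comment> \<open>The commutator, read as \<sigma> times a conjugate of its inverse it fixes the
      earlier fields, and read as a conjugate of \<tau> times the inverse of \<tau> it fixes
      \<open>K'\<close>.\<close>
    define \<kappa> where "\<kappa> x = \<sigma> (\<tau> (\<sigma>' (\<tau>' x)))" for x
    have k1: "\<kappa> \<in> fixing \<F>"
      unfolding \<kappa>_def using fixing_comp[OF s(1) fixing_conj[OF _ s'F ta t'(1,3)]] n' by blast
    have k2: "\<kappa> \<in> fixing {K'}"
    proof -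
      have "(\<lambda>x. \<sigma> (\<tau> (\<sigma>' x))) \<in> fixing {K'}" by (rule fixing_conj[OF _ t(1) sa s'(1,3)]) (use n' in auto)
      from fixing_comp[OF this t'F] show ?thesis by (simp add: \<kappa>_def[abs_def])
    qed
    have "\<kappa> (\<tau> (\<sigma> y)) = \<sigma> (\<tau> y)"
      using s'(2) t'(2) y(1) normal_fieldD(2,3)[OF n] sa by (simp add: \<kappa>_def galois_aut_algebraic)
    moreover have "\<tau> (\<sigma> y) \<in> K" using normal_fieldD(3)[OF n] sa ta y(1) by simp
    moreover have "\<kappa> \<in> fixing (insert K' \<F>)" using k1 k2 by (auto simp: fixing_def)
    ultimately show ?case using y(2) by metis
  qed
  then show thesis using that by blast
qed

text \<open>Every automorphism of \<open>K\<close> is induced by one that fixes the compositum of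
  the other fields. An element common to \<open>K\<close> and the compositum is therefore fixed by
  all automorphisms and is rational.\<close>

theorem linearly_disjoint_A5_fields:
  assumes "\<And>K. K \<in> \<K> \<Longrightarrow> A5_field K"
  shows "linearly_disjoint \<K>"
  unfolding linearly_disjoint_def
proof (intro ballI allI impI)
  fix K F assume K: "K \<in> \<K>" and F: "finite F \<and> F \<subseteq> \<K> - {K}"
  have n: "normal_field K" using assms[OF K] by (simp add: A5_field_def)
  have nF: "normal_field K'" if "K' \<in> F" for K' using assms that F by (auto simp: A5_field_def)
  obtain \<sigma>0 x0 where s0: "\<sigma>0 \<in> fixing F" "x0 \<in> K" "\<sigma>0 x0 \<noteq> x0"
    by (rule A5_fields_joint_fixing[of F K]) (use F assms K in auto)
  show "K \<inter> compositum F = \<rat>"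
  proof
    show "\<rat> \<subseteq> K \<inter> compositum F"
      unfolding compositum_def
      using Rats_subset_csubfield[OF normal_fieldD(1)[OF n]] Rats_subset_csubfield[OF csubfield_generate] by blast
    show "K \<inter> compositum F \<subseteq> \<rat>"
    proof
      fix x assume x: "x \<in> K \<inter> compositum F"
      show "x \<in> \<rat>"
      proof (rule rational_if_fixed)
        show "algebraic x" using normal_fieldD(2)[OF n] x by blast
        fix \<tau> assume t: "galois_aut \<tau>"
        obtain \<sigma> where s: "\<sigma> \<in> fixing F" "\<And>x. x \<in> K \<Longrightarrow> \<sigma> x = \<tau> x"
        proof (rule A5_field_image_full[OF assms[OF K], of "fixing F" \<sigma>0 x0 \<tau>])
          show "galois_aut \<sigma>" if "\<sigma> \<in> fixing F" for \<sigma> using that by (simp add: fixing_def)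
          show "(\<lambda>x. \<sigma> (\<tau> x)) \<in> fixing F" if "\<sigma> \<in> fixing F" "\<tau> \<in> fixing F" for \<sigma> \<tau>
            by (rule fixing_comp[OF that])
          show "(\<lambda>x. \<upsilon> (\<sigma> (\<upsilon>' x))) \<in> fixing F"
            if "\<sigma> \<in> fixing F" "galois_aut \<upsilon>" "galois_aut \<upsilon>'" "\<And>x. algebraic x \<Longrightarrow> \<upsilon> (\<upsilon>' x) = x" for \<sigma> \<upsilon> \<upsilon>'
            using fixing_conj[OF _ that] nF by blast
        qed (use s0 t in blast)+
        have sa: "galois_aut \<sigma>" using s(1) by (simp add: fixing_def)
        have "\<sigma> x = x"
          by (rule galois_aut_eq_on_generate[OF sa galois_aut_id, of "\<Union>F"])
             (use x s(1) normal_fieldD(2)[OF nF] in \<open>auto simp: fixing_def compositum_def\<close>)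
        then show "\<tau> x = x" using s(2) x by simp
      qed
    qed
  qed
qed

section \<open>Congruences between algebraic integers\<close>

text \<open>An ideal of the ring of all algebraic integers, so that one notion serves every number
  field at once.\<close>

definition alg_ideal :: "complex set \<Rightarrow> bool" where
  "alg_ideal I \<longleftrightarrow> I \<subseteq> {x. algebraic_int x} \<and> 0 \<in> I \<and> (\<forall>x\<in>I. \<forall>y\<in>I. x + y \<in> I) \<and>
     (\<forall>x\<in>I. \<forall>a. algebraic_int a \<longrightarrow> a * x \<in> I)"

lemma alg_idealD:
  assumes "alg_ideal I"
  shows "x \<in> I \<Longrightarrow> algebraic_int x" "0 \<in> I" "x \<in> I \<Longrightarrow> y \<in> I \<Longrightarrow> x + y \<in> I"
    "x \<in> I \<Longrightarrow> algebraic_int a \<Longrightarrow> a * x \<in> I" "x \<in> I \<Longrightarrow> algebraic_int a \<Longrightarrow> x * a \<in> I"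
    "x \<in> I \<Longrightarrow> - x \<in> I" "x \<in> I \<Longrightarrow> y \<in> I \<Longrightarrow> x - y \<in> I"
proof -
  show 0: "x \<in> I \<Longrightarrow> algebraic_int x" "0 \<in> I" and
    add: "\<And>x y. x \<in> I \<Longrightarrow> y \<in> I \<Longrightarrow> x + y \<in> I" and
    mult: "\<And>a x. x \<in> I \<Longrightarrow> algebraic_int a \<Longrightarrow> a * x \<in> I"
    using assms unfolding alg_ideal_def by blast+
  show "x \<in> I \<Longrightarrow> algebraic_int a \<Longrightarrow> x * a \<in> I" by (subst mult.commute) (rule mult)
  show neg: "x \<in> I \<Longrightarrow> - x \<in> I" for x
    using mult[of x "-1"] algebraic_int_of_int[of "-1"] by simp
  show "x \<in> I \<Longrightarrow> y \<in> I \<Longrightarrow> x - y \<in> I" using add[of x "- y"] neg by simp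
qed

lemma alg_ideal_sum: "alg_ideal I \<Longrightarrow> (\<And>i. i \<in> A \<Longrightarrow> f i \<in> I) \<Longrightarrow> sum f A \<in> I"
  by (induction A rule: infinite_finite_induct) (auto intro: alg_idealD)

text \<open>Integrality of both sides is part of the relation, so that congruences can be multiplied
  without side conditions.\<close>

definition cong_ideal :: "complex set \<Rightarrow> complex \<Rightarrow> complex \<Rightarrow> bool" where
  "cong_ideal I x y \<longleftrightarrow> algebraic_int x \<and> algebraic_int y \<and> x - y \<in> I"

lemma cong_ideal_refl: "alg_ideal I \<Longrightarrow> algebraic_int x \<Longrightarrow> cong_ideal I x x"
  by (simp add: cong_ideal_def alg_idealD)

lemma cong_ideal_sym: "alg_ideal I \<Longrightarrow> cong_ideal I x y \<Longrightarrow> cong_ideal I y x"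
  using alg_idealD(6)[of I "x - y"] by (simp add: cong_ideal_def)

lemma cong_ideal_trans: "alg_ideal I \<Longrightarrow> cong_ideal I x y \<Longrightarrow> cong_ideal I y z \<Longrightarrow> cong_ideal I x z"
  using alg_idealD(3)[of I "x - y" "y - z"] by (simp add: cong_ideal_def)

lemma cong_ideal_add:
  assumes "alg_ideal I" "cong_ideal I x y" "cong_ideal I x' y'"
  shows "cong_ideal I (x + x') (y + y')"
  using alg_idealD(3)[OF assms(1), of "x - y" "x' - y'"] assms(2,3)
  by (simp add: cong_ideal_def algebraic_int_plus_times algebra_simps)

lemma cong_ideal_diff:
  assumes "alg_ideal I" "cong_ideal I x y" "cong_ideal I x' y'"
  shows "cong_ideal I (x - x') (y - y')"
  using alg_idealD(7)[OF assms(1), of "x - y" "x' - y'"] assms(2,3)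
  by (simp add: cong_ideal_def algebraic_int_diff algebra_simps)

lemma cong_ideal_mult:
  assumes "alg_ideal I" "cong_ideal I x y" "cong_ideal I x' y'"
  shows "cong_ideal I (x * x') (y * y')"
proof -
  have "x' * (x - y) + y * (x' - y') \<in> I"
    using assms by (intro alg_idealD(3,4)[OF assms(1)]) (auto simp: cong_ideal_def)
  then show ?thesis using assms(2,3)
    by (simp add: cong_ideal_def algebraic_int_plus_times algebra_simps)
qed

lemma cong_ideal_power: "alg_ideal I \<Longrightarrow> cong_ideal I x y \<Longrightarrow> cong_ideal I (x ^ n) (y ^ n)"
  by (induction n) (auto intro: cong_ideal_mult cong_ideal_refl int_imp_algebraic_int)

lemma cong_ideal_sum:
  "alg_ideal I \<Longrightarrow> (\<And>i. i \<in> A \<Longrightarrow> cong_ideal I (f i) (g i)) \<Longrightarrow> cong_ideal I (sum f A) (sum g A)"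
  by (induction A rule: infinite_finite_induct) (auto intro: cong_ideal_add cong_ideal_refl)

lemma cong_ideal_poly:
  assumes "alg_ideal I" "cong_ideal I x y"
  shows "cong_ideal I (poly (map_poly of_int f) x) (poly (map_poly of_int f) y)"
  unfolding poly_altdef
  by (intro cong_ideal_sum[OF assms(1)] cong_ideal_mult[OF assms(1)] cong_ideal_power[OF assms]
      cong_ideal_refl[OF assms(1)]) (simp add: coeff_map_poly algebraic_int_of_int)

section \<open>The Frobenius map modulo an ideal containing p\<close>

text \<open>All inner binomial coefficients are multiples of \<open>p\<close>. The ideal is an
  arbitrary one containing \<open>p\<close>, so this serves both prime ideals and the principal
  ideal \<open>multiples p\<close>.\<close>

lemma frobenius_add:
  fixes p :: nat
  assumes p: "Factorial_Ring.prime p" and I: "alg_ideal I" "of_nat p \<in> I"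
    and xy: "algebraic_int x" "algebraic_int y"
  shows "cong_ideal I ((x + y) ^ p) (x ^ p + y ^ p)"
proof -
  have p1: "p \<ge> 1" "p \<noteq> 0" using prime_gt_0_nat[OF p] by auto
  let ?t = "\<lambda>k. of_nat (p choose k) * x ^ k * y ^ (p - k)"
  have "{..p} = insert 0 (insert p {0<..<p})" using p1 by auto
  then have "(x + y) ^ p = ?t 0 + (?t p + (\<Sum>k\<in>{0<..<p}. ?t k))"
    using p1 by (simp add: binomial_ring)
  then have "(x + y) ^ p - (x ^ p + y ^ p) = (\<Sum>k\<in>{0<..<p}. ?t k)" by simp
  also have "\<dots> \<in> I"
  proof (rule alg_ideal_sum[OF I(1)])
    fix k assume k: "k \<in> {0<..<p}"
    have "p dvd p choose k" using k by (intro dvd_choose_prime p) auto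
    then obtain m where "p choose k = p * m" by (elim dvdE)
    then have "?t k = of_nat p * (of_int (int m) * x ^ k * y ^ (p - k))" by simp
    also have "\<dots> \<in> I"
      by (intro alg_idealD(5)[OF I] algebraic_int_plus_times algebraic_int_of_int algebraic_int_power xy)
    finally show "?t k \<in> I" .
  qed
  finally show ?thesis
    using xy by (simp add: cong_ideal_def algebraic_int_plus_times algebraic_int_power)
qed

lemma frobenius_diff:
  fixes p :: nat
  assumes p: "Factorial_Ring.prime p" and I: "alg_ideal I" "of_nat p \<in> I"
    and xy: "algebraic_int x" "algebraic_int y"
  shows "cong_ideal I ((x - y) ^ p) (x ^ p - y ^ p)"
  using frobenius_add[OF p I algebraic_int_diff[OF xy] xy(2)] xy
    alg_idealD(6)[OF I(1), of "x ^ p - ((x - y) ^ p + y ^ p)"]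
  by (simp add: cong_ideal_def algebraic_int_diff algebraic_int_power algebra_simps)

lemma frobenius_sum:
  fixes p :: nat
  assumes p: "Factorial_Ring.prime p" and I: "alg_ideal I" "of_nat p \<in> I"
    and "\<And>i. i \<in> A \<Longrightarrow> algebraic_int (f i)"
  shows "cong_ideal I ((\<Sum>i\<in>A. f i) ^ p) (\<Sum>i\<in>A. f i ^ p)"
  using assms(4)
proof (induction A rule: infinite_finite_induct)
  case (insert a A)
  have "cong_ideal I ((f a + sum f A) ^ p) (f a ^ p + sum f A ^ p)"
    using insert.prems by (intro frobenius_add[OF p I] algebraic_int_sum) auto
  moreover have "cong_ideal I (f a ^ p + sum f A ^ p) (f a ^ p + (\<Sum>i\<in>A. f i ^ p))"
    using insert by (intro cong_ideal_add[OF I(1)] cong_ideal_refl[OF I(1)] algebraic_int_power) auto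
  ultimately have "cong_ideal I ((f a + sum f A) ^ p) (f a ^ p + (\<Sum>i\<in>A. f i ^ p))"
    by (rule cong_ideal_trans[OF I(1)])
  then show ?case using insert.hyps by simp
next
  case empty
  show ?case using prime_gt_0_nat[OF p] cong_ideal_refl[OF I(1), of 0] by (simp add: zero_power)
next
  case (infinite A)
  then show ?case using prime_gt_0_nat[OF p] cong_ideal_refl[OF I(1), of 0] by (simp add: zero_power)
qed

lemma frobenius_of_int:
  fixes p :: nat
  assumes p: "Factorial_Ring.prime p" and I: "alg_ideal I" "of_nat p \<in> I"
  shows "cong_ideal I (of_int n ^ p) (of_int n)"
proof (induction n rule: int_induct[where k = 0])
  case base
  then show ?case using prime_gt_0_nat[OF p] by (simp add: cong_ideal_refl[OF I(1)] zero_power)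
next
  case (step1 i)
  have "cong_ideal I ((of_int i + of_int 1) ^ p) (of_int i ^ p + of_int 1 ^ p)"
    by (intro frobenius_add[OF p I] algebraic_int_of_int)
  moreover have "cong_ideal I (of_int i ^ p + of_int 1 ^ p) (of_int i + of_int 1)"
    using step1 cong_ideal_refl[OF I(1) algebraic_int_of_int[of 1]]
    by (intro cong_ideal_add[OF I(1)]) auto
  ultimately show ?case using cong_ideal_trans[OF I(1)] by simp
next
  case (step2 i)
  have "cong_ideal I ((of_int i - of_int 1) ^ p) (of_int i ^ p - of_int 1 ^ p)"
    by (intro frobenius_diff[OF p I] algebraic_int_of_int)
  moreover have "cong_ideal I (of_int i ^ p - of_int 1 ^ p) (of_int i - of_int 1)"
    using step2 cong_ideal_refl[OF I(1) algebraic_int_of_int[of 1]]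
    by (intro cong_ideal_diff[OF I(1)]) auto
  ultimately show ?case using cong_ideal_trans[OF I(1)] by simp
qed

lemma frobenius_poly:
  fixes p :: nat
  assumes p: "Factorial_Ring.prime p" and I: "alg_ideal I" "of_nat p \<in> I" and x: "algebraic_int x"
  shows "cong_ideal I (poly (map_poly of_int f) x ^ p) (poly (map_poly of_int f) (x ^ p))"
proof -
  let ?f = "map_poly of_int f :: complex poly"
  have "cong_ideal I ((\<Sum>i\<le>Polynomial.degree ?f. Polynomial.coeff ?f i * x ^ i) ^ p)
      (\<Sum>i\<le>Polynomial.degree ?f. (Polynomial.coeff ?f i * x ^ i) ^ p)"
    by (rule frobenius_sum[OF p I])
       (simp add: coeff_map_poly algebraic_int_plus_times algebraic_int_of_int algebraic_int_power x)
  moreover have "cong_ideal I (\<Sum>i\<le>Polynomial.degree ?f. (Polynomial.coeff ?f i * x ^ i) ^ p)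
      (\<Sum>i\<le>Polynomial.degree ?f. Polynomial.coeff ?f i * (x ^ p) ^ i)"
  proof (rule cong_ideal_sum[OF I(1)])
    fix i
    have "(x ^ i) ^ p = (x ^ p) ^ i" by (metis power_mult mult.commute)
    then show "cong_ideal I ((Polynomial.coeff ?f i * x ^ i) ^ p) (Polynomial.coeff ?f i * (x ^ p) ^ i)"
      unfolding power_mult_distrib
      by (auto simp: coeff_map_poly intro!: cong_ideal_mult[OF I(1)] frobenius_of_int[OF p I]
          cong_ideal_refl[OF I(1)] algebraic_int_power x)
  qed
  ultimately show ?thesis unfolding poly_altdef using cong_ideal_trans[OF I(1)] by blast
qed

text \<open>A rational algebraic integer is an integer, so divisibility among the algebraic integers
  descends to the integers.\<close>

lemma of_int_multiple_not_unit:
  fixes x :: complex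
  assumes "algebraic_int x" "of_int m * x = of_int n"
  shows "m dvd n"
proof (cases "m = 0")
  case False
  then have "x = of_int n / of_int m"
    using assms(2) by (simp add: nonzero_eq_divide_eq mult.commute)
  then have "x \<in> \<rat>" by simp
  then have "x \<in> \<int>" using assms(1) rational_algebraic_int_is_int by blast
  then obtain k where "x = of_int k" by (elim Ints_cases)
  then have "(of_int (m * k) :: complex) = of_int n" using assms(2) by simp
  then have "m * k = n" by (simp only: of_int_eq_iff)
  then show ?thesis by auto
qed (use assms in auto)

section \<open>Prime ideals above a rational prime\<close>

definition multiples :: "nat \<Rightarrow> complex set" where
  "multiples p = {of_nat p * x | x. algebraic_int x}"

lemma alg_ideal_multiples: "alg_ideal (multiples p)"
    unfolding alg_ideal_def
  proof (intro conjI ballI allI impI subsetI)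
    show "x \<in> {x. algebraic_int x}" if "x \<in> multiples p" for x
      using that algebraic_int_plus_times(2)[OF algebraic_int_of_int[of "int p"]] by (auto simp: multiples_def)
    show "0 \<in> multiples p" by (auto simp: multiples_def intro!: exI[of _ 0])
    show "x + y \<in> multiples p" if "x \<in> multiples p" "y \<in> multiples p" for x y
    proof -
      obtain u v where "x = of_nat p * u" "y = of_nat p * v" "algebraic_int u" "algebraic_int v"
        using \<open>x \<in> multiples p\<close> \<open>y \<in> multiples p\<close> by (auto simp: multiples_def)
      then show ?thesis unfolding multiples_def
        by (intro CollectI exI[of _ "u + v"]) (simp add: algebraic_int_plus_times algebra_simps)
    qed
    show "a * x \<in> multiples p" if "x \<in> multiples p" "algebraic_int a" for x a
    proof -
      obtain u where "x = of_nat p * u" "algebraic_int u" using \<open>x \<in> multiples p\<close> by (auto simp: multiples_def)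
      then show ?thesis using that(2) unfolding multiples_def
        by (intro CollectI exI[of _ "a * u"]) (simp add: algebraic_int_plus_times algebra_simps)
    qed
  qed

text \<open>A maximal element among the proper ideals containing \<open>p\<close>, which exist
  because 1 / p is not an algebraic integer. Such an ideal is prime, since any x outside it
  satisfies 1 = m + a x for some m in the ideal and some algebraic integer a.\<close>

lemma prime_alg_ideal_exists:
  fixes p :: nat
  assumes p: "Factorial_Ring.prime p"
  obtains M where "alg_ideal M" "of_nat p \<in> M" "1 \<notin> M"
    "\<And>x y. algebraic_int x \<Longrightarrow> algebraic_int y \<Longrightarrow> x * y \<in> M \<Longrightarrow> x \<in> M \<or> y \<in> M"
proof -
  define A where "A = {I. alg_ideal I \<and> of_nat p \<in> I \<and> 1 \<notin> I}"
  have "of_nat p \<in> multiples p"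
    unfolding multiples_def using int_imp_algebraic_int[of "1::complex"] by (intro CollectI exI[of _ 1]) simp
  moreover have "1 \<notin> multiples p"
  proof
    assume "1 \<in> multiples p"
    then obtain x :: complex where x: "algebraic_int x" "of_nat p * x = 1" by (auto simp: multiples_def)
    then have "int p dvd 1" using of_int_multiple_not_unit[of x "int p" 1] by simp
    then show False using prime_gt_1_nat[OF p] by simp
  qed
  ultimately have "multiples p \<in> A" using alg_ideal_multiples by (simp add: A_def)
  have "\<exists>M\<in>A. \<forall>N\<in>A. M \<subseteq> N \<longrightarrow> N = M"
  proof (rule subset_Zorn_nonempty)
    show "A \<noteq> {}" using \<open>multiples p \<in> A\<close> by blast
    fix C assume C: "C \<noteq> {}" "subset.chain A C"
    have CA: "\<And>I. I \<in> C \<Longrightarrow> I \<in> A" and tot: "\<And>I J. I \<in> C \<Longrightarrow> J \<in> C \<Longrightarrow> I \<subseteq> J \<or> J \<subseteq> I"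
      using C(2) by (auto simp: subset_chain_def)
    have ideal: "alg_ideal I" if "I \<in> C" for I using CA[OF that] by (simp add: A_def)
    have "alg_ideal (\<Union>C)"
      unfolding alg_ideal_def
    proof (intro conjI ballI allI impI subsetI)
      show "x \<in> {x. algebraic_int x}" if "x \<in> \<Union>C" for x using that alg_idealD(1)[OF ideal] by blast
      show "0 \<in> \<Union>C" using C(1) alg_idealD(2)[OF ideal] by blast
      show "x + y \<in> \<Union>C" if "x \<in> \<Union>C" "y \<in> \<Union>C" for x y
      proof -
        obtain I where "I \<in> C" "x \<in> I" "y \<in> I" using \<open>x \<in> \<Union>C\<close> \<open>y \<in> \<Union>C\<close> tot by blast
        then show ?thesis using alg_idealD(3)[OF ideal] by blast
      qed
      show "a * x \<in> \<Union>C" if "x \<in> \<Union>C" "algebraic_int a" for x a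
        using that alg_idealD(4)[OF ideal] by blast
    qed
    moreover have "of_nat p \<in> \<Union>C" using C(1) CA by (auto simp: A_def)
    moreover have "1 \<notin> \<Union>C" using CA by (auto simp: A_def)
    ultimately show "\<Union>C \<in> A" by (simp add: A_def)
  qed
  then obtain M where MA: "M \<in> A" and max: "\<And>N. N \<in> A \<Longrightarrow> M \<subseteq> N \<Longrightarrow> N = M" by blast
  have M: "alg_ideal M" "of_nat p \<in> M" "1 \<notin> M" using MA by (auto simp: A_def)
  have unit: "\<exists>m\<in>M. \<exists>a. algebraic_int a \<and> 1 = m + a * x" if x: "algebraic_int x" "x \<notin> M" for x
  proof (rule ccontr)
    assume no: "\<not> (\<exists>m\<in>M. \<exists>a. algebraic_int a \<and> 1 = m + a * x)"
    define N where "N = {m + a * x | m a. m \<in> M \<and> algebraic_int a}"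
    have NI: "m + a * x \<in> N" if "m \<in> M" "algebraic_int a" for m a using that by (auto simp: N_def)
    have MN: "M \<subseteq> N" using NI[of _ 0] by fastforce
    have "alg_ideal N"
      unfolding alg_ideal_def
    proof (intro conjI ballI allI impI subsetI)
      show "y \<in> {x. algebraic_int x}" if "y \<in> N" for y
        using that x(1) alg_idealD(1)[OF M(1)] by (auto simp: N_def algebraic_int_plus_times)
      show "0 \<in> N" using MN alg_idealD(2)[OF M(1)] by blast
      show "y + z \<in> N" if "y \<in> N" "z \<in> N" for y z
      proof -
        obtain m a n b where e: "y = m + a * x" "z = n + b * x" "m \<in> M" "n \<in> M" "algebraic_int a" "algebraic_int b"
          using \<open>y \<in> N\<close> \<open>z \<in> N\<close> by (auto simp: N_def)
        have "(m + n) + (a + b) * x \<in> N"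
          using e by (intro NI alg_idealD(3)[OF M(1)] algebraic_int_plus_times)
        then show ?thesis by (simp add: e algebra_simps)
      qed
      show "c * y \<in> N" if "y \<in> N" "algebraic_int c" for y c
      proof -
        obtain m a where e: "y = m + a * x" "m \<in> M" "algebraic_int a" using \<open>y \<in> N\<close> by (auto simp: N_def)
        have "c * m + (c * a) * x \<in> N"
          using e that(2) by (intro NI alg_idealD(4)[OF M(1)] algebraic_int_plus_times)
        then show ?thesis by (simp add: e algebra_simps)
      qed
    qed
    moreover have "1 \<notin> N" using no by (auto simp: N_def)
    ultimately have "N = M" using max MN M(2) by (auto simp: A_def)
    moreover have "x \<in> N" using NI[of 0 1] alg_idealD(2)[OF M(1)] int_imp_algebraic_int[of "1::complex"] by simp
    ultimately show False using x(2) by blast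
  qed
  have "x \<in> M \<or> y \<in> M" if xy: "algebraic_int x" "algebraic_int y" "x * y \<in> M" for x y
  proof (rule ccontr)
    assume "\<not> (x \<in> M \<or> y \<in> M)"
    then obtain m a n b where e: "m \<in> M" "algebraic_int a" "1 = m + a * x" "n \<in> M" "algebraic_int b" "1 = n + b * y"
      using unit[OF xy(1)] unit[OF xy(2)] by blast
    \<comment> \<open>This element of \<open>M\<close> equals m + a x (n + b y) = m + a x =
      1.\<close>
    have "m + (a * x) * n + (a * b) * (x * y) \<in> M"
      by (rule alg_idealD(3)[OF M(1) alg_idealD(3)[OF M(1) e(1) alg_idealD(4)[OF M(1) e(4)]]
            alg_idealD(4)[OF M(1) xy(3)]]) (rule algebraic_int_plus_times e xy)+
    moreover have "m + (a * x) * n + (a * b) * (x * y) = m + a * x * (n + b * y)"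
      by (simp add: algebra_simps)
    ultimately show False using e(3,6) M(3) by simp
  qed
  then show thesis using that M by blast
qed

lemma prime_alg_ideal_of_int:
  fixes p :: nat
  assumes p: "Factorial_Ring.prime p" and M: "alg_ideal M" "of_nat p \<in> M" "1 \<notin> M"
  shows "of_int n \<in> M \<longleftrightarrow> int p dvd n"
proof
  assume "int p dvd n"
  then obtain k where "n = int p * k" by (elim dvdE)
  then show "of_int n \<in> M" using alg_idealD(5)[OF M(1,2) algebraic_int_of_int[of k]] by simp
next
  assume n: "of_int n \<in> M"
  show "int p dvd n"
  proof (rule ccontr)
    assume "\<not> int p dvd n"
    moreover have "Factorial_Ring.prime (int p)" using p by simp
    ultimately have "coprime n (int p)" by (metis coprime_commute prime_imp_coprime)
    then obtain u v where "u * n + v * int p = 1" by (metis bezout_int coprime_iff_gcd_eq_1)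
    then have "of_int u * of_int n + of_int v * of_nat p = (1 :: complex)"
      by (metis of_int_1 of_int_add of_int_mult of_int_of_nat_eq)
    moreover have "of_int u * of_int n + of_int v * of_nat p \<in> M"
      by (intro alg_idealD(3,4)[OF M(1)] n M(2) algebraic_int_of_int)
    ultimately show False using M(3) by simp
  qed
qed

text \<open>The field with p elements in disguise: a polynomial with more roots than its degree is
  zero modulo \<open>p\<close>. Synthetic division removes one root at a time, and primality keeps
  the other roots.\<close>

lemma dvd_poly_if_many_roots:
  fixes q :: "int poly" and p :: nat
  assumes p: "Factorial_Ring.prime p" and "finite S"
    "\<And>s t. s \<in> S \<Longrightarrow> t \<in> S \<Longrightarrow> s \<noteq> t \<Longrightarrow> \<not> int p dvd s - t"
    "\<And>s. s \<in> S \<Longrightarrow> int p dvd poly q s" "q = 0 \<or> Polynomial.degree q < card S"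
  shows "\<exists>r. q = Polynomial.smult (int p) r"
  using assms(2-5)
proof (induction S arbitrary: q rule: finite_induct)
  case empty
  then show ?case by (intro exI[of _ 0]) simp
next
  case (insert s S)
  have pp: "Factorial_Ring.prime (int p)" using p by simp
  define q' where "q' = synthetic_div q s"
  have q: "q = [:- s, 1:] * q' + [:poly q s:]"
    using synthetic_div_correct'[of s q] by (simp add: q'_def)
  have "int p dvd poly q' t" if t: "t \<in> S" for t
  proof -
    have "poly q t = (t - s) * poly q' t + poly q s" by (subst q) (simp add: algebra_simps)
    then have "int p dvd (t - s) * poly q' t"
      using insert.prems(2)[of t] insert.prems(2)[of s] t by (metis dvd_add_left_iff insertCI)
    moreover have "\<not> int p dvd t - s" using insert.prems(1)[of t s] insert.hyps(2) t by blast
    ultimately show ?thesis using prime_dvd_mult_iff[OF pp] by blast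
  qed
  moreover have "q' = 0 \<or> Polynomial.degree q' < card S"
  proof (cases "Polynomial.degree q = 0")
    case True
    then have "q' = 0" unfolding q'_def by (simp add: synthetic_div_eq_0_iff)
    then show ?thesis by simp
  next
    case False
    have "card (insert s S) = Suc (card S)" using insert.hyps by simp
    moreover have "q \<noteq> 0" using False by auto
    moreover have "Polynomial.degree q' = Polynomial.degree q - 1"
      unfolding q'_def by (rule degree_synthetic_div)
    ultimately show ?thesis using insert.prems(3) False by linarith
  qed
  ultimately obtain r where r: "q' = Polynomial.smult (int p) r"
    using insert.IH[of q'] insert.prems(1) by blast
  obtain k where "poly q s = int p * k" using insert.prems(2)[of s] by (auto elim: dvdE)
  then have "q = Polynomial.smult (int p) ([:- s, 1:] * r + [:k:])"
    by (subst q) (simp add: r smult_add_right)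
  then show ?case by blast
qed

text \<open>In the residue ring the fixed points of Frobenius form the prime field: X^p - X is
  congruent modulo \<open>p\<close> to the product of all X - s, so that product lies in
  \<open>M\<close> at X = x, and primality of \<open>M\<close> selects one factor.\<close>

lemma frobenius_fixed_is_integer:
  fixes p :: nat
  assumes p: "Factorial_Ring.prime p" and M: "alg_ideal M" "of_nat p \<in> M" "1 \<notin> M"
    and prime: "\<And>x y. algebraic_int x \<Longrightarrow> algebraic_int y \<Longrightarrow> x * y \<in> M \<Longrightarrow> x \<in> M \<or> y \<in> M"
    and x: "cong_ideal M (x ^ p) x"
  obtains n :: int where "cong_ideal M x (of_int n)"
proof -
  have xi: "algebraic_int x" using x by (simp add: cong_ideal_def)
  have p1: "p > 1" by (rule prime_gt_1_nat[OF p])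
  define S where "S = {0..<int p}"
  define F :: "int poly" where "F = (\<Prod>s\<in>S. [:- s, 1:])"
  define W :: "int poly" where "W = Polynomial.monom 1 p - [:0, 1:]"
  have dF: "Polynomial.degree F = p" "Polynomial.lead_coeff F = 1"
    unfolding F_def by (subst degree_prod_eq_sum_degree, auto simp: S_def lead_coeff_prod)
  have dX: "Polynomial.degree W = p" "Polynomial.coeff W p = 1"
  proof -
    have "Polynomial.degree ([:0, 1:] :: int poly) < Polynomial.degree (Polynomial.monom 1 p :: int poly)"
      using p1 by (simp add: Polynomial.degree_monom_eq)
    then show "Polynomial.degree W = p"
      unfolding W_def diff_conv_add_uminus by (subst degree_add_eq_left) (auto simp: Polynomial.degree_monom_eq)
    show "Polynomial.coeff W p = 1" using p1 by (auto simp: W_def coeff_pCons split: nat.split)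
  qed
  \<comment> \<open>Both polynomials are monic of degree \<open>p\<close>, so their difference has
    degree below \<open>p\<close>, the number of residues at which it vanishes modulo
    \<open>p\<close>.\<close>
  have deg: "F - W = 0 \<or> Polynomial.degree (F - W) < card S"
  proof -
    have "Polynomial.coeff (F - W) p = 0" using dF dX by simp
    moreover have "Polynomial.degree (F - W) \<le> p" using dF dX by (metis degree_diff_le order.refl)
    ultimately show ?thesis
      by (metis S_def card_atLeastLessThan_int diff_zero le_neq_implies_less leading_coeff_0_iff nat_int)
  qed
  have I0: "cong_ideal M (of_int (s ^ p)) (of_int s)" for s
    using frobenius_of_int[OF p M(1,2), of s] by simp
  have van: "int p dvd poly (F - W) s" if "s \<in> S" for s
  proof -
    have "poly F s = 0" using that by (auto simp: F_def poly_prod S_def)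
    moreover have "of_int (s ^ p - s) \<in> M" using I0[of s] by (simp add: cong_ideal_def)
    then have "int p dvd s ^ p - s" by (simp only: prime_alg_ideal_of_int[OF p M])
    ultimately show ?thesis by (simp add: W_def poly_monom dvd_diff_commute)
  qed
  have "\<exists>r. F - W = Polynomial.smult (int p) r"
  proof (rule dvd_poly_if_many_roots[OF p _ _ van deg])
    show "\<not> int p dvd s - t" if "s \<in> S" "t \<in> S" "s \<noteq> t" for s t
    proof
      assume d: "int p dvd s - t"
      have "\<bar>s - t\<bar> < int p" "s - t \<noteq> 0" using that by (auto simp: S_def)
      then show False using dvd_imp_le_int[OF _ d] by simp
    qed
  qed (simp add: S_def)
  then obtain r where r: "F = W + Polynomial.smult (int p) r" by (metis add_diff_cancel_left' diff_add_cancel add.commute)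
  have "poly (map_poly of_int F) x = (\<Prod>s\<in>S. x - of_int s)"
    by (simp add: F_def of_int_poly_hom.hom_prod poly_prod)
  moreover have "poly (map_poly of_int F) x = (x ^ p - x) + of_nat p * poly (map_poly of_int r) x"
    unfolding r W_def by (simp add: of_int_poly_hom.hom_add of_int_poly_hom.hom_minus poly_monom hom_distribs)
  moreover have "(x ^ p - x) + of_nat p * poly (map_poly of_int r) x \<in> M"
    using x by (intro alg_idealD(3,5)[OF M(1)] M(2) algebraic_int_poly xi) (simp add: cong_ideal_def)
  ultimately have "(\<Prod>s\<in>S. x - of_int s) \<in> M" by simp
  moreover have "(\<Prod>s\<in>T. x - of_int s) \<in> M \<Longrightarrow> \<exists>s\<in>T. x - of_int s \<in> M" if "finite T" for T :: "int set"
    using that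
  proof (induction T rule: finite_induct)
    case (insert t T)
    have "algebraic_int (x - of_int t)" "algebraic_int (\<Prod>s\<in>T. x - of_int s)"
      using xi by (intro algebraic_int_diff algebraic_int_of_int algebraic_int_prod; assumption?)+
    then show ?case using prime[of "x - of_int t" "\<Prod>s\<in>T. x - of_int s"] insert by auto
  qed (use M(3) in simp)
  ultimately obtain s where "x - of_int s \<in> M" unfolding S_def by blast
  then show thesis using that[of s] xi algebraic_int_of_int by (simp add: cong_ideal_def)
qed

section \<open>The quintic family and its sextic resolvent\<close>

definition quintic :: "int \<Rightarrow> int \<Rightarrow> int poly" where
  "quintic a b = [:b, a, 0, 0, 0, 1:]"

text \<open>The relation of \<open>resolvent_identity\<close> with the value 16 a^2 inserted for
  \<open>vand\<close>. The constant term of the quintic enters only through that value.\<close>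

definition sextic :: "int \<Rightarrow> int poly" where
  "sextic a = [:5 * a ^ 3, - 16 * a ^ 2, 15 * a ^ 2, 0, - 5 * a, 0, 1:]"

lemma poly_quintic: "poly (map_poly of_int (quintic a b)) (x :: 'a :: comm_ring_1) = x ^ 5 + of_int a * x + of_int b"
  by (simp add: quintic_def map_poly_pCons algebra_simps numeral_eq_Suc)

lemma poly_sextic: "poly (map_poly of_int (sextic a)) (x :: 'a :: comm_ring_1) =
    x ^ 6 - 5 * of_int a * x ^ 4 + 15 * of_int a ^ 2 * x ^ 2 - 16 * of_int a ^ 2 * x + 5 * of_int a ^ 3"
  by (simp add: sextic_def map_poly_pCons algebra_simps numeral_eq_Suc)

section \<open>The Vandermonde product and the pentagon sum\<close>

definition vand :: "'a::comm_ring_1 \<Rightarrow> 'a \<Rightarrow> 'a \<Rightarrow> 'a \<Rightarrow> 'a \<Rightarrow> 'a" where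
  "vand a b c d e = (a - b) * (a - c) * (a - d) * (a - e) * (b - c) * (b - d) * (b - e) *
     (c - d) * (c - e) * (d - e)"

text \<open>The sum over the edges of the pentagon a b c d e, invariant under its dihedral group of
  order 10. When the second elementary symmetric function vanishes, the complementary pentagon a c e
  b d gives the negative.\<close>

definition cyc_sum :: "'a::comm_ring_1 \<Rightarrow> 'a \<Rightarrow> 'a \<Rightarrow> 'a \<Rightarrow> 'a \<Rightarrow> 'a" where
  "cyc_sum a b c d e = a * b + b * c + c * d + d * e + e * a"

text \<open>The six even conjugates of y = \<open>cyc_sum\<close> are the roots of a degree-six
  polynomial whose y^k-coefficient has weight 12 - 2k in the roots a, ..., e. Odd permutations
  negate these six values as a set, so even k gives symmetric coefficients, while odd k gives
  multiples of \<open>vand\<close>, which has weight 10. With the first three symmetric functions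
  zero, weights leave only powers of A for even k and a multiple of \<open>vand\<close> at k =
  1.\<close>

lemma resolvent_identity:
  fixes a b c d e :: complex
  assumes "a + b + c + d + e = 0"
    "a * b + a * c + a * d + a * e + b * c + b * d + b * e + c * d + c * e + d * e = 0"
    "a * b * c + a * b * d + a * b * e + a * c * d + a * c * e + a * d * e + b * c * d +
      b * c * e + b * d * e + c * d * e = 0"
    "a * b * c * d + a * b * c * e + a * b * d * e + a * c * d * e + b * c * d * e = A"
  shows "cyc_sum a b c d e ^ 6 - 5 * A * cyc_sum a b c d e ^ 4 + 15 * A ^ 2 * cyc_sum a b c d e ^ 2
     + 5 * A ^ 3 = vand a b c d e * cyc_sum a b c d e"
  unfolding cyc_sum_def vand_def using assms by Groebner_Basis.algebra

text \<open>The roots are indexed by the points on which \<open>alt_group 5\<close> acts and are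
  listed with multiplicity. Their order matters, since \<open>vand5\<close> depends on it up to
  sign.\<close>

definition quintic_roots :: "int \<Rightarrow> int \<Rightarrow> (nat \<Rightarrow> complex) \<Rightarrow> bool" where
  "quintic_roots a b r \<longleftrightarrow>
     map_poly of_int (quintic a b) = (\<Prod>i\<in>{1..5}. [:- r i, 1:])"

lemma prod_1_5: "(\<Prod>i\<in>{1..5::nat}. f i) = f 1 * f 2 * f 3 * f 4 * f 5"
proof -
  have "{1..5::nat} = {1, 2, 3, 4, 5}" by auto
  then show ?thesis by (simp add: mult.assoc)
qed

abbreviation vand5 :: "(nat \<Rightarrow> complex) \<Rightarrow> complex" where
  "vand5 r \<equiv> vand (r 1) (r 2) (r 3) (r 4) (r 5)"

lemma vand_swap_adjacent:
  "vand a b c d e = - vand b a c d e" "vand a b c d e = - vand a c b d e"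
  "vand a b c d e = - vand a b d c e" "vand a b c d e = - vand a b c e d"
  unfolding vand_def minus_diff_eq[of a b, symmetric] minus_diff_eq[of b c, symmetric]
    minus_diff_eq[of c d, symmetric] minus_diff_eq[of d e, symmetric]
  by (simp_all only: mult_minus_left mult_minus_right minus_minus mult_ac)

lemma vand_swap_distant:
  "vand a b c d e = - vand c b a d e" "vand a b c d e = - vand a d c b e"
  "vand a b c d e = - vand a b e d c" "vand a b c d e = - vand d b c a e"
  "vand a b c d e = - vand a e c d b" "vand a b c d e = - vand e b c d a"
proof -
  note s = vand_swap_adjacent
  show "vand a b c d e = - vand c b a d e" for a b c d e :: 'a
    by (simp only: s(1)[of a b c d e] s(2)[of b a c d e] s(1)[of b c a d e] minus_minus)
  show 24: "vand a b c d e = - vand a d c b e" for a b c d e :: 'a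
    by (simp only: s(2)[of a b c d e] s(3)[of a c b d e] s(2)[of a c d b e] minus_minus)
  show 35: "vand a b c d e = - vand a b e d c" for a b c d e :: 'a
    by (simp only: s(3)[of a b c d e] s(4)[of a b d c e] s(3)[of a b d e c] minus_minus)
  show 14: "vand a b c d e = - vand d b c a e" for a b c d e :: 'a
    by (simp only: s(1)[of a b c d e] 24[of b a c d e] s(1)[of b d c a e] minus_minus)
  show "vand a b c d e = - vand a e c d b" for a b c d e :: 'a
    by (simp only: s(2)[of a b c d e] 35[of a c b d e] s(2)[of a c e d b] minus_minus)
  show "vand a b c d e = - vand e b c d a" for a b c d e :: 'a
    by (simp only: s(4)[of a b c d e] 14[of a b c e d] s(4)[of e b c a d] minus_minus)
qed

lemma vand5_transpose:
  assumes "i \<in> {1..5}" "j \<in> {1..5}" "i \<noteq> j"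
  shows "vand5 (r \<circ> Transposition.transpose i j) = - vand5 r"
proof -
  note sw = vand_swap_adjacent(1)[of "r 2" "r 1" "r 3" "r 4" "r 5"]
    vand_swap_adjacent(2)[of "r 1" "r 3" "r 2" "r 4" "r 5"]
    vand_swap_adjacent(3)[of "r 1" "r 2" "r 4" "r 3" "r 5"]
    vand_swap_adjacent(4)[of "r 1" "r 2" "r 3" "r 5" "r 4"]
    vand_swap_distant(1)[of "r 3" "r 2" "r 1" "r 4" "r 5"]
    vand_swap_distant(2)[of "r 1" "r 4" "r 3" "r 2" "r 5"]
    vand_swap_distant(3)[of "r 1" "r 2" "r 5" "r 4" "r 3"]
    vand_swap_distant(4)[of "r 4" "r 2" "r 3" "r 1" "r 5"]
    vand_swap_distant(5)[of "r 1" "r 5" "r 3" "r 4" "r 2"]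
    vand_swap_distant(6)[of "r 5" "r 2" "r 3" "r 4" "r 1"]
  have lt: "vand5 (r \<circ> Transposition.transpose i j) = - vand5 r" if "i < j" "i \<in> {1..5}" "j \<in> {1..5}" for i j
  proof -
    have ij: "i \<in> {1, 2, 3, 4, 5}" "j \<in> {1, 2, 3, 4, 5}" using that(2,3) by auto
    show ?thesis
      using that(1) ij
      by (elim insertE emptyE) (simp_all add: transpose_def sw del: One_nat_def)
  qed
  show ?thesis
  proof (cases "i < j")
    case False
    then have "j < i" using assms(3) by simp
    then show ?thesis using lt[of j i] assms by (simp add: transpose_commute)
  qed (use lt assms in blast)
qed

text \<open>The right side runs over ordered pairs; ten factors are reversed, an even number, so no
  sign appears.\<close>

lemma vand_square_eq_prod:
  "vand a b c d e ^ 2 = ((a - b) * (a - c) * (a - d) * (a - e)) * ((b - a) * (b - c) * (b - d) * (b - e)) *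
     ((c - a) * (c - b) * (c - d) * (c - e)) * ((d - a) * (d - b) * (d - c) * (d - e)) *
     ((e - a) * (e - b) * (e - c) * (e - d))"
  unfolding vand_def power2_eq_square
    minus_diff_eq[of a b, symmetric] minus_diff_eq[of a c, symmetric] minus_diff_eq[of a d, symmetric]
    minus_diff_eq[of a e, symmetric] minus_diff_eq[of b c, symmetric] minus_diff_eq[of b d, symmetric]
    minus_diff_eq[of b e, symmetric] minus_diff_eq[of c d, symmetric] minus_diff_eq[of c e, symmetric]
    minus_diff_eq[of d e, symmetric]
  by (simp only: mult_minus_left mult_minus_right minus_minus mult_ac)

lemma vand5_permute:
  assumes "p permutes {1..5 :: nat}"
  shows "vand5 (r \<circ> p) = of_int (sign p) * vand5 r"
proof -
  have fin: "finite {1..5 :: nat}" by simp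
  have "\<forall>r. vand5 (r \<circ> p) = of_int (sign p) * vand5 r"
    using assms fin
  proof (induction rule: permutes_induct)
    case id
    show ?case by (simp add: sign_id)
  next
    case (swap a b p)
    show ?case
    proof
      fix r :: "nat \<Rightarrow> complex"
      have perm: "permutation p" using swap.hyps permutation_permutes by blast
      show "vand5 (r \<circ> (Transposition.transpose a b \<circ> p)) = of_int (sign (Transposition.transpose a b \<circ> p)) * vand5 r"
      proof (cases "a = b")
        case True
        then show ?thesis using swap.IH by simp
      next
        case False
        have "vand5 (r \<circ> (Transposition.transpose a b \<circ> p)) = vand5 ((r \<circ> Transposition.transpose a b) \<circ> p)"
          by (simp only: o_assoc)
        also have "\<dots> = of_int (sign p) * vand5 (r \<circ> Transposition.transpose a b)" using swap.IH by blast
        also have "vand5 (r \<circ> Transposition.transpose a b) = - vand5 r"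
          by (rule vand5_transpose) (use swap.hyps False in auto)
        also have "of_int (sign p) * (- vand5 r) = of_int (sign (Transposition.transpose a b \<circ> p)) * vand5 r"
          using False by (simp add: sign_compose permutation_swap_id perm sign_swap_id)
        finally show ?thesis .
      qed
    qed
  qed
  then show ?thesis by blast
qed

lemma quintic_roots_exist:
  obtains r where "quintic_roots a b r"
proof -
  let ?f = "map_poly of_int (quintic a b) :: complex poly"
  have deg: "Polynomial.degree ?f = 5" by (simp add: quintic_def map_poly_pCons degree_map_poly)
  have lead: "Polynomial.lead_coeff ?f = 1" by (simp add: quintic_def map_poly_pCons)
  obtain as where as: "Polynomial.smult (Polynomial.lead_coeff ?f) (\<Prod>a\<leftarrow>as. [:- a, 1:]) = ?f" "length as = Polynomial.degree ?f"
    using fundamental_theorem_algebra_factorized[of ?f] by blast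
  have "length as = 5" using as(2) deg by simp
  then obtain x1 x2 x3 x4 x5 where x: "as = [x1, x2, x3, x4, x5]"
    by (auto simp: length_Suc_conv numeral_eq_Suc)
  have "quintic_roots a b (\<lambda>i. as ! (i - 1))"
    unfolding quintic_roots_def prod_1_5 using as(1)
    by (simp add: x lead quintic_def mult.assoc del: mult_pCons_left mult_pCons_right)
  then show thesis by (rule that)
qed

lemma quintic_rootsD:
  assumes "quintic_roots a b r"
  shows "r 1 + r 2 + r 3 + r 4 + r 5 = 0"
    "r 1 * r 2 + r 1 * r 3 + r 1 * r 4 + r 1 * r 5 + r 2 * r 3 + r 2 * r 4 + r 2 * r 5 + r 3 * r 4 + r 3 * r 5 + r 4 * r 5 = 0"
    "r 1 * r 2 * r 3 + r 1 * r 2 * r 4 + r 1 * r 2 * r 5 + r 1 * r 3 * r 4 + r 1 * r 3 * r 5 + r 1 * r 4 * r 5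
      + r 2 * r 3 * r 4 + r 2 * r 3 * r 5 + r 2 * r 4 * r 5 + r 3 * r 4 * r 5 = 0"
    "r 1 * r 2 * r 3 * r 4 + r 1 * r 2 * r 3 * r 5 + r 1 * r 2 * r 4 * r 5 + r 1 * r 3 * r 4 * r 5 + r 2 * r 3 * r 4 * r 5 = of_int a"
    "r 1 * r 2 * r 3 * r 4 * r 5 = - of_int b"
proof -
  have f: "map_poly of_int (quintic a b) = [:- r 1, 1:] * [:- r 2, 1:] * [:- r 3, 1:] * [:- r 4, 1:] * [:- r 5, 1:]"
    using assms unfolding quintic_roots_def prod_1_5 .
  have e: "[:of_int b, of_int a, 0, 0, 0, 1 :: complex:] = [:- r 1, 1:] * [:- r 2, 1:] * [:- r 3, 1:] * [:- r 4, 1:] * [:- r 5, 1:]"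
    unfolding f[symmetric] quintic_def by (simp add: map_poly_pCons)
  have m2: "[:- A, 1:] * [:- B, 1:] = [:A * B, - (A + B), 1 :: complex:]" for A B by simp
  have m3: "[:u, v, 1:] * [:- C, 1:] = [:- (u * C), u - v * C, v - C, 1 :: complex:]" for u v C by simp
  have m4: "[:u, v, w, 1:] * [:- C, 1:] = [:- (u * C), u - v * C, v - w * C, w - C, 1 :: complex:]"
    for u v w C by simp
  have m5: "[:u, v, w, x, 1:] * [:- C, 1:]
      = [:- (u * C), u - v * C, v - w * C, w - x * C, x - C, 1 :: complex:]" for u v w x C by simp
  note e' = e[unfolded m2 m3 m4 m5 pCons_eq_iff]
  show "r 1 + r 2 + r 3 + r 4 + r 5 = 0"
    "r 1 * r 2 + r 1 * r 3 + r 1 * r 4 + r 1 * r 5 + r 2 * r 3 + r 2 * r 4 + r 2 * r 5 + r 3 * r 4 + r 3 * r 5 + r 4 * r 5 = 0"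
    "r 1 * r 2 * r 3 + r 1 * r 2 * r 4 + r 1 * r 2 * r 5 + r 1 * r 3 * r 4 + r 1 * r 3 * r 5 + r 1 * r 4 * r 5
      + r 2 * r 3 * r 4 + r 2 * r 3 * r 5 + r 2 * r 4 * r 5 + r 3 * r 4 * r 5 = 0"
    "r 1 * r 2 * r 3 * r 4 + r 1 * r 2 * r 3 * r 5 + r 1 * r 2 * r 4 * r 5 + r 1 * r 3 * r 4 * r 5 + r 2 * r 3 * r 4 * r 5 = of_int a"
    "r 1 * r 2 * r 3 * r 4 * r 5 = - of_int b"
    using e' by Groebner_Basis.algebra+
qed

lemma quintic_root_iff:
  assumes "quintic_roots a b r"
  shows "poly (map_poly of_int (quintic a b)) z = (\<Prod>i\<in>{1..5}. z - r i)"
    "poly (map_poly of_int (quintic a b)) z = 0 \<longleftrightarrow> (\<exists>i\<in>{1..5}. z = r i)"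
  using assms unfolding quintic_roots_def by (auto simp: poly_prod)

lemma quintic_roots_algebraic_int:
  assumes "quintic_roots a b r" "i \<in> {1..5}"
  shows "algebraic_int (r i)"
proof -
  have "poly (map_poly of_int (quintic a b)) (r i) = 0" using quintic_root_iff(2)[OF assms(1)] assms(2) by blast
  moreover have "Polynomial.lead_coeff (quintic a b) = 1" by (simp add: quintic_def)
  ultimately show ?thesis unfolding algebraic_int_altdef_ipoly by blast
qed

lemma quintic_roots_permute:
  assumes "quintic_roots a b r" "p permutes {1..5}"
  shows "quintic_roots a b (r \<circ> p)"
  using assms(1) prod.permute[OF assms(2), of "\<lambda>i. [:- r i, 1:]"]
  by (simp add: quintic_roots_def comp_def)

text \<open>Let \<open>g\<close> be the quintic. As \<open>vand\<^sup>2 = \<Prod> g'(r\<^sub>i)\<close> and \<open>r g'(r) = 5 g(r) - 4a (r + 5w)\<close>, the discriminant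
  comes down to \<open>\<Prod> (r\<^sub>i + 5w) = - g(- 5w)\<close>, which is \<open>w\<close> when \<open>a = 1 - 3125 w\<^sup>4\<close>.\<close>

lemma vand_square:
  assumes r: "quintic_roots a (4 * a * w) r" and a: "a = 1 - 3125 * w ^ 4" and nz: "a \<noteq> 0" "w \<noteq> 0"
  shows "vand5 r ^ 2 = (16 * of_int a ^ 2) ^ 2"
proof -
  let ?g = "map_poly of_int (quintic a (4 * a * w)) :: complex poly"
  let ?A = "of_int a :: complex" and ?W = "of_int w :: complex"
  have g': "poly (pderiv ?g) z = 5 * z ^ 4 + ?A" for z
    by (simp add: quintic_def map_poly_pCons pderiv_pCons algebra_simps numeral_eq_Suc)
  have g: "?g = [:- r 1, 1:] * [:- r 2, 1:] * [:- r 3, 1:] * [:- r 4, 1:] * [:- r 5, 1:]"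
    using r unfolding quintic_roots_def prod_1_5 .
  have d: "poly (pderiv ?g) z = (z - r 2) * (z - r 3) * (z - r 4) * (z - r 5) + (z - r 1) * (z - r 3) * (z - r 4) * (z - r 5)
     + (z - r 1) * (z - r 2) * (z - r 4) * (z - r 5) + (z - r 1) * (z - r 2) * (z - r 3) * (z - r 5)
     + (z - r 1) * (z - r 2) * (z - r 3) * (z - r 4)" for z
  proof -
    have lin: "poly [:- c, 1:] z = z - c" "poly (pderiv [:- c, 1:]) z = 1" for c z :: complex
      by (simp_all add: pderiv_pCons)
    have gen: "A * B * C * D * 1 + E * (A * B * C * 1 + D * (A * B * 1 + C * (A * 1 + B * 1)))
      = B * C * D * E + A * C * D * E + A * B * D * E + A * B * C * E + A * B * C * D" for A B C D E :: complex
      by (simp add: algebra_simps)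
    show ?thesis unfolding g pderiv_mult poly_add poly_mult lin by (rule gen)
  qed
  have "vand5 r ^ 2 = (5 * r 1 ^ 4 + ?A) * (5 * r 2 ^ 4 + ?A) * (5 * r 3 ^ 4 + ?A) * (5 * r 4 ^ 4 + ?A) * (5 * r 5 ^ 4 + ?A)"
    unfolding vand_square_eq_prod g'[symmetric] d by simp
  moreover have rd: "r i * (5 * r i ^ 4 + ?A) = - 4 * ?A * (r i + 5 * ?W)" if "i \<in> {1..5}" for i
  proof -
    have "poly ?g (r i) = 0" using quintic_root_iff(2)[OF r] that by blast
    then have "r i ^ 5 + ?A * r i + 4 * ?A * ?W = 0" by (simp add: poly_quintic)
    moreover have "r i * (5 * r i ^ 4 + ?A) = 5 * (r i ^ 5 + ?A * r i + 4 * ?A * ?W) - 4 * ?A * (r i + 5 * ?W)"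
      by (simp add: algebra_simps numeral_eq_Suc)
    ultimately show ?thesis by simp
  qed
  \<comment> \<open>Multiplying by the product of the roots, which is - 4 a w, supplies each
    derivative with the factor that \<open>rd\<close> requires; it is cancelled at the end because
    \<open>a\<close> and \<open>w\<close> are nonzero.\<close>
  ultimately have "(r 1 * r 2 * r 3 * r 4 * r 5) * vand5 r ^ 2 = (r 1 * (5 * r 1 ^ 4 + ?A)) * (r 2 * (5 * r 2 ^ 4 + ?A)) *
      (r 3 * (5 * r 3 ^ 4 + ?A)) * (r 4 * (5 * r 4 ^ 4 + ?A)) * (r 5 * (5 * r 5 ^ 4 + ?A))"
    by (simp only: mult_ac)
  also have "\<dots> = (- 4 * ?A) ^ 5 * ((r 1 + 5 * ?W) * (r 2 + 5 * ?W) * (r 3 + 5 * ?W) * (r 4 + 5 * ?W) * (r 5 + 5 * ?W))"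
  proof -
    have gen: "(c * s1) * (c * s2) * (c * s3) * (c * s4) * (c * s5) = c ^ 5 * (s1 * s2 * s3 * s4 * s5)"
      for c s1 s2 s3 s4 s5 :: complex by (simp add: numeral_eq_Suc mult_ac)
    have one5: "1 \<in> {1..5::nat}" "2 \<in> {1..5::nat}" "3 \<in> {1..5::nat}" "4 \<in> {1..5::nat}" "5 \<in> {1..5::nat}"
      by auto
    show ?thesis unfolding one5[THEN rd] by (rule gen)
  qed
  also have "(r 1 + 5 * ?W) * (r 2 + 5 * ?W) * (r 3 + 5 * ?W) * (r 4 + 5 * ?W) * (r 5 + 5 * ?W) = - poly ?g (- 5 * ?W)"
  proof -
    have "poly ?g (- 5 * ?W) = (- (r 1 + 5 * ?W)) * (- (r 2 + 5 * ?W)) * (- (r 3 + 5 * ?W)) * (- (r 4 + 5 * ?W)) * (- (r 5 + 5 * ?W))"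
      unfolding quintic_root_iff(1)[OF r] prod_1_5 by (simp add: algebra_simps)
    moreover have "A * B * C * D * E = - ((- A) * (- B) * (- C) * (- D) * (- E))" for A B C D E :: complex
      by (simp only: mult_minus_left mult_minus_right minus_minus)
    ultimately show ?thesis by metis
  qed
  \<comment> \<open>The origin of \<open>a\<close>: the value of the quintic at - 5 w is - w (3125
    w^4 + a), and \<open>a\<close> is chosen to make the bracket 1.\<close>
  also have "poly ?g (- 5 * ?W) = - ?W"
  proof -
    have "?A = 1 - 3125 * ?W ^ 4" by (simp add: a)
    moreover have "poly ?g (- 5 * ?W) = (- 5 * ?W) ^ 5 + ?A * (- 5 * ?W) + 4 * ?A * ?W"
      unfolding poly_quintic by simp
    ultimately show ?thesis by Groebner_Basis.algebra
  qed
  finally have "(- 4 * ?A * ?W) * vand5 r ^ 2 = (- 4 * ?A) ^ 5 * - (- ?W)"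
    using quintic_rootsD(5)[OF r] by simp
  then have "(- 4 * ?A * ?W) * vand5 r ^ 2 = (- 4 * ?A * ?W) * (16 * ?A ^ 2) ^ 2"
    by (simp add: power2_eq_square numeral_eq_Suc algebra_simps)
  then show ?thesis using nz by simp
qed

text \<open>Two roots are swapped if necessary. The sign matters: for the opposite one,
  \<open>cyc_sum\<close> is the negative of a root of the sextic.\<close>

lemma quintic_roots_positive:
  assumes a: "a = 1 - 3125 * w ^ 4" and nz: "a \<noteq> 0" "w \<noteq> 0"
  obtains r where "quintic_roots a (4 * a * w) r" "vand5 r = 16 * of_int a ^ 2"
proof -
  obtain r where r: "quintic_roots a (4 * a * w) r" by (rule quintic_roots_exist)
  have "vand5 r = 16 * of_int a ^ 2 \<or> vand5 r = - (16 * of_int a ^ 2)"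
    using vand_square[OF r a nz] by (simp only: power2_eq_iff)
  then show thesis
  proof
    assume "vand5 r = - (16 * of_int a ^ 2)"
    then have "vand5 (r \<circ> Transposition.transpose 1 2) = 16 * of_int a ^ 2"
      using vand5_transpose[of 1 2 r] by simp
    moreover have "quintic_roots a (4 * a * w) (r \<circ> Transposition.transpose 1 2)"
      by (rule quintic_roots_permute[OF r permutes_swap_id]) auto
    ultimately show thesis using that by blast
  qed (use that r in blast)
qed

lemma sextic_root:
  assumes r: "quintic_roots a b r" and V: "vand5 r = 16 * of_int a ^ 2"
  shows "poly (map_poly of_int (sextic a)) (cyc_sum (r 1) (r 2) (r 3) (r 4) (r 5)) = 0"
  using resolvent_identity[OF quintic_rootsD(1-4)[OF r]] V
  unfolding poly_sextic by Groebner_Basis.algebra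

lemma vand5_nonzero_distinct:
  assumes "vand5 r \<noteq> 0" "i \<in> {1..5}" "j \<in> {1..5}" "i \<noteq> j"
  shows "r i \<noteq> r j"
proof
  assume eq: "r i = r j"
  have "r \<circ> Transposition.transpose i j = r" using eq by (auto simp: fun_eq_iff transpose_def)
  then have "vand5 r = - vand5 r" using vand5_transpose[OF assms(2-4), of r] by simp
  then show False using assms(1) by simp
qed

text \<open>The Frobenius map permutes the roots of the quintic modulo a prime ideal above \<open>p\<close>. The permutation
  is even because \<open>vand\<close> is an integer, so it has a fixed point or is a five-cycle; in the latter
  case it fixes a root of the sextic.\<close>

lemma root_mod_prime:
  fixes p :: nat
  assumes p: "Factorial_Ring.prime p" and r: "quintic_roots a b r" and V: "vand5 r = 16 * of_int a ^ 2"
    and pa: "\<not> int p dvd 2 * a"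
  shows "(\<exists>n. int p dvd poly (quintic a b) n) \<or> (\<exists>n. int p dvd poly (sextic a) n)"
proof -
  obtain M where M: "alg_ideal M" "of_nat p \<in> M" "1 \<notin> M"
    and prime: "\<And>x y. algebraic_int x \<Longrightarrow> algebraic_int y \<Longrightarrow> x * y \<in> M \<Longrightarrow> x \<in> M \<or> y \<in> M"
    using prime_alg_ideal_exists[OF p] by blast
  have pp: "Factorial_Ring.prime (int p)" using p by simp
  note intM = prime_alg_ideal_of_int[OF p M]
  let ?g = "map_poly of_int (quintic a b) :: complex poly"
  have ri: "algebraic_int (r i)" if "i \<in> {1..5}" for i by (rule quintic_roots_algebraic_int[OF r that])
  have prodM: "\<exists>i\<in>T. f i \<in> M" if "finite T" "(\<Prod>i\<in>T. f i) \<in> M" "\<And>i. i \<in> T \<Longrightarrow> algebraic_int (f i)"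
    for T :: "nat set" and f
    using that
  proof (induction T rule: finite_induct)
    case (insert t T)
    have "algebraic_int (f t)" "algebraic_int (prod f T)"
      using insert.prems(2) by (auto intro: algebraic_int_prod)
    then show ?case using prime[of "f t" "prod f T"] insert by auto
  qed (use M(3) in simp)
  have VM: "vand5 r \<notin> M"
  proof
    assume "vand5 r \<in> M"
    then have "of_int (16 * a ^ 2) \<in> M" using V by simp
    then have "int p dvd 16 * a ^ 2" by (simp only: intM)
    also have "16 * a ^ 2 dvd (2 * a) ^ 4" by (simp add: power_mult_distrib power2_eq_square numeral_eq_Suc)
    finally show False using prime_dvd_power[OF pp] pa by blast
  qed
  \<comment> \<open>Swapping two roots that are congruent modulo \<open>M\<close> changes
    \<open>vand5\<close> only within its class, but it also negates it; then \<open>M\<close> would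
    contain 2 or \<open>vand5 r\<close>.\<close>
  have diffM: "r i - r j \<notin> M" if ij: "i \<in> {1..5}" "j \<in> {1..5}" "i \<noteq> j" for i j
  proof
    assume d: "r i - r j \<in> M"
    have c: "cong_ideal M ((r \<circ> Transposition.transpose i j) k) (r k)" if "k \<in> {1..5}" for k
      using ri d ij that alg_idealD(6)[OF M(1) d]
      by (auto simp: cong_ideal_def transpose_def alg_idealD(2)[OF M(1)])
    have "cong_ideal M (vand5 (r \<circ> Transposition.transpose i j)) (vand5 r)"
      unfolding vand_def by (intro cong_ideal_mult[OF M(1)] cong_ideal_diff[OF M(1)] c) auto
    then have "- vand5 r - vand5 r \<in> M" unfolding vand5_transpose[OF ij] by (simp add: cong_ideal_def)
    then have "of_int (- 2) * vand5 r \<in> M" by simp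
    then have "of_int (- 2) \<in> M \<or> vand5 r \<in> M"
      by (rule prime[rotated 2]) (simp_all only: V algebraic_int_of_int, use algebraic_int_of_int[of "16 * a ^ 2"] in simp)
    then have "int p dvd - 2" using VM intM by blast
    then show False using pa by simp
  qed
  \<comment> \<open>The p-th power of a root is a root modulo \<open>M\<close> because the
    coefficients are integers; since \<open>M\<close> is prime, it is congruent to one of the five
    roots.\<close>
  have ex: "\<exists>j\<in>{1..5}. cong_ideal M (r i ^ p) (r j)" if i: "i \<in> {1..5}" for i
  proof -
    have "poly ?g (r i) = 0" using quintic_root_iff(2)[OF r] i by blast
    moreover have "cong_ideal M (poly ?g (r i) ^ p) (poly ?g (r i ^ p))"
      by (rule frobenius_poly[OF p M(1,2) ri[OF i]])
    ultimately have "0 - poly ?g (r i ^ p) \<in> M"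
      using prime_gt_0_nat[OF p] by (simp add: cong_ideal_def zero_power)
    then have "(\<Prod>j\<in>{1..5}. r i ^ p - r j) \<in> M"
      using alg_idealD(6)[OF M(1)] by (fastforce simp: quintic_root_iff(1)[OF r])
    then have "\<exists>j\<in>{1..5}. r i ^ p - r j \<in> M"
      by (rule prodM[rotated]) (rule algebraic_int_diff[OF algebraic_int_power[OF ri[OF i]] ri] | simp)+
    then show ?thesis using ri i by (auto simp: cong_ideal_def intro: algebraic_int_power)
  qed
  \<comment> \<open>The permutation induced by Frobenius on the indices, extended by the identity so
    that it \<open>permutes\<close> {1..5}.\<close>
  define q where "q i = (if i \<in> {1..5} then SOME j. j \<in> {1..5} \<and> cong_ideal M (r i ^ p) (r j) else i)" for i
  have q: "q i \<in> {1..5}" "cong_ideal M (r i ^ p) (r (q i))" if "i \<in> {1..5}" for i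
    using someI_ex[of "\<lambda>j. j \<in> {1..5} \<and> cong_ideal M (r i ^ p) (r j)"] ex[OF that] that
    by (auto simp: q_def Bex_def)
  have powM: "x \<in> M" if "x ^ n \<in> M" "algebraic_int x" for x and n :: nat
    using that
  proof (induction n)
    case (Suc n)
    then show ?case using prime[of x "x ^ n"] algebraic_int_power by auto
  qed (use M(3) in simp)
  have "inj_on q {1..5}"
  proof (rule inj_onI, rule ccontr)
    fix i j assume ij: "i \<in> {1..5}" "j \<in> {1..5}" "q i = q j" "i \<noteq> j"
    have "cong_ideal M (r i ^ p) (r j ^ p)"
      using cong_ideal_trans[OF M(1) q(2)[OF ij(1)]] cong_ideal_sym[OF M(1) q(2)[OF ij(2)]] ij(3) by simp
    moreover have "cong_ideal M ((r i - r j) ^ p) (r i ^ p - r j ^ p)"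
      by (rule frobenius_diff[OF p M(1,2) ri[OF ij(1)] ri[OF ij(2)]])
    ultimately have "(r i - r j) ^ p - (r i ^ p - r j ^ p) + (r i ^ p - r j ^ p) \<in> M"
      by (intro alg_idealD(3)[OF M(1)]) (simp_all add: cong_ideal_def)
    then have "r i - r j \<in> M" using powM[of "r i - r j" p] algebraic_int_diff ri ij by simp
    then show False using diffM ij by blast
  qed
  moreover have "q ` {1..5} \<subseteq> {1..5}" using q(1) by blast
  ultimately have "bij_betw q {1..5} {1..5}"
    by (simp add: bij_betw_def endo_inj_surj)
  then have perm: "q permutes {1..5}" by (rule bij_imp_permutes) (unfold q_def, rule if_not_P)
  have one5: "1 \<in> {1..5::nat}" "2 \<in> {1..5::nat}" "3 \<in> {1..5::nat}" "4 \<in> {1..5::nat}" "5 \<in> {1..5::nat}"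
    by auto
  have frob_diff: "cong_ideal M ((r i - r j) ^ p) (r (q i) - r (q j))" if "i \<in> {1..5}" "j \<in> {1..5}" for i j
    by (rule cong_ideal_trans[OF M(1) frobenius_diff[OF p M(1,2) ri[OF that(1)] ri[OF that(2)]]])
       (intro cong_ideal_diff[OF M(1)] q that)
  \<comment> \<open>Frobenius fixes the integer \<open>vand5 r\<close> modulo \<open>M\<close>,
    whereas an odd \<open>q\<close> would send it to its negative.\<close>
  have even: "evenperm q"
  proof (rule ccontr)
    assume "\<not> evenperm q"
    then have Vq: "vand5 (r \<circ> q) = - vand5 r" using vand5_permute[OF perm, of r] by (simp add: sign_def)
    have c1: "cong_ideal M (vand5 r ^ p) (vand5 (r \<circ> q))"
      unfolding vand_def power_mult_distrib comp_apply
      by (intro cong_ideal_mult[OF M(1)] frob_diff one5)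
    have c2: "cong_ideal M (vand5 r ^ p) (vand5 r)"
      using frobenius_of_int[OF p M(1,2), of "16 * a ^ 2"] V by simp
    have "cong_ideal M (vand5 r) (- vand5 r)"
      using cong_ideal_trans[OF M(1) cong_ideal_sym[OF M(1) c2] c1] unfolding Vq .
    then have "of_int 2 * vand5 r \<in> M" by (simp add: cong_ideal_def)
    then have "of_int 2 \<in> M \<or> vand5 r \<in> M"
      by (rule prime[rotated 2]) (simp_all only: V algebraic_int_of_int, use algebraic_int_of_int[of "16 * a ^ 2"] in simp)
    then have "int p dvd 2" using VM intM by blast
    then show False using pa by simp
  qed
  \<comment> \<open>A root fixed by Frobenius is congruent to an integer n, and an integer value
    f(n) lying in \<open>M\<close> is divisible by \<open>p\<close>.\<close>
  have to_int: "\<exists>n. int p dvd poly f n"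
    if x: "cong_ideal M (x ^ p) x" and f: "poly (map_poly of_int f) x = 0" for x f
  proof -
    obtain n where n: "cong_ideal M x (of_int n)"
      by (rule frobenius_fixed_is_integer[OF p M prime x])
    from cong_ideal_poly[OF M(1) this, of f] have "- of_int (poly f n) \<in> M"
      using f by (simp add: cong_ideal_def of_int_hom.poly_map_poly)
    then have "of_int (poly f n) \<in> M" using alg_idealD(6)[OF M(1)] by fastforce
    then show ?thesis using intM by blast
  qed
  show ?thesis
  proof (cases "\<exists>i\<in>{1..5}. q i = i")
    case True
    then obtain i where i: "i \<in> {1..5}" "q i = i" by blast
    have "cong_ideal M (r i ^ p) (r i)" using q(2)[OF i(1)] i(2) by simp
    moreover have "poly ?g (r i) = 0" using quintic_root_iff(2)[OF r] i(1) by blast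
    ultimately show ?thesis using to_int by blast
  next
    case False
    then obtain i j k l m where c: "distinct [i, j, k, l, m]" "{1..5} = {i, j, k, l, m}"
      "q = cycle_of_list [i, j, k, l, m]"
      using even_perm_five_without_fixed_point[OF perm even] by blast
    have qc: "q i = j" "q j = k" "q k = l" "q l = m" "q m = i"
      using c(1) by (auto simp: c(3) transpose_def)
    have mem: "i \<in> {1..5}" "j \<in> {1..5}" "k \<in> {1..5}" "l \<in> {1..5}" "m \<in> {1..5}" unfolding c(2) by auto
    have qr: "cong_ideal M (r i ^ p) (r j)" "cong_ideal M (r j ^ p) (r k)" "cong_ideal M (r k ^ p) (r l)"
      "cong_ideal M (r l ^ p) (r m)" "cong_ideal M (r m ^ p) (r i)"
      using q(2)[OF mem(1)] q(2)[OF mem(2)] q(2)[OF mem(3)] q(2)[OF mem(4)] q(2)[OF mem(5)] by (simp_all add: qc)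
    have fix_sum: "cong_ideal M (cyc_sum x1 x2 x3 x4 x5 ^ p) (cyc_sum y1 y2 y3 y4 y5)"
      if "cong_ideal M (x1 ^ p) y1" "cong_ideal M (x2 ^ p) y2" "cong_ideal M (x3 ^ p) y3"
        "cong_ideal M (x4 ^ p) y4" "cong_ideal M (x5 ^ p) y5" "algebraic_int x1" "algebraic_int x2"
        "algebraic_int x3" "algebraic_int x4" "algebraic_int x5" for x1 x2 x3 x4 x5 y1 y2 y3 y4 y5
    proof -
      have add: "cong_ideal M ((u + v) ^ p) (u' + v')"
        if "cong_ideal M (u ^ p) u'" "cong_ideal M (v ^ p) v'" "algebraic_int u" "algebraic_int v" for u v u' v'
        by (rule cong_ideal_trans[OF M(1) frobenius_add[OF p M(1,2) that(3,4)] cong_ideal_add[OF M(1) that(1,2)]])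
      have mult: "cong_ideal M ((u * v) ^ p) (u' * v')"
        if "cong_ideal M (u ^ p) u'" "cong_ideal M (v ^ p) v'" for u v u' v'
        unfolding power_mult_distrib by (rule cong_ideal_mult[OF M(1) that])
      show ?thesis unfolding cyc_sum_def by (intro add mult that algebraic_int_plus_times)
    qed
    have "vand (r i) (r j) (r k) (r l) (r m) = vand5 r \<or> vand (r i) (r j) (r k) (r l) (r m) = - vand5 r"
    proof -
      obtain g where g: "g permutes {1..5}" "g 1 = i" "g 2 = j" "g 3 = k" "g 4 = l" "g 5 = m"
        by (rule permutation_of_five[OF c(1,2)])
      show ?thesis using vand5_permute[OF g(1), of r] g by (auto simp: sign_def split: if_splits)
    qed
    then show ?thesis
    proof
      assume v: "vand (r i) (r j) (r k) (r l) (r m) = vand5 r"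
      obtain g where g: "g permutes {1..5}" "g 1 = i" "g 2 = j" "g 3 = k" "g 4 = l" "g 5 = m"
        by (rule permutation_of_five[OF c(1,2)])
      have "poly (map_poly of_int (sextic a)) (cyc_sum (r i) (r j) (r k) (r l) (r m)) = 0"
        using sextic_root[OF quintic_roots_permute[OF r g(1)]] v V by (simp only: comp_apply g)
      moreover have "cong_ideal M (cyc_sum (r i) (r j) (r k) (r l) (r m) ^ p) (cyc_sum (r j) (r k) (r l) (r m) (r i))"
        by (rule fix_sum[OF qr]) (rule ri mem)+
      moreover have "cyc_sum (r j) (r k) (r l) (r m) (r i) = cyc_sum (r i) (r j) (r k) (r l) (r m)"
        by (simp add: cyc_sum_def)
      ultimately show ?thesis using to_int by metis
    next
      assume v: "vand (r i) (r j) (r k) (r l) (r m) = - vand5 r"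
      \<comment> \<open>With the wrong sign, the complementary pentagon is taken. It is read off
        from the square of \<open>q\<close>, is an odd rearrangement of the first, and is rotated by
        \<open>q\<close> as well.\<close>
      have c': "distinct [i, k, m, j, l]" "{1..5} = {i, k, m, j, l}" using c(1,2) by auto
      obtain g where g: "g permutes {1..5}" "g 1 = i" "g 2 = k" "g 3 = m" "g 4 = j" "g 5 = l"
        by (rule permutation_of_five[OF c'])
      have "vand (r i) (r k) (r m) (r j) (r l) = - vand (r i) (r k) (r j) (r m) (r l)" by (rule vand_swap_adjacent(3))
      also have "\<dots> = - vand (r i) (r j) (r k) (r l) (r m)"
        using vand_swap_adjacent(2)[of "r i" "r k" "r j" "r m" "r l"] vand_swap_adjacent(4)[of "r i" "r j" "r k" "r m" "r l"] by simp
      finally have "vand (r i) (r k) (r m) (r j) (r l) = vand5 r" using v by simp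
      then have "poly (map_poly of_int (sextic a)) (cyc_sum (r i) (r k) (r m) (r j) (r l)) = 0"
        using sextic_root[OF quintic_roots_permute[OF r g(1)]] V by (simp only: comp_apply g)
      moreover have "cong_ideal M (cyc_sum (r i) (r k) (r m) (r j) (r l) ^ p) (cyc_sum (r j) (r l) (r i) (r k) (r m))"
        by (rule fix_sum[OF qr(1) qr(3) qr(5) qr(2) qr(4)]) (rule ri mem)+
      moreover have "cyc_sum (r j) (r l) (r i) (r k) (r m) = cyc_sum (r i) (r k) (r m) (r j) (r l)"
        by (simp add: cyc_sum_def)
      ultimately show ?thesis using to_int by metis
    qed
  qed
qed

section \<open>Roots modulo every integer\<close>

lemma poly_taylor2:
  fixes f :: "int poly"
  shows "\<exists>c. poly f (x + h) = poly f x + h * poly (pderiv f) x + h ^ 2 * c"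
proof (induction f)
  case (pCons a f)
  then obtain c where c: "poly f (x + h) = poly f x + h * poly (pderiv f) x + h ^ 2 * c" by blast
  have "poly (pCons a f) (x + h) = poly (pCons a f) x + h * poly (pderiv (pCons a f)) x
      + h ^ 2 * (poly (pderiv f) x + (x + h) * c)"
    unfolding poly_pCons pderiv_pCons poly_add c by (simp add: power2_eq_square algebra_simps)
  then show ?case by blast
qed simp

lemma poly_cong_int: "(m :: int) dvd x - y \<Longrightarrow> m dvd poly f x - poly f y"
proof (induction f)
  case (pCons a f)
  have "poly (pCons a f) x - poly (pCons a f) y = x * (poly f x - poly f y) + (x - y) * poly f y"
    by (simp add: algebra_simps)
  then show ?case using pCons by simp
qed simp

lemma hensel:
  fixes f :: "int poly" and p :: nat
  assumes p: "Factorial_Ring.prime p" and x: "int p dvd poly f x" "\<not> int p dvd poly (pderiv f) x"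
  shows "\<exists>y. int p ^ k dvd poly f y"
proof -
  \<comment> \<open>The congruence of \<open>y\<close> with \<open>x\<close> modulo \<open>p\<close>
    is carried along; it keeps the derivative at \<open>y\<close> prime to \<open>p\<close>.\<close>
  have "\<exists>y. int p ^ Suc k dvd poly f y \<and> int p dvd y - x" for k
  proof (induction k)
    case 0
    show ?case using x(1) by (intro exI[of _ x]) simp
  next
    case (Suc k)
    then obtain y where y: "int p ^ Suc k dvd poly f y" "int p dvd y - x" by blast
    then obtain u where u: "poly f y = int p ^ Suc k * u" by (elim dvdE)
    have "\<not> int p dvd poly (pderiv f) y"
      using poly_cong_int[OF y(2), of "pderiv f"] x(2) dvd_diff[of "int p" "poly (pderiv f) y"] by fastforce
    then have "coprime (poly (pderiv f) y) (int p)"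
      using prime_imp_coprime[of "int p" "poly (pderiv f) y"] p
      by (simp add: coprime_commute[of "poly (pderiv f) y"])
    then obtain s t where st: "s * poly (pderiv f) y + t * int p = 1"
      by (metis bezout_int coprime_iff_gcd_eq_1)
    \<comment> \<open>Newton's correction: \<open>s\<close> inverts the derivative modulo
      \<open>p\<close>, so adding \<open>h\<close> cancels the value at \<open>y\<close> up to the
      next power of \<open>p\<close>.\<close>
    define h where "h = int p ^ Suc k * (- u * s)"
    obtain c where c: "poly f (y + h) = poly f y + h * poly (pderiv f) y + h ^ 2 * c"
      using poly_taylor2 by blast
    have "poly f y + h * poly (pderiv f) y = int p ^ Suc k * u * (1 - s * poly (pderiv f) y)"
      by (simp add: u h_def algebra_simps)
    also have "\<dots> = int p ^ Suc (Suc k) * (u * t)" using st by (simp add: algebra_simps flip: st)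
    finally have "poly f (y + h) = int p ^ Suc (Suc k) * (u * t + int p ^ k * (u * s) ^ 2 * c)"
      unfolding c by (simp add: h_def power2_eq_square algebra_simps)
    moreover have "int p dvd y + h - x"
    proof -
      have eq: "y + h - x = (y - x) + int p * (int p ^ k * (- u * s))" by (simp add: h_def)
      show ?thesis unfolding eq by (rule dvd_add[OF y(2) dvd_triv_left])
    qed
    ultimately show ?case by (metis dvd_triv_left)
  qed
  then obtain y where "int p ^ Suc k dvd poly f y" by blast
  then have "int p ^ k dvd poly f y" by (rule power_le_dvd) simp
  then show ?thesis by blast
qed

text \<open>The Chinese remainder theorem, splitting off the full power of one prime factor of
  \<open>m\<close> at each step.\<close>

lemma root_mod_all_if_prime_powers:
  fixes f :: "int poly"
  assumes "\<And>p k. Factorial_Ring.prime (p :: nat) \<Longrightarrow> \<exists>x. int p ^ k dvd poly f x" "m > 0"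
  shows "\<exists>x. int m dvd poly f x"
  using assms(2)
proof (induction m rule: less_induct)
  case (less m)
  show ?case
  proof (cases "m = 1")
    case False
    then obtain p where p: "Factorial_Ring.prime p" "p dvd m" using prime_factor_nat by blast
    obtain k n where kn: "m = p ^ k * n" "\<not> p dvd n" "k = multiplicity p m"
      using multiplicity_decompose'[of m p] less.prems p by (metis not_prime_unit neq0_conv)
    have "k \<noteq> 0"
    proof
      assume "k = 0"
      then have "m = n" using kn(1) by simp
      then show False using p(2) kn(2) by simp
    qed
    then have "k > 0" by simp
    then have "p ^ k > 1" by (rule one_less_power[OF prime_gt_1_nat[OF p(1)]])
    moreover have "n > 0" using kn(2) by (cases n) auto
    ultimately have "n < m" by (simp add: kn(1))
    then obtain y where y: "int n dvd poly f y" using less.IH \<open>n > 0\<close> by blast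
    obtain x where x: "int p ^ k dvd poly f x" using assms(1)[OF p(1)] by blast
    have "coprime (int (p ^ k)) (int n)"
      using kn(2) p(1) by (simp add: prime_imp_coprime)
    then obtain z where z: "[z = x] (mod int (p ^ k))" "[z = y] (mod int n)"
      using binary_chinese_remainder_int by blast
    have "int (p ^ k) dvd poly f z - poly f x" "int n dvd poly f z - poly f y"
      using z by (auto simp: cong_iff_dvd_diff intro: poly_cong_int)
    then have "int (p ^ k) dvd poly f z - poly f x + poly f x" "int n dvd poly f z - poly f y + poly f y"
      using x y by (intro dvd_add; simp)+
    then have "int (p ^ k) dvd poly f z" "int n dvd poly f z" by simp_all
    from divides_mult[OF this \<open>coprime (int (p ^ k)) (int n)\<close>] have "int (p ^ k) * int n dvd poly f z" .
    then show ?thesis unfolding kn(1) by auto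
  qed simp
qed

text \<open>In each of three cases Hensel's lemma starts from a simple root. If \<open>p\<close>
  divides \<open>w\<close>, it is the root 0 of the quintic, with derivative \<open>a\<close>. If
  \<open>p\<close> divides \<open>a\<close>, it is a root of the rescaled sextic. Otherwise
  Frobenius gives a root modulo \<open>p\<close> of one factor, and neither factor has multiple
  roots modulo \<open>p\<close>.\<close>

lemma quintic_sextic_prime_power_root:
  fixes p :: nat
  assumes p: "Factorial_Ring.prime p" and a: "a = 1 - 3125 * w ^ 4" and w: "10 dvd w" and nz: "a \<noteq> 0" "w \<noteq> 0"
  shows "\<exists>x. int p ^ k dvd poly (quintic a (4 * a * w) * sextic a) x"
proof -
  have pp: "Factorial_Ring.prime (int p)" using p by simp
  note pm = prime_dvd_mult_iff[OF pp]
  have canc: "int p dvd v" if "int p dvd u * v" "\<not> int p dvd u" for u v using that pm by blast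
  have ppow: "int p dvd u" if "int p dvd u ^ n" for u n using prime_dvd_power[OF pp that] .
  have pg: "poly (quintic a (4 * a * w)) n = n ^ 5 + a * n + 4 * a * w" for n
    using poly_quintic[of a "4 * a * w" n] by (simp add: map_poly_idI)
  have pg': "poly (pderiv (quintic a (4 * a * w))) n = 5 * n ^ 4 + a" for n
    by (simp add: quintic_def pderiv_pCons algebra_simps numeral_eq_Suc)
  have ps: "poly (sextic a) n = n ^ 6 - 5 * a * n ^ 4 + 15 * a ^ 2 * n ^ 2 - 16 * a ^ 2 * n + 5 * a ^ 3" for n
    using poly_sextic[of a n] by (simp add: map_poly_idI)
  have ps': "poly (pderiv (sextic a)) n = 6 * n ^ 5 - 20 * a * n ^ 3 + 30 * a ^ 2 * n - 16 * a ^ 2" for n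
    by (simp add: sextic_def pderiv_pCons algebra_simps numeral_eq_Suc)
  have "(\<exists>x. int p ^ k dvd poly (quintic a (4 * a * w)) x) \<or> (\<exists>x. int p ^ k dvd poly (sextic a) x)"
  proof -
    have aw: "\<not> (int p dvd a \<and> int p dvd w)"
    proof
      assume d: "int p dvd a \<and> int p dvd w"
      have "1 = a + w * (3125 * w ^ 3)" by (simp add: a power_eq_if)
      then have "int p dvd 1" using d by (metis dvd_add dvd_mult2)
      then show False using pp not_prime_unit by blast
    qed
    consider "int p dvd w" | "int p dvd a" | "\<not> int p dvd w" "\<not> int p dvd a" by blast
    then show ?thesis
    proof cases
      case 1
      have "\<exists>x. int p ^ k dvd poly (quintic a (4 * a * w)) x"
        by (rule hensel[OF p, of _ 0]) (use 1 aw in \<open>simp_all add: pg pg'\<close>)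
      then show ?thesis ..
    next
      case 2
      have p2: "\<not> int p dvd 2"
      proof
        assume "int p dvd 2"
        also have "2 dvd w" by (rule dvd_trans[OF _ w]) simp
        finally show False using 2 aw by blast
      qed
      \<comment> \<open>The sextic at a z, divided by a^3. Modulo a divisor \<open>p\<close> of
        \<open>a\<close> only 5 - 16 z remains, and 16 is invertible because 2 divides
        \<open>w\<close>, which is prime to \<open>a\<close>.\<close>
      define Q where "Q = [:5, - 16, 15 * a, 0, - 5 * a ^ 2, 0, a ^ 3:]"
      have PQ: "poly (sextic a) (a * z) = a ^ 3 * poly Q z" for z
        by (simp add: ps Q_def algebra_simps power_mult_distrib numeral_eq_Suc)
      have "\<not> int p dvd 16" using p2 ppow[of 2 4] by auto
      then have "coprime 16 (int p)" by (metis coprime_commute prime_imp_coprime pp)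
      then obtain s t where st: "s * 16 + t * int p = 1" by (metis bezout_int coprime_iff_gcd_eq_1)
      have "poly Q (5 * s) = 5 - 16 * (5 * s) + a * (15 * (5 * s) ^ 2 - 5 * a * (5 * s) ^ 4 + a ^ 2 * (5 * s) ^ 6)"
        by (simp add: Q_def algebra_simps power_mult_distrib numeral_eq_Suc)
      moreover have "5 - 16 * (5 * s) = int p * (5 * t)" using st by Groebner_Basis.algebra
      ultimately have "int p dvd poly Q (5 * s)" using 2 by simp
      moreover have "\<not> int p dvd poly (pderiv Q) (5 * s)"
      proof
        assume "int p dvd poly (pderiv Q) (5 * s)"
        moreover have Q': "poly (pderiv Q) z = a * (30 * z - 20 * a * z ^ 3 + 6 * a ^ 2 * z ^ 5) - 16" for z
          by (simp add: Q_def pderiv_pCons algebra_simps numeral_eq_Suc)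
        ultimately have "int p dvd a * (30 * (5 * s) - 20 * a * (5 * s) ^ 3 + 6 * a ^ 2 * (5 * s) ^ 5)
          - poly (pderiv Q) (5 * s)" using 2 by (intro dvd_diff) simp_all
        then have "int p dvd 16" unfolding Q' by simp
        then show False using \<open>\<not> int p dvd 16\<close> by blast
      qed
      ultimately obtain z where "int p ^ k dvd poly Q z" using hensel[OF p] by blast
      then show ?thesis using PQ by (metis dvd_mult)
    next
      case 3
      have p10: "\<not> int p dvd 10" using 3(1) w dvd_trans by blast
      have p2: "\<not> int p dvd 2"
      proof
        assume "int p dvd 2"
        then have "int p dvd 2 * 5" by (rule dvd_mult2)
        then show False using p10 by simp
      qed
      have p2a: "\<not> int p dvd 2 * a" using p2 3(2) pm by blast
      obtain r where r: "quintic_roots a (4 * a * w) r" "vand5 r = 16 * of_int a ^ 2"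
        by (rule quintic_roots_positive[OF a nz])
      from root_mod_prime[OF p r p2a] show ?thesis
      proof
        assume "\<exists>n. int p dvd poly (quintic a (4 * a * w)) n"
        then obtain n where n: "int p dvd poly (quintic a (4 * a * w)) n" by blast
        have "\<not> int p dvd poly (pderiv (quintic a (4 * a * w))) n"
        proof
          assume d: "int p dvd poly (pderiv (quintic a (4 * a * w))) n"
          \<comment> \<open>Five times the quintic minus n times its derivative is 4 a (n + 5 w), so
            a multiple root must be - 5 w; there the quintic takes the value - w, which is prime to
            \<open>p\<close>.\<close>
          have "2 * a * (2 * (n + 5 * w)) = 5 * poly (quintic a (4 * a * w)) n - n * poly (pderiv (quintic a (4 * a * w))) n"
            unfolding pg pg' by Groebner_Basis.algebra
          then have "int p dvd 2 * a * (2 * (n + 5 * w))" using n d by simp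
          then have "int p dvd n - (- 5 * w)" using p2a p2 pm by (metis diff_minus_eq_add mult_minus_left)
          from poly_cong_int[OF this, of "quintic a (4 * a * w)"]
          have d5: "int p dvd poly (quintic a (4 * a * w)) n - poly (quintic a (4 * a * w)) (- 5 * w)" .
          have "int p dvd poly (quintic a (4 * a * w)) (- 5 * w)"
            using dvd_diff[OF n d5] by simp
          moreover have "poly (quintic a (4 * a * w)) (- 5 * w) = - w"
            unfolding pg using a by Groebner_Basis.algebra
          ultimately show False using 3(1) by simp
        qed
        then show ?thesis using hensel[OF p n] by blast
      next
        assume "\<exists>n. int p dvd poly (sextic a) n"
        then obtain n where n: "int p dvd poly (sextic a) n" by blast
        have "\<not> int p dvd poly (pderiv (sextic a)) n"
        proof
          assume d: "int p dvd poly (pderiv (sextic a)) n"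
          \<comment> \<open>\<open>T\<close>, \<open>S\<close> and \<open>U\<close> come from
            eliminating between the sextic and its derivative. Only the factors 2, 5,
            \<open>a\<close> and a - 1 are cancelled on the way, and all of these are prime to
            \<open>p\<close>.\<close>
          define T where "T = n ^ 4 - 6 * a * n ^ 2 + 8 * a * n - 3 * a ^ 2"
          define S where "S = n ^ 3 - 3 * a * n ^ 2 + 3 * a * n - a ^ 2"
          define U where "U = 9 * n ^ 2 - 8 * n + 3 * a"
          have eq1: "10 * (a * T) = n * poly (pderiv (sextic a)) n - 6 * poly (sextic a) n"
            unfolding ps ps' T_def by Groebner_Basis.algebra
          have "int p dvd 10 * (a * T)" unfolding eq1 by (intro dvd_diff dvd_mult n d)
          from canc[OF canc[OF this p10] 3(2)] have T: "int p dvd T" .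
          have eq2: "2 * (2 * (2 * (a * S))) = (n ^ 2 + a) * T - poly (sextic a) n"
            unfolding ps T_def S_def by Groebner_Basis.algebra
          have "int p dvd 2 * (2 * (2 * (a * S)))" unfolding eq2 by (intro dvd_diff dvd_mult n T)
          from canc[OF canc[OF canc[OF canc[OF this p2] p2] p2] 3(2)] have S: "int p dvd S" .
          have eq3: "a * ((a - 1) * U) = T - n * S - 3 * a * S"
            unfolding T_def S_def U_def by Groebner_Basis.algebra
          have aU: "int p dvd a * ((a - 1) * U)" unfolding eq3 by (intro dvd_diff dvd_mult S T)
          \<comment> \<open>By the choice of \<open>a\<close>, this number is - 3125 w^4, and
            \<open>p\<close> divides neither 5 nor \<open>w\<close>.\<close>
          have "\<not> int p dvd a - 1"
          proof
            assume "int p dvd a - 1"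
            then have "int p dvd - (5 ^ 5 * w ^ 4)" by (simp add: a)
            then have "int p dvd 5 ^ 5 \<or> int p dvd w ^ 4" using pm by simp
            then have "int p dvd 5 \<or> int p dvd w" using ppow by blast
            moreover have "int p dvd 10" if "int p dvd 5" using dvd_mult[OF that, of 2] by simp
            ultimately show False using p10 3(1) by blast
          qed
          from canc[OF canc[OF aU 3(2)] this] have U: "int p dvd U" .
          have eq4: "2 * (2 * (2 * n ^ 2)) = 9 * S + U * (U - 9 * n ^ 2 + 7 * n)"
            unfolding S_def U_def by Groebner_Basis.algebra
          have "int p dvd 2 * (2 * (2 * n ^ 2))"
            unfolding eq4 by (intro dvd_add dvd_mult dvd_mult2[OF U] S)
          from canc[OF canc[OF canc[OF this p2] p2] p2] have "int p dvd n ^ 2" .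
          then have pn: "int p dvd n" by (rule ppow)
          have eq5: "a ^ 2 = n * (n ^ 2 - 3 * a * n + 3 * a) - S"
            unfolding S_def by Groebner_Basis.algebra
          have "int p dvd a ^ 2" unfolding eq5 by (intro dvd_diff dvd_mult2[OF pn] S)
          then show False using ppow 3(2) by blast
        qed
        then show ?thesis using hensel[OF p n] by blast
      qed
    qed
  qed
  then show ?thesis unfolding poly_mult using dvd_mult dvd_mult2 by blast
qed

lemma quintic_sextic_root_mod_all:
  assumes a: "a = 1 - 3125 * w ^ 4" and w: "10 dvd w" and nz: "a \<noteq> 0" "w \<noteq> 0" and m: "m > 0"
  shows "\<exists>x. m dvd poly (quintic a (4 * a * w) * sextic a) x"
  using root_mod_all_if_prime_powers[OF quintic_sextic_prime_power_root[OF _ a w nz], of "nat m"] m by simp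

section \<open>Irreducibility\<close>

lemma coeff_algebraic_int_if_roots:
  assumes "\<And>z. z \<in> set zs \<Longrightarrow> algebraic_int (z :: complex)"
  shows "algebraic_int (Polynomial.coeff (\<Prod>z\<leftarrow>zs. [:- z, 1:]) i)"
  using assms
proof (induction zs arbitrary: i)
  case Nil
  then show ?case by (auto simp: coeff_1 intro: int_imp_algebraic_int)
next
  case (Cons z zs)
  let ?p = "\<Prod>z\<leftarrow>zs. [:- z, 1:]"
  have IH: "algebraic_int (Polynomial.coeff ?p j)" for j using Cons by simp
  have "Polynomial.coeff ([:- z, 1:] * ?p) i = (- z) * Polynomial.coeff ?p i + (case i of 0 \<Rightarrow> 0 | Suc j \<Rightarrow> Polynomial.coeff ?p j)"
    by (simp add: coeff_pCons split: nat.split)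
  also have "algebraic_int \<dots>"
    using IH Cons.prems int_imp_algebraic_int[of "0::complex"]
    by (intro algebraic_int_plus_times algebraic_int_minus) (auto split: nat.split)
  finally show ?case by simp
qed

text \<open>Gauss's lemma by way of roots: the roots of the factor are algebraic integers, hence so
  are its coefficients, and a rational algebraic integer is an integer.\<close>

lemma rat_factor_of_monic_int_poly:
  fixes f :: "int poly" and p q :: "rat poly"
  assumes f: "Polynomial.lead_coeff f = 1" and pq: "map_poly of_int f = p * q" and p: "Polynomial.lead_coeff p = 1"
  obtains p' where "p = map_poly of_int p'"
proof -
  define P :: "complex poly" where "P = map_poly of_rat p"
  have cP: "Polynomial.coeff P i = of_rat (Polynomial.coeff p i)" for i by (simp add: P_def coeff_map_poly)
  have dP: "Polynomial.degree P = Polynomial.degree p" by (simp add: P_def degree_map_poly)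
  have fP: "(map_poly of_int f :: complex poly) = P * map_poly of_rat q"
  proof -
    have "(map_poly of_int f :: complex poly) = map_poly of_rat (map_poly of_int f)"
      by (simp add: poly_eq_iff coeff_map_poly)
    also have "\<dots> = P * map_poly of_rat q" unfolding pq P_def 
      by (simp add: poly_eq_iff coeff_map_poly coeff_mult of_rat_sum of_rat_mult)
    finally show ?thesis .
  qed
  obtain zs where zs: "Polynomial.smult (Polynomial.lead_coeff P) (\<Prod>z\<leftarrow>zs. [:- z, 1:]) = P" "length zs = Polynomial.degree P"
    using fundamental_theorem_algebra_factorized[of P] by blast
  have "Polynomial.lead_coeff P = 1" using p by (simp add: cP dP)
  then have P: "P = (\<Prod>z\<leftarrow>zs. [:- z, 1:])" using zs(1) by simp
  have "algebraic_int z" if "z \<in> set zs" for z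
  proof -
    have "poly P z = 0" unfolding P using that by (auto simp: poly_prod_list prod_list_zero_iff)
    then have "poly (map_poly of_int f) z = 0" by (simp add: fP)
    then show ?thesis using f unfolding algebraic_int_altdef_ipoly by blast
  qed
  then have "algebraic_int (Polynomial.coeff P i)" for i
    unfolding P by (rule coeff_algebraic_int_if_roots)
  then have int: "Polynomial.coeff p i \<in> \<int>" for i
  proof -
    assume "\<And>i. algebraic_int (Polynomial.coeff P i)"
    then have "algebraic_int (of_rat (Polynomial.coeff p i) :: complex)" by (simp add: cP)
    then have "(of_rat (Polynomial.coeff p i) :: complex) \<in> \<int>"
      by (rule rational_algebraic_int_is_int) simp
    then obtain n where "(of_rat (Polynomial.coeff p i) :: complex) = of_int n" by (elim Ints_cases)
    then have "(of_rat (Polynomial.coeff p i) :: complex) = of_rat (of_int n)" by simp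
    then show ?thesis by (simp only: of_rat_eq_iff Ints_of_int)
  qed
  have "p = map_poly of_int (map_poly floor p)"
    by (rule poly_eqI) (use int in \<open>simp add: coeff_map_poly\<close>)
  then show thesis by (rule that)
qed

text \<open>After rescaling to monic factors, a rational factorization is an integral one, and one
  of the two factors has at most half the degree.\<close>

lemma irreducible_rat_poly_if:
  fixes f :: "int poly"
  assumes f: "Polynomial.lead_coeff f = 1" and d: "Polynomial.degree f > 0"
    and no: "\<And>p q. f = p * q \<Longrightarrow> Polynomial.lead_coeff p = 1 \<Longrightarrow> Polynomial.lead_coeff q = 1 \<Longrightarrow>
      0 < Polynomial.degree p \<Longrightarrow> 2 * Polynomial.degree p \<le> Polynomial.degree f \<Longrightarrow> False"
  shows "Factorial_Ring.irreducible (map_poly of_int f :: rat poly)"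
proof (rule Factorial_Ring.irreducibleI)
  let ?f = "map_poly of_int f :: rat poly"
  have df: "Polynomial.degree ?f = Polynomial.degree f" by (simp add: degree_map_poly)
  show "?f \<noteq> 0" using d df by fastforce
  show "\<not> ?f dvd 1" using d df by (auto simp: is_unit_iff_degree[OF \<open>?f \<noteq> 0\<close>])
  have key: False if pq: "?f = p * q" and dp: "0 < Polynomial.degree p" and le: "2 * Polynomial.degree p \<le> Polynomial.degree f" for p q
  proof -
    define c where "c = Polynomial.lead_coeff p"
    have p0: "p \<noteq> 0" "q \<noteq> 0" using pq \<open>?f \<noteq> 0\<close> by auto
    have c0: "c \<noteq> 0" using p0 by (simp add: c_def)
    have lead: "c * Polynomial.lead_coeff q = 1"
      using arg_cong[OF pq, of Polynomial.lead_coeff] f by (simp add: Polynomial.lead_coeff_mult c_def coeff_map_poly df)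
    define p1 where "p1 = Polynomial.smult (inverse c) p"
    define q1 where "q1 = Polynomial.smult c q"
    have pq1: "?f = p1 * q1" using pq c0 by (simp add: p1_def q1_def)
    have l: "Polynomial.lead_coeff p1 = 1" "Polynomial.lead_coeff q1 = 1"
      using c0 lead by (simp_all add: p1_def q1_def c_def Polynomial.lead_coeff_smult)
    obtain p' where p': "p1 = map_poly of_int p'" using rat_factor_of_monic_int_poly[OF f pq1 l(1)] .
    obtain q' where q': "q1 = map_poly of_int q'"
      using rat_factor_of_monic_int_poly[OF f pq1[unfolded mult.commute[of p1]] l(2)] .
    have "(map_poly of_int f :: rat poly) = map_poly of_int (p' * q')"
      unfolding pq1 p' q' by (simp add: of_int_poly_hom.hom_mult)
    then have "f = p' * q'" by (simp only: of_int_poly_hom.eq_iff)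
    moreover have "Polynomial.degree p' = Polynomial.degree p"
      using arg_cong[OF p', of Polynomial.degree] c0 by (simp add: p1_def degree_map_poly)
    moreover have "Polynomial.lead_coeff p' = 1" "Polynomial.lead_coeff q' = 1"
      using l unfolding p' q' by (simp_all add: degree_map_poly coeff_map_poly)
    ultimately show False using no dp le by metis
  qed
  show "p dvd 1 \<or> q dvd 1" if pq: "?f = p * q" for p q
  proof (rule ccontr)
    assume nu: "\<not> (p dvd 1 \<or> q dvd 1)"
    have p0: "p \<noteq> 0" "q \<noteq> 0" using pq \<open>?f \<noteq> 0\<close> by auto
    have dp: "0 < Polynomial.degree p" "0 < Polynomial.degree q"
      using nu p0 by (auto simp: is_unit_iff_degree)
    have "Polynomial.degree f = Polynomial.degree p + Polynomial.degree q"
      using df pq p0 by (metis degree_mult_eq)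
    then have "2 * Polynomial.degree p \<le> Polynomial.degree f \<or> 2 * Polynomial.degree q \<le> Polynomial.degree f" by linarith
    then show False using key[OF pq dp(1)] key[OF _ dp(2), of p] pq by (metis mult.commute)
  qed
qed

section \<open>Excluding small factors by residues\<close>

lemma monic_poly_by_degree:
  fixes p :: "int poly"
  assumes "Polynomial.lead_coeff p = 1"
  shows "Polynomial.degree p = 1 \<Longrightarrow> \<exists>c. p = [:c, 1:]"
    "Polynomial.degree p = 2 \<Longrightarrow> \<exists>c d. p = [:c, d, 1:]"
    "Polynomial.degree p = 3 \<Longrightarrow> \<exists>c d e. p = [:c, d, e, 1:]"
    "Polynomial.degree p = 4 \<Longrightarrow> \<exists>c d e f. p = [:c, d, e, f, 1:]"
proof -
  have eq: "p = Poly (map (Polynomial.coeff p) [0..<Suc (Polynomial.degree p)])"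
    by (rule poly_eqI) (auto simp: nth_default_def coeff_eq_0 simp del: upt_Suc)
  show "Polynomial.degree p = 1 \<Longrightarrow> \<exists>c. p = [:c, 1:]"
    using assms by (subst eq) (auto simp: numeral_eq_Suc)
  show "Polynomial.degree p = 2 \<Longrightarrow> \<exists>c d. p = [:c, d, 1:]"
    using assms by (subst eq) (auto simp: numeral_eq_Suc)
  show "Polynomial.degree p = 3 \<Longrightarrow> \<exists>c d e. p = [:c, d, e, 1:]"
    using assms by (subst eq) (auto simp: numeral_eq_Suc)
  show "Polynomial.degree p = 4 \<Longrightarrow> \<exists>c d e f. p = [:c, d, e, f, 1:]"
    using assms by (subst eq) (auto simp: numeral_eq_Suc)
qed

lemma cong_neg: "[x = y] (mod m) \<Longrightarrow> [- x = - y] (mod m :: int)"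
  by (simp add: cong_minus_minus_iff)

lemma cong_mod_self: "[x = x mod m] (mod m :: int)"
  by (simp add: cong_def)

text \<open>These rules replace the variables of an integer polynomial expression by their residues,
  which leaves finitely many cases to evaluate.\<close>

lemmas cong_residue_intros = cong_add cong_diff cong_mult cong_pow cong_neg cong_mod_self cong_refl

lemma mod3_cases: "(n :: int) mod 3 = 0 \<or> n mod 3 = 1 \<or> n mod 3 = 2"
  by presburger

lemma degree_quintic: "Polynomial.degree (quintic a b) = 5" "Polynomial.lead_coeff (quintic a b) = 1"
  by (simp_all add: quintic_def)

lemma degree_sextic: "Polynomial.degree (sextic a) = 6" "Polynomial.lead_coeff (sextic a) = 1"
  by (simp_all add: sextic_def)

text \<open>Modulo 3 the polynomial is x^5 - x - 1, which has no root and no quadratic factor. The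
  cofactor of a quadratic factor is eliminated by comparing coefficients, so that only nine residue
  pairs remain.\<close>

lemma irreducible_quintic:
  assumes a: "a mod 3 = 2" and b: "b mod 3 = 2"
  shows "Factorial_Ring.irreducible (map_poly of_int (quintic a b) :: rat poly)"
proof (rule irreducible_rat_poly_if)
  fix p q assume pq: "quintic a b = p * q" and l: "Polynomial.lead_coeff p = 1" "Polynomial.lead_coeff q = 1"
    and dp: "0 < Polynomial.degree p" "2 * Polynomial.degree p \<le> Polynomial.degree (quintic a b)"
  have "p \<noteq> 0" "q \<noteq> 0" using l by auto
  then have dq: "Polynomial.degree p + Polynomial.degree q = 5"
    using arg_cong[OF pq, of Polynomial.degree] by (simp add: degree_mult_eq degree_quintic)
  consider "Polynomial.degree p = 1" | "Polynomial.degree p = 2"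
    using dp unfolding degree_quintic(1) by linarith
  then show False
  proof cases
    case 1
    then obtain c where c: "p = [:c, 1:]" using monic_poly_by_degree(1)[OF l(1)] by blast
    have "poly (quintic a b) (- c) = 0" unfolding pq c by simp
    then have "((- c) ^ 5 + a * (- c) + b) mod 3 = 0"
      using poly_quintic[of a b "- c"] by (simp add: map_poly_idI)
    moreover have "((- c) ^ 5 + a * (- c) + b) mod 3
        = ((- (c mod 3)) ^ 5 + (a mod 3) * (- (c mod 3)) + b mod 3) mod 3"
      by (fold cong_def) (intro cong_residue_intros)
    ultimately show False using mod3_cases[of c] a b by auto
  next
    case 2
    then obtain c d where c: "p = [:d, c, 1:]" using monic_poly_by_degree(2)[OF l(1)] by blast
    have "Polynomial.degree q = 3" using 2 dq by simp
    then obtain e f g where q: "q = [:g, f, e, 1:]" using monic_poly_by_degree(3)[OF l(2)] by blast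
    have e: "e = - c" "f = c ^ 2 - d" "g = - (c ^ 3) + 2 * c * d"
      and eqs: "a = - (c ^ 4) + 3 * c ^ 2 * d - d ^ 2" "b = - (c ^ 3) * d + 2 * c * d ^ 2"
    proof -
      have "[:b, a, 0, 0, 0, 1:] = [:d, c, 1:] * [:g, f, e, 1:]" using pq unfolding c q quintic_def .
      then have h: "b = d * g" "a = d * f + c * g" "0 = d * e + c * f + g" "0 = d + c * e + f" "0 = c + e" by (simp_all add: algebra_simps)
      show e: "e = - c" using h(5) by simp
      show f: "f = c ^ 2 - d" using h(4) unfolding e by Groebner_Basis.algebra
      show g: "g = - (c ^ 3) + 2 * c * d" using h(3) unfolding e f by Groebner_Basis.algebra
      show "a = - (c ^ 4) + 3 * c ^ 2 * d - d ^ 2" using h(2) unfolding f g by Groebner_Basis.algebra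
      show "b = - (c ^ 3) * d + 2 * c * d ^ 2" using h(1) unfolding g by Groebner_Basis.algebra
    qed
    define c0 d0 where "c0 = c mod 3" and "d0 = d mod 3"
    have "a mod 3 = (- (c0 ^ 4) + 3 * c0 ^ 2 * d0 - d0 ^ 2) mod 3"
      "b mod 3 = (- (c0 ^ 3) * d0 + 2 * c0 * d0 ^ 2) mod 3"
      unfolding eqs c0_def d0_def by (fold cong_def) (intro cong_residue_intros)+
    moreover have "c0 = 0 \<or> c0 = 1 \<or> c0 = 2" "d0 = 0 \<or> d0 = 1 \<or> d0 = 2"
      using mod3_cases unfolding c0_def d0_def by blast+
    ultimately show False using a b by (elim disjE) simp_all
  qed
qed (use degree_quintic[of a b] in simp_all)

text \<open>Modulo 16, where \<open>a\<close> is 1, the sextic is (x - 1)^4 (x^2 + 4x + 5) and still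
  has the root 1, so a higher power of 2 is needed. No residue modulo 256 is a root.\<close>

lemma sextic_no_integer_root:
  assumes a: "a mod 256 = 177"
  shows "poly (sextic a) n \<noteq> 0"
proof
  assume "poly (sextic a) n = 0"
  then have "(n ^ 6 - 5 * a * n ^ 4 + 15 * a ^ 2 * n ^ 2 - 16 * a ^ 2 * n + 5 * a ^ 3) mod 256 = 0"
    using poly_sextic[of a n] by (simp add: map_poly_idI)
  moreover have "(n ^ 6 - 5 * a * n ^ 4 + 15 * a ^ 2 * n ^ 2 - 16 * a ^ 2 * n + 5 * a ^ 3) mod 256
    = ((n mod 256) ^ 6 - 5 * (a mod 256) * (n mod 256) ^ 4 + 15 * (a mod 256) ^ 2 * (n mod 256) ^ 2
       - 16 * (a mod 256) ^ 2 * (n mod 256) + 5 * (a mod 256) ^ 3) mod 256"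
    by (fold cong_def) (intro cong_residue_intros)
  moreover have "n mod 256 \<in> set [0..255]" by simp
  moreover have "\<forall>m\<in>set [0..255 :: int]. (m ^ 6 - 5 * 177 * m ^ 4 + 15 * 177 ^ 2 * m ^ 2 - 16 * 177 ^ 2 * m + 5 * 177 ^ 3) mod 256 \<noteq> 0"
    by code_simp
  ultimately show False using a by metis
qed

text \<open>Modulo 3 there are no factors of degree 2 or 3, but 1 is a root. For the family this is
  forced: the quintic is irreducible modulo 3, so Frobenius acts as a five-cycle and fixes a root of
  the sextic. Linear factors are therefore excluded modulo 256.\<close>

lemma irreducible_sextic:
  assumes a3: "a mod 3 = 2" and a256: "a mod 256 = 177"
  shows "Factorial_Ring.irreducible (map_poly of_int (sextic a) :: rat poly)"
proof (rule irreducible_rat_poly_if)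
  fix p q assume pq: "sextic a = p * q" and l: "Polynomial.lead_coeff p = 1" "Polynomial.lead_coeff q = 1"
    and dp: "0 < Polynomial.degree p" "2 * Polynomial.degree p \<le> Polynomial.degree (sextic a)"
  have "p \<noteq> 0" "q \<noteq> 0" using l by auto
  then have dq: "Polynomial.degree p + Polynomial.degree q = 6"
    using arg_cong[OF pq, of Polynomial.degree] by (simp add: degree_mult_eq degree_sextic)
  consider "Polynomial.degree p = 1" | "Polynomial.degree p = 2" | "Polynomial.degree p = 3"
    using dp unfolding degree_sextic(1) by linarith
  then show False
  proof cases
    case 1
    then obtain c where c: "p = [:c, 1:]" using monic_poly_by_degree(1)[OF l(1)] by blast
    have "poly (sextic a) (- c) = 0" unfolding pq c by simp
    then show False using sextic_no_integer_root[OF a256] by blast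
  next
    case 2
    then obtain b c where c: "p = [:c, b, 1:]" using monic_poly_by_degree(2)[OF l(1)] by blast
    have "Polynomial.degree q = 4" using 2 dq by simp
    then obtain d e f h where q: "q = [:h, f, e, d, 1:]" using monic_poly_by_degree(4)[OF l(2)] by blast
    have "[:5 * a ^ 3, - 16 * a ^ 2, 15 * a ^ 2, 0, - 5 * a, 0, 1:] = [:c, b, 1:] * [:h, f, e, d, 1:]"
      using pq unfolding c q sextic_def .
    then have k: "5 * a ^ 3 = c * h" "- 16 * a ^ 2 = c * f + b * h" "15 * a ^ 2 = c * e + b * f + h"
      "0 = c * d + b * e + f" "- 5 * a = c + b * d + e" "0 = b + d" by (simp_all add: algebra_simps)
    have d: "d = - b" using k(6) by simp
    have e: "e = - 5 * a - c + b ^ 2" using k(5) unfolding d by Groebner_Basis.algebra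
    have f: "f = b * c - b * e" using k(4) unfolding d by Groebner_Basis.algebra
    have h: "h = 15 * a ^ 2 - c * e - b * f" using k(3) by Groebner_Basis.algebra
    define c0 b0 where "c0 = c mod 3" and "b0 = b mod 3"
    have e3: "e mod 3 = (- 5 * (a mod 3) - c0 + b0 ^ 2) mod 3"
      unfolding e c0_def b0_def by (fold cong_def) (intro cong_residue_intros)
    have f3: "f mod 3 = (b0 * c0 - b0 * (e mod 3)) mod 3"
      unfolding f c0_def b0_def by (fold cong_def) (intro cong_residue_intros)
    have h3: "h mod 3 = (15 * (a mod 3) ^ 2 - c0 * (e mod 3) - b0 * (f mod 3)) mod 3"
      unfolding h c0_def b0_def by (fold cong_def) (intro cong_residue_intros)
    have "(5 * a ^ 3) mod 3 = (c0 * (h mod 3)) mod 3" "(- 16 * a ^ 2) mod 3 = (c0 * (f mod 3) + b0 * (h mod 3)) mod 3"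
      unfolding k(1,2) c0_def b0_def by (fold cong_def) (intro cong_residue_intros)+
    moreover have "(5 * a ^ 3) mod 3 = (5 * (a mod 3) ^ 3) mod 3" "(- 16 * a ^ 2) mod 3 = (- 16 * (a mod 3) ^ 2) mod 3"
      by (fold cong_def) (intro cong_residue_intros)+
    moreover have "b0 = 0 \<or> b0 = 1 \<or> b0 = 2" "c0 = 0 \<or> c0 = 1 \<or> c0 = 2"
      using mod3_cases unfolding b0_def c0_def by blast+
    ultimately show False using e3 f3 h3 a3 by (elim disjE) simp_all
  next
    case 3
    then obtain b c d where c: "p = [:d, c, b, 1:]" using monic_poly_by_degree(3)[OF l(1)] by blast
    have "Polynomial.degree q = 3" using 3 dq by simp
    then obtain e f h where q: "q = [:h, f, e, 1:]" using monic_poly_by_degree(3)[OF l(2)] by blast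
    have "[:5 * a ^ 3, - 16 * a ^ 2, 15 * a ^ 2, 0, - 5 * a, 0, 1:] = [:d, c, b, 1:] * [:h, f, e, 1:]"
      using pq unfolding c q sextic_def .
    then have k: "5 * a ^ 3 = d * h" "- 16 * a ^ 2 = d * f + c * h" "15 * a ^ 2 = d * e + c * f + b * h"
      "0 = d + c * e + b * f + h" "- 5 * a = c + b * e + f" "0 = b + e" by (simp_all add: algebra_simps)
    have e: "e = - b" using k(6) by simp
    have f: "f = - 5 * a - c + b ^ 2" using k(5) unfolding e by Groebner_Basis.algebra
    have h: "h = - d - b * f + b * c" using k(4) unfolding e by Groebner_Basis.algebra
    define c0 b0 d0 where "c0 = c mod 3" and "b0 = b mod 3" and "d0 = d mod 3"
    have f3: "f mod 3 = (- 5 * (a mod 3) - c0 + b0 ^ 2) mod 3"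
      unfolding f c0_def b0_def by (fold cong_def) (intro cong_residue_intros)
    have h3: "h mod 3 = (- d0 - b0 * (f mod 3) + b0 * c0) mod 3"
      unfolding h c0_def b0_def d0_def by (fold cong_def) (intro cong_residue_intros)
    have "(5 * a ^ 3) mod 3 = (d0 * (h mod 3)) mod 3" "(- 16 * a ^ 2) mod 3 = (d0 * (f mod 3) + c0 * (h mod 3)) mod 3"
      "(15 * a ^ 2) mod 3 = (d0 * (- b0) + c0 * (f mod 3) + b0 * (h mod 3)) mod 3"
      unfolding k(1-3) e c0_def b0_def d0_def by (fold cong_def) (intro cong_residue_intros)+
    moreover have "(5 * a ^ 3) mod 3 = (5 * (a mod 3) ^ 3) mod 3" "(- 16 * a ^ 2) mod 3 = (- 16 * (a mod 3) ^ 2) mod 3"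
      "(15 * a ^ 2) mod 3 = (15 * (a mod 3) ^ 2) mod 3"
      by (fold cong_def) (intro cong_residue_intros)+
    moreover have "b0 = 0 \<or> b0 = 1 \<or> b0 = 2" "c0 = 0 \<or> c0 = 1 \<or> c0 = 2" "d0 = 0 \<or> d0 = 1 \<or> d0 = 2"
      using mod3_cases unfolding b0_def c0_def d0_def by blast+
    ultimately show False using f3 h3 a3 by (elim disjE) simp_all
  qed
qed (use degree_sextic[of a] in simp_all)

section \<open>The Galois groups of the family\<close>

lemma rat_poly_of_polys_over_Rats:
  assumes "p \<in> polys_over \<rat>"
  obtains p0 :: "rat poly" where "p = map_poly of_rat p0"
proof -
  have "\<forall>i. \<exists>q. Polynomial.coeff p i = of_rat q"
    using assms by (auto simp: polys_over_def elim: Rats_cases)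
  then obtain c where c: "\<And>i. Polynomial.coeff p i = of_rat (c i)" by metis
  define p0 where "p0 = Poly (map c [0..<Suc (Polynomial.degree p)])"
  have "Polynomial.coeff p i = of_rat (Polynomial.coeff p0 i)" for i
  proof (cases "i \<le> Polynomial.degree p")
    case True
    then show ?thesis by (simp add: p0_def nth_default_def c del: upt_Suc)
  next
    case False
    then have "Polynomial.coeff p i = 0" by (simp add: coeff_eq_0)
    then show ?thesis using False by (simp add: p0_def nth_default_def del: upt_Suc)
  qed
  then have "p = map_poly of_rat p0" by (simp add: poly_eq_iff coeff_map_poly)
  then show thesis by (rule that)
qed

lemma map_poly_of_rat_mult:
  "map_poly of_rat (p * q) = (map_poly of_rat p * map_poly of_rat q :: complex poly)"
  by (simp add: poly_eq_iff coeff_map_poly coeff_mult of_rat_sum of_rat_mult)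

lemma map_poly_of_rat_const: "map_poly of_rat [:c:] = [:of_rat c :: complex:]"
  by (simp add: poly_eq_iff coeff_map_poly coeff_pCons split: nat.split)

lemma map_poly_of_rat_eq_iff:
  "(map_poly of_rat p :: complex poly) = map_poly of_rat q \<longleftrightarrow> p = q"
  by (auto simp: poly_eq_iff coeff_map_poly)

lemma map_poly_of_rat_of_int:
  "(map_poly of_rat (map_poly of_int f) :: complex poly) = map_poly of_int f"
  by (simp add: poly_eq_iff coeff_map_poly)

lemma unit_poly_const:
  fixes p :: "rat poly"
  assumes "p dvd 1"
  obtains c where "p = [:c:]" "c \<noteq> 0"
proof -
  have "p \<noteq> 0" using assms by auto
  then have "Polynomial.degree p = 0" using assms is_unit_iff_degree by blast
  then obtain c where "p = [:c:]" by (rule degree_eq_zeroE)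
  then show thesis using that \<open>p \<noteq> 0\<close> by simp
qed

lemma irreducible_dvd_min_poly:
  fixes f :: "int poly"
  assumes irr: "Factorial_Ring.irreducible (map_poly of_int f :: rat poly)"
    and \<alpha>: "poly (map_poly of_int f) \<alpha> = 0" and p: "min_poly_over \<rat> \<alpha> p"
  obtains c where "c \<noteq> 0" "map_poly of_int f = Polynomial.smult c p"
proof -
  have pR: "p \<in> polys_over \<rat>" "p \<noteq> 0" "poly p \<alpha> = 0" using p by (auto simp: min_poly_over_def)
  obtain s where s: "s \<in> polys_over \<rat>" "map_poly of_int f = p * s"
    by (rule min_poly_over_dvd[OF csubfield_Rats p of_int_poly_in_polys_over \<alpha>])
  obtain p0 where p0: "p = map_poly of_rat p0" by (rule rat_poly_of_polys_over_Rats[OF pR(1)])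
  obtain s0 where s0: "s = map_poly of_rat s0" by (rule rat_poly_of_polys_over_Rats[OF s(1)])
  have "(map_poly of_rat (map_poly of_int f) :: complex poly) = map_poly of_rat (p0 * s0)"
    unfolding map_poly_of_rat_of_int map_poly_of_rat_mult p0[symmetric] s0[symmetric] by (rule s(2))
  then have "map_poly of_int f = p0 * s0" by (simp only: map_poly_of_rat_eq_iff)
  then have "p0 dvd 1 \<or> s0 dvd 1" using irr by (rule Factorial_Ring.irreducibleD[rotated])
  moreover have "\<not> p0 dvd 1"
  proof
    assume "p0 dvd 1"
    then obtain c where "p0 = [:c:]" by (rule unit_poly_const)
    then have "p = [:of_rat c:]" unfolding p0 by (simp only: map_poly_of_rat_const)
    then show False using pR by simp
  qed
  ultimately have "s0 dvd 1" by blast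
  then obtain c where c: "s0 = [:c:]" "c \<noteq> 0" by (rule unit_poly_const)
  then have "s = [:of_rat c:]" unfolding s0 by (simp only: map_poly_of_rat_const)
  then show thesis using that[of "of_rat c"] s(2) c(2) by simp
qed

text \<open>By irreducibility the minimal polynomial of \<alpha> is \<open>f\<close> up to a scalar,
  so \<beta> is a possible image of \<alpha>.\<close>

lemma irreducible_roots_conjugate:
  fixes f :: "int poly"
  assumes irr: "Factorial_Ring.irreducible (map_poly of_int f :: rat poly)"
    and \<alpha>: "poly (map_poly of_int f) \<alpha> = 0" and \<beta>: "poly (map_poly of_int f) \<beta> = 0"
  obtains \<sigma> where "galois_aut \<sigma>" "\<sigma> \<alpha> = \<beta>"
proof -
  have "f \<noteq> 0" using irr by auto
  obtain p where p: "min_poly_over \<rat> \<alpha> p"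
    by (rule min_poly_over_exists[OF csubfield_Rats root_of_int_poly_algebraic[OF \<open>f \<noteq> 0\<close> \<alpha>]])
  obtain c where "c \<noteq> 0" "map_poly of_int f = Polynomial.smult c p"
    by (rule irreducible_dvd_min_poly[OF irr \<alpha> p])
  then have "poly p \<beta> = 0" using \<beta> by simp
  moreover have "map_poly (\<lambda>x. x) p = p" by (simp add: map_poly_idI)
  ultimately have "poly (map_poly (\<lambda>x. x) p) \<beta> = 0" by simp
  then obtain F' \<tau> where \<tau>: "embedding F' \<tau>" "\<alpha> \<in> F'" "\<tau> \<alpha> = \<beta>"
    by (rule embedding_extend_simple[OF embedding_id[OF csubfield_Rats] p])
  obtain \<upsilon> where \<upsilon>: "galois_aut \<upsilon>" "\<And>x. x \<in> F' \<Longrightarrow> \<upsilon> x = \<tau> x"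
    by (rule embedding_extends_to_galois_aut[OF \<tau>(1)]) blast
  show thesis using that[OF \<upsilon>(1)] \<upsilon>(2)[OF \<tau>(2)] \<tau>(3) by simp
qed

text \<open>Separability by Galois descent: the product of X - z over the distinct roots z is
  invariant under all automorphisms, hence rational, so its degree is at least that of the minimal
  polynomial of a root.\<close>

lemma irreducible_card_roots:
  fixes f :: "int poly"
  assumes irr: "Factorial_Ring.irreducible (map_poly of_int f :: rat poly)" and d: "Polynomial.degree f > 0"
  shows "card {z :: complex. poly (map_poly of_int f) z = 0} = Polynomial.degree f"
proof -
  let ?f = "map_poly of_int f :: complex poly"
  let ?Z = "{z. poly ?f z = 0}"
  have f0: "?f \<noteq> 0" "f \<noteq> 0" using irr by auto
  have fin: "finite ?Z" using f0(1) by (rule poly_roots_finite)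
  have df: "Polynomial.degree ?f = Polynomial.degree f" by (simp add: degree_map_poly)
  have "\<not> constant (poly ?f)" using d by (simp add: constant_degree df)
  then obtain \<alpha> where \<alpha>: "poly ?f \<alpha> = 0" using fundamental_theorem_of_algebra by blast
  have alg: "algebraic z" if "z \<in> ?Z" for z using root_of_int_poly_algebraic[OF f0(2)] that by simp
  define q where "q = (\<Prod>z\<in>?Z. [:- z, 1:])"
  have q0: "q \<noteq> 0" using fin by (simp add: q_def)
  have dq: "Polynomial.degree q = card ?Z"
    unfolding q_def by (subst degree_prod_eq_sum_degree) auto
  have q\<alpha>: "poly q \<alpha> = 0" using \<alpha> fin by (auto simp: q_def poly_prod)
  have qA: "q \<in> polys_over {x. algebraic x}"
    unfolding q_def using alg csubfieldD(1,2,5)[OF csubfield_algebraic]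
    by (intro polys_over_prod[OF csubfield_algebraic]) (auto simp: polys_over_simps[OF csubfield_algebraic])
  have inv: "map_poly \<sigma> q = q" if s: "galois_aut \<sigma>" for \<sigma>
  proof -
    note e = s[unfolded galois_aut_def]
    have lin: "map_poly \<sigma> [:- z, 1:] = [:- \<sigma> z, 1:]" if "algebraic z" for z
      using that embeddingD(2,3)[OF e] embeddingD(6)[OF e, of z]
      by (simp add: poly_eq_iff coeff_map_embedding[OF e] coeff_pCons split: nat.split)
    have "map_poly \<sigma> q = (\<Prod>z\<in>?Z. map_poly \<sigma> [:- z, 1:])"
      unfolding q_def using alg csubfieldD(1,2,5)[OF csubfield_algebraic]
      by (intro map_poly_embedding_prod[OF e]) (auto simp: polys_over_simps[OF csubfield_algebraic])
    also have "\<dots> = (\<Prod>z\<in>?Z. [:- \<sigma> z, 1:])" by (rule prod.cong[OF refl]) (rule lin[OF alg])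
    also have "\<dots> = (\<Prod>z\<in>\<sigma> ` ?Z. [:- z, 1:])"
    proof -
      have "inj_on \<sigma> ?Z" using galois_aut_inj[OF s] alg by (intro inj_onI) blast
      then show ?thesis by (simp add: prod.reindex)
    qed
    also have "\<sigma> ` ?Z = ?Z"
    proof (rule endo_inj_surj[OF fin])
      show "\<sigma> ` ?Z \<subseteq> ?Z" using galois_aut_root[OF s of_int_poly_in_polys_over f0(1)] by blast
      show "inj_on \<sigma> ?Z" using galois_aut_inj[OF s] alg by (intro inj_onI) blast
    qed
    finally show ?thesis by (simp add: q_def)
  qed
  have "q \<in> polys_over \<rat>"
    unfolding polys_over_def
  proof (intro CollectI allI, rule rational_if_fixed)
    fix i
    show "algebraic (Polynomial.coeff q i)" using qA by (simp add: polys_over_def)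
    show "\<sigma> (Polynomial.coeff q i) = Polynomial.coeff q i" if "galois_aut \<sigma>" for \<sigma>
      using coeff_map_embedding[OF that[unfolded galois_aut_def], of q i] inv[OF that] by simp
  qed
  moreover obtain p where p: "min_poly_over \<rat> \<alpha> p"
    by (rule min_poly_over_exists[OF csubfield_Rats root_of_int_poly_algebraic[OF f0(2) \<alpha>]])
  ultimately have "Polynomial.degree p \<le> Polynomial.degree q"
    using q0 q\<alpha> by (simp add: min_poly_over_def)
  moreover obtain c where "c \<noteq> 0" "?f = Polynomial.smult c p"
    by (rule irreducible_dvd_min_poly[OF irr \<alpha> p])
  then have "Polynomial.degree p = Polynomial.degree f" using df by (metis degree_smult_eq)
  ultimately have "Polynomial.degree f \<le> card ?Z" using dq by simp
  moreover have "card ?Z \<le> Polynomial.degree f" using card_poly_roots_bound[OF f0(1)] df by simp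
  ultimately show ?thesis by simp
qed

text \<open>Orbit and stabilizer: the group acts transitively on the roots of \<open>f\<close>,
  whose number is the degree of \<open>f\<close>.\<close>

lemma irreducible_degree_dvd_order:
  fixes f :: "int poly"
  assumes irr: "Factorial_Ring.irreducible (map_poly of_int f :: rat poly)" and d: "Polynomial.degree f > 0"
    and K: "normal_field K" and \<alpha>: "\<alpha> \<in> K" "poly (map_poly of_int f) \<alpha> = 0"
  shows "Polynomial.degree f dvd card (carrier (galois_group K))"
proof -
  let ?G = "galois_group K"
  let ?Z = "{z. poly (map_poly of_int f) z = (0 :: complex)}"
  interpret G: group ?G by (rule galois_group_is_group[OF K])
  have f0: "map_poly of_int f \<noteq> (0 :: complex poly)" using irr by auto
  have ZK: "z \<in> K" if zZ: "z \<in> ?Z" for z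
  proof -
    obtain \<sigma> where "galois_aut \<sigma>" "\<sigma> \<alpha> = z"
      using irreducible_roots_conjugate[OF irr \<alpha>(2)] zZ by blast
    then show ?thesis using normal_fieldD(3)[OF K _ \<alpha>(1)] by blast
  qed
  have fin: "finite ?Z" by (rule poly_roots_finite[OF f0])
  define \<phi> where "\<phi> g = restrict g ?Z" for g :: "complex \<Rightarrow> complex"
  have inj: "inj_on \<sigma> ?Z" if "galois_aut \<sigma>" for \<sigma>
    using galois_aut_inj[OF that] ZK normal_fieldD(2)[OF K] by (intro inj_onI) blast
  have im: "\<sigma> ` ?Z \<subseteq> ?Z" if "galois_aut \<sigma>" for \<sigma>
    using galois_aut_root[OF that of_int_poly_in_polys_over f0] by blast
  have \<phi>: "\<phi> (restrict \<sigma> K) = restrict \<sigma> ?Z" for \<sigma>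
    unfolding \<phi>_def using ZK by (intro ext) (auto simp: restrict_def)
  have bij: "restrict \<sigma> ?Z \<in> Bij ?Z" if "galois_aut \<sigma>" for \<sigma>
    unfolding Bij_def using endo_inj_surj[OF fin im[OF that] inj[OF that]] inj[OF that]
    by (simp add: bij_betw_def inj_on_restrict_eq)
  have "group_hom ?G (BijGroup ?Z) \<phi>"
  proof (unfold group_hom_def group_hom_axioms_def, intro conjI G.is_group group_BijGroup homI)
    show "\<phi> x \<in> carrier (BijGroup ?Z)" if "x \<in> carrier ?G" for x
      using that bij \<phi> unfolding galois_group_carrier[OF K] by (auto simp: BijGroup_def)
    show "\<phi> (x \<otimes>\<^bsub>?G\<^esub> y) = \<phi> x \<otimes>\<^bsub>BijGroup ?Z\<^esub> \<phi> y" if xy: "x \<in> carrier ?G" "y \<in> carrier ?G" for x y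
    proof -
      obtain \<sigma> \<tau> where e: "galois_aut \<sigma>" "x = restrict \<sigma> K" "galois_aut \<tau>" "y = restrict \<tau> K"
        using xy unfolding galois_group_carrier[OF K] by blast
      have "restrict \<sigma> ?Z \<otimes>\<^bsub>BijGroup ?Z\<^esub> restrict \<tau> ?Z = compose ?Z (restrict \<sigma> ?Z) (restrict \<tau> ?Z)"
        using bij[OF e(1)] bij[OF e(3)] by (simp add: BijGroup_def)
      also have "\<dots> = restrict (\<lambda>x. \<sigma> (\<tau> x)) ?Z"
        using im[OF e(3)] by (intro ext) (auto simp: compose_def restrict_def)
      finally show ?thesis unfolding e(2,4) galois_group_mult[OF K e(1,3)] \<phi> by simp
    qed
  qed
  then have "group_action ?G ?Z \<phi>" by (simp add: group_action_def)
  then interpret A: group_action ?G ?Z \<phi> .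
  have \<alpha>Z: "\<alpha> \<in> ?Z" using \<alpha>(2) by simp
  have "orbit ?G \<phi> \<alpha> = ?Z"
  proof
    show "orbit ?G \<phi> \<alpha> \<subseteq> ?Z" using A.element_image[OF _ \<alpha>Z] by (auto simp: orbit_def)
    show "?Z \<subseteq> orbit ?G \<phi> \<alpha>"
    proof
      fix z assume z: "z \<in> ?Z"
      obtain \<sigma> where s: "galois_aut \<sigma>" "\<sigma> \<alpha> = z"
        using irreducible_roots_conjugate[OF irr \<alpha>(2)] z by blast
      then have "restrict \<sigma> K \<in> carrier ?G" unfolding galois_group_carrier[OF K] by blast
      moreover have "\<phi> (restrict \<sigma> K) \<alpha> = z" unfolding \<phi> using s(2) \<alpha>Z by simp
      ultimately show "z \<in> orbit ?G \<phi> \<alpha>" unfolding orbit_def by blast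
    qed
  qed
  then have "card ?Z * card (stabilizer ?G \<phi> \<alpha>) = Coset.order ?G"
    using A.orbit_stabilizer_theorem[OF \<alpha>Z] by simp
  then show ?thesis
    unfolding irreducible_card_roots[OF irr d] by (metis Coset.order_def dvd_triv_left)
qed

section \<open>The family and its splitting fields\<close>

text \<open>The single residue combines three demands: 10 divides \<open>w\<close> (for roots modulo
  powers of 2 and 5), \<open>w\<close> is 1 modulo 3, and \<open>w\<close> is 2 modulo 4 (both for
  irreducibility).\<close>

definition admissible :: "int \<Rightarrow> bool" where
  "admissible w \<longleftrightarrow> w mod 60 = 10"

definition coeff_a :: "int \<Rightarrow> int" where
  "coeff_a w = 1 - 3125 * w ^ 4"

definition quintic_w :: "int \<Rightarrow> int poly" where
  "quintic_w w = quintic (coeff_a w) (4 * coeff_a w * w)"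

definition family_poly :: "int \<Rightarrow> int poly" where
  "family_poly w = quintic_w w * sextic (coeff_a w)"

lemma admissibleD:
  assumes "admissible w"
  shows "w \<noteq> 0" "10 dvd w" "coeff_a w \<noteq> 0" "coeff_a w mod 3 = 2" "4 * coeff_a w * w mod 3 = 2"
    "coeff_a w mod 256 = 177"
proof -
  have w: "w mod 60 = 10" using assms by (simp add: admissible_def)
  show "w \<noteq> 0" using w by auto
  show "10 dvd w" using w by presburger
  have w3: "w mod 3 = 1" using w by presburger
  have "(1 - 3125 * w ^ 4) mod 3 = (1 - 3125 * (w mod 3) ^ 4) mod 3"
    by (fold cong_def) (intro cong_residue_intros)
  then show a3: "coeff_a w mod 3 = 2" by (simp add: coeff_a_def w3)
  then show "coeff_a w \<noteq> 0" by auto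
  have "(4 * coeff_a w * w) mod 3 = (4 * (coeff_a w mod 3) * (w mod 3)) mod 3"
    by (fold cong_def) (intro cong_residue_intros)
  then show "4 * coeff_a w * w mod 3 = 2" by (simp add: a3 w3)
  have "w mod 4 = 2" using w by presburger
  then obtain k where k: "w = 4 * k + 2" by (metis mult_div_mod_eq)
  \<comment> \<open>With w = 2 (2k + 1), the claim is that the fourth power of an odd number is 1
    modulo 16; evenness of 3 k^2 + k provides the last factor 2.\<close>
  have "3 * k ^ 2 + k = 2 * ((3 * k ^ 2 + k) div 2)" by simp
  then obtain m where m: "3 * k ^ 2 + k = 2 * m" by blast
  have "w ^ 4 = 16 * (16 * (k ^ 4 + 2 * k ^ 3 + m) + 1)"
    using m unfolding k by Groebner_Basis.algebra
  then have "coeff_a w = 177 + (- 196 - 3125 * (k ^ 4 + 2 * k ^ 3 + m)) * 256"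
    by (simp add: coeff_a_def)
  then obtain z where "coeff_a w = 177 + z * 256" by blast
  then show "coeff_a w mod 256 = 177" by simp
qed

lemma admissible_roots:
  assumes "admissible w"
  obtains r where "quintic_roots (coeff_a w) (4 * coeff_a w * w) r" "vand5 r = 16 * of_int (coeff_a w) ^ 2"
  using quintic_roots_positive[OF coeff_a_def admissibleD(3,1)[OF assms]] by blast

lemma irreducible_family:
  assumes "admissible w"
  shows "Factorial_Ring.irreducible (map_poly of_int (quintic_w w) :: rat poly)"
    "Factorial_Ring.irreducible (map_poly of_int (sextic (coeff_a w)) :: rat poly)"
  unfolding quintic_w_def using admissibleD[OF assms] by (auto intro: irreducible_quintic irreducible_sextic)

lemma family_poly_monic: "Polynomial.lead_coeff (family_poly w) = 1"
  unfolding family_poly_def quintic_w_def Polynomial.lead_coeff_mult degree_quintic(2) degree_sextic(2) by simp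

text \<open>The sextic contributes nothing new: one of its roots is a polynomial in the roots of the
  quintic, and the others are conjugates of it, hence lie in the same normal field.\<close>

lemma splitting_field_family:
  assumes w: "admissible w" and r: "quintic_roots (coeff_a w) (4 * coeff_a w * w) r"
    and V: "vand5 r = 16 * of_int (coeff_a w) ^ 2"
  shows "splitting_field (family_poly w) = generate_field CC (r ` {1..5})"
    "normal_field (generate_field CC (r ` {1..5}))"
    "cyc_sum (r 1) (r 2) (r 3) (r 4) (r 5) \<in> generate_field CC (r ` {1..5})"
proof -
  let ?L = "generate_field CC (r ` {1..5})"
  let ?a = "coeff_a w"
  have rL: "r i \<in> ?L" if "i \<in> {1..5}" for i using subset_generate_field that by blast
  have root: "poly (map_poly of_int (quintic_w w)) z = 0 \<longleftrightarrow> z \<in> r ` {1..5}" for z :: complex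
    unfolding quintic_w_def quintic_root_iff(2)[OF r] by blast
  have ne: "quintic_w w \<noteq> 0" "map_poly of_int (quintic_w w) \<noteq> (0 :: complex poly)"
    using degree_quintic(1) by (auto simp: quintic_w_def dest: arg_cong[of _ _ Polynomial.degree])
  show N: "normal_field ?L"
  proof (rule normal_field_generate)
    show "algebraic x" if "x \<in> r ` {1..5}" for x
      by (rule root_of_int_poly_algebraic[OF ne(1)]) (use that in \<open>simp only: root\<close>)
    show "\<sigma> x \<in> ?L" if "galois_aut \<sigma>" "x \<in> r ` {1..5}" for \<sigma> x
    proof -
      have "poly (map_poly of_int (quintic_w w)) x = 0" using that(2) by (simp only: root)
      then have "poly (map_poly of_int (quintic_w w)) (\<sigma> x) = 0"
        by (rule galois_aut_root[OF that(1) of_int_poly_in_polys_over ne(2)])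
      then have "\<sigma> x \<in> r ` {1..5}" by (simp only: root)
      then show ?thesis using rL by (elim imageE) simp
    qed
  qed
  have one5: "1 \<in> {1..5::nat}" "2 \<in> {1..5::nat}" "3 \<in> {1..5::nat}" "4 \<in> {1..5::nat}" "5 \<in> {1..5::nat}"
    by auto
  show \<phi>L: "cyc_sum (r 1) (r 2) (r 3) (r 4) (r 5) \<in> ?L"
    unfolding cyc_sum_def by (intro csubfieldD(3,4)[OF csubfield_generate] rL one5)
  have "poly (map_poly of_int (sextic ?a)) (cyc_sum (r 1) (r 2) (r 3) (r 4) (r 5)) = 0"
    by (rule sextic_root[OF r V])
  note conj = irreducible_roots_conjugate[OF irreducible_family(2)[OF w] this]
  have sub: "{z. poly (map_poly of_int (family_poly w)) z = 0} \<subseteq> ?L"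
  proof
    fix z :: complex assume "z \<in> {z. poly (map_poly of_int (family_poly w)) z = 0}"
    then have "poly (map_poly of_int (quintic_w w)) z = 0 \<or> poly (map_poly of_int (sextic ?a)) z = 0"
      by (simp add: family_poly_def of_int_poly_hom.hom_mult)
    then show "z \<in> ?L"
    proof
      assume "poly (map_poly of_int (quintic_w w)) z = 0"
      then have "z \<in> r ` {1..5}" by (simp only: root)
      then show ?thesis using rL by (elim imageE) simp
    next
      assume "poly (map_poly of_int (sextic ?a)) z = 0"
      then obtain \<sigma> where "galois_aut \<sigma>" "\<sigma> (cyc_sum (r 1) (r 2) (r 3) (r 4) (r 5)) = z"
        using conj by blast
      then show ?thesis using normal_fieldD(3)[OF N _ \<phi>L] by blast
    qed
  qed
  have sup: "r ` {1..5} \<subseteq> splitting_field (family_poly w)"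
  proof
    fix z assume "z \<in> r ` {1..5}"
    then have "poly (map_poly of_int (quintic_w w)) z = 0" by (simp only: root)
    then have "poly (map_poly of_int (family_poly w)) z = 0"
      by (simp add: family_poly_def of_int_poly_hom.hom_mult)
    then show "z \<in> splitting_field (family_poly w)"
      unfolding splitting_field_def by (intro subsetD[OF subset_generate_field]) simp
  qed
  show "splitting_field (family_poly w) = ?L"
  proof
    show "splitting_field (family_poly w) \<subseteq> ?L"
      unfolding splitting_field_def by (rule generate_field_least[OF csubfield_generate sub])
    show "?L \<subseteq> splitting_field (family_poly w)"
      by (rule generate_field_least[OF _ sup]) (simp add: splitting_field_def csubfield_generate)
  qed
qed

text \<open>The action on root indices embeds the Galois group into A5: it is faithful because the
  roots generate, and even because \<open>vand5 r\<close> is a nonzero integer and is therefore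
  fixed. The degrees 5 and 6 of the two irreducible factors make the order divisible by 30.\<close>

lemma A5_field_family:
  assumes w: "admissible w"
  shows "A5_field (splitting_field (family_poly w))"
proof -
  obtain r where r: "quintic_roots (coeff_a w) (4 * coeff_a w * w) r" and V: "vand5 r = 16 * of_int (coeff_a w) ^ 2"
    by (rule admissible_roots[OF w])
  define K where "K = generate_field CC (r ` {1..5})"
  have KS: "splitting_field (family_poly w) = K" and N: "normal_field K"
    and \<phi>K: "cyc_sum (r 1) (r 2) (r 3) (r 4) (r 5) \<in> K"
    using splitting_field_family[OF w r V] by (simp_all add: K_def)
  let ?G = "galois_group K"
  interpret G: group ?G by (rule galois_group_is_group[OF N])
  have one5: "1 \<in> {1..5::nat}" "2 \<in> {1..5::nat}" "3 \<in> {1..5::nat}" "4 \<in> {1..5::nat}" "5 \<in> {1..5::nat}"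
    by auto
  have rK: "r i \<in> K" if "i \<in> {1..5}" for i unfolding K_def using subset_generate_field that by blast
  have root: "poly (map_poly of_int (quintic_w w)) z = 0 \<longleftrightarrow> (\<exists>i\<in>{1..5}. z = r i)" for z :: complex
    unfolding quintic_w_def quintic_root_iff(2)[OF r] by blast
  have ne: "map_poly of_int (quintic_w w) \<noteq> (0 :: complex poly)"
    using degree_quintic(1) by (auto simp: quintic_w_def dest: arg_cong[of _ _ Polynomial.degree])
  have V0: "vand5 r \<noteq> 0" using V admissibleD(3)[OF w] by simp
  have rinj: "i = j" if "i \<in> {1..5}" "j \<in> {1..5}" "r i = r j" for i j
    using vand5_nonzero_distinct[OF V0] that by blast
  \<comment> \<open>The index of the image root is unique since the roots are distinct; outside
    {1..5} the identity is prescribed, as \<open>permutes\<close> demands.\<close>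
  define \<pi> where "\<pi> f i = (if i \<in> {1..5} then THE j. j \<in> {1..5} \<and> r j = f (r i) else i)" for f i
  have \<pi>: "\<pi> \<sigma> i \<in> {1..5}" "r (\<pi> \<sigma> i) = \<sigma> (r i)" if s: "galois_aut \<sigma>" and i: "i \<in> {1..5}" for \<sigma> i
  proof -
    have "poly (map_poly of_int (quintic_w w)) (\<sigma> (r i)) = 0"
      using galois_aut_root[OF s of_int_poly_in_polys_over ne, of "r i"] root i by blast
    then obtain j where j: "j \<in> {1..5}" "\<sigma> (r i) = r j" using root by blast
    have "(THE j. j \<in> {1..5} \<and> r j = \<sigma> (r i)) = j"
      by (rule the_equality) (use j rinj in auto)
    then have "\<pi> \<sigma> i = j" using i by (simp add: \<pi>_def)
    then show "\<pi> \<sigma> i \<in> {1..5}" "r (\<pi> \<sigma> i) = \<sigma> (r i)" using j by auto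
  qed
  have \<pi>_restrict: "\<pi> (restrict \<sigma> K) = \<pi> \<sigma>" for \<sigma>
    using rK by (intro ext) (simp add: \<pi>_def)
  have perm: "\<pi> \<sigma> permutes {1..5}" if s: "galois_aut \<sigma>" for \<sigma>
  proof (rule bij_imp_permutes)
    have "inj_on (\<pi> \<sigma>) {1..5}"
    proof (rule inj_onI)
      fix i j assume ij: "i \<in> {1..5}" "j \<in> {1..5}" "\<pi> \<sigma> i = \<pi> \<sigma> j"
      then have "\<sigma> (r i) = \<sigma> (r j)" using \<pi>(2)[OF s] by metis
      then have "r i = r j" using galois_aut_inj[OF s] normal_fieldD(2)[OF N] rK ij by blast
      then show "i = j" using rinj ij by blast
    qed
    then show "bij_betw (\<pi> \<sigma>) {1..5} {1..5}"
      using \<pi>(1)[OF s] by (simp add: bij_betw_def endo_inj_surj image_subset_iff)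
    show "\<pi> \<sigma> x = x" if "x \<notin> {1..5}" for x unfolding \<pi>_def by (rule if_not_P[OF that])
  qed
  have alt: "\<pi> \<sigma> \<in> carrier (alt_group 5)" if s: "galois_aut \<sigma>" for \<sigma>
  proof -
    have e: "embedding K \<sigma>" by (rule galois_aut_embedding[OF s]) (use normal_fieldD[OF N] in auto)
    have "\<sigma> (vand5 r) = vand5 (r \<circ> \<pi> \<sigma>)"
      unfolding vand_def comp_apply
      by (simp add: embeddingD[OF e] csubfieldD[OF normal_fieldD(1)[OF N]] rK \<pi>(2)[OF s])
    also have "\<dots> = of_int (sign (\<pi> \<sigma>)) * vand5 r" by (rule vand5_permute[OF perm[OF s]])
    also have "\<sigma> (vand5 r) = vand5 r" unfolding V using embedding_of_int[OF e, of "16 * coeff_a w ^ 2"] by simp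
    finally have "sign (\<pi> \<sigma>) = 1" using V0 by simp
    then have "evenperm (\<pi> \<sigma>)" by (simp add: sign_def split: if_splits)
    then show ?thesis using perm[OF s] by (simp add: alt_group_carrier)
  qed
  have hom: "group_hom ?G (alt_group 5) \<pi>"
  proof (unfold group_hom_def group_hom_axioms_def, intro conjI G.is_group alt_group_is_group homI)
    show "\<pi> x \<in> carrier (alt_group 5)" if "x \<in> carrier ?G" for x
      using that alt \<pi>_restrict unfolding galois_group_carrier[OF N] by auto
    show "\<pi> (x \<otimes>\<^bsub>?G\<^esub> y) = \<pi> x \<otimes>\<^bsub>alt_group 5\<^esub> \<pi> y" if xy: "x \<in> carrier ?G" "y \<in> carrier ?G" for x y
    proof -
      obtain \<sigma> \<tau> where e: "galois_aut \<sigma>" "x = restrict \<sigma> K" "galois_aut \<tau>" "y = restrict \<tau> K"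
        using xy unfolding galois_group_carrier[OF N] by blast
      have c: "galois_aut (\<lambda>x. \<sigma> (\<tau> x))" by (rule galois_aut_comp[OF e(1,3)])
      have "\<pi> (\<lambda>x. \<sigma> (\<tau> x)) i = \<pi> \<sigma> (\<pi> \<tau> i)" for i
      proof (cases "i \<in> {1..5}")
        case True
        have "r (\<pi> (\<lambda>x. \<sigma> (\<tau> x)) i) = r (\<pi> \<sigma> (\<pi> \<tau> i))"
          unfolding \<pi>(2)[OF c True] \<pi>(2)[OF e(1) \<pi>(1)[OF e(3) True]] \<pi>(2)[OF e(3) True] ..
        then show ?thesis using rinj \<pi>(1)[OF c True] \<pi>(1)[OF e(1) \<pi>(1)[OF e(3) True]] by blast
      next
        case False
        then show ?thesis unfolding \<pi>_def by (simp only: if_False)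
      qed
      then show ?thesis unfolding e(2,4) galois_group_mult[OF N e(1,3)] \<pi>_restrict alt_group_mult by (simp add: fun_eq_iff)
    qed
  qed
  have inj: "inj_on \<pi> (carrier ?G)"
  proof (rule inj_onI)
    fix x y assume xy: "x \<in> carrier ?G" "y \<in> carrier ?G" "\<pi> x = \<pi> y"
    obtain \<sigma> \<tau> where e: "galois_aut \<sigma>" "x = restrict \<sigma> K" "galois_aut \<tau>" "y = restrict \<tau> K"
      using xy(1,2) unfolding galois_group_carrier[OF N] by blast
    have "\<pi> \<sigma> = \<pi> \<tau>" using xy(3) unfolding e(2,4) \<pi>_restrict .
    then have "\<sigma> z = \<tau> z" if "z \<in> r ` {1..5}" for z
      using that \<pi>(2)[OF e(1)] \<pi>(2)[OF e(3)] by force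
    then have "\<sigma> z = \<tau> z" if "z \<in> K" for z
      using galois_aut_eq_on_generate[OF e(1,3), of "r ` {1..5}" z] that rK normal_fieldD(2)[OF N]
      unfolding K_def[symmetric] by blast
    then show "x = y" unfolding e(2,4) by (rule restrict_ext)
  qed
  have sub: "subgroup (\<pi> ` carrier ?G) (alt_group 5)" by (rule group_hom.img_is_subgroup[OF hom])
  have "5 dvd card (carrier ?G)"
  proof -
    have "poly (map_poly of_int (quintic_w w)) (r 1) = 0" using root one5(1) by blast
    then show ?thesis
      using irreducible_degree_dvd_order[OF irreducible_family(1)[OF w] _ N rK[OF one5(1)]]
      by (simp add: quintic_w_def degree_quintic(1))
  qed
  moreover have "6 dvd card (carrier ?G)"
    using irreducible_degree_dvd_order[OF irreducible_family(2)[OF w] _ N \<phi>K sextic_root[OF r V]]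
    by (simp add: degree_sextic(1))
  ultimately have "30 dvd card (carrier ?G)" by presburger
  then have "30 dvd card (\<pi> ` carrier ?G)" using card_image[OF inj] by simp
  then have "\<pi> ` carrier ?G = carrier (alt_group 5)" by (rule subgroup_alt_group_5_full[OF sub])
  then have "\<pi> \<in> iso ?G (alt_group 5)"
    using inj group_hom.homh[OF hom] by (simp add: iso_def bij_betw_def)
  then have "?G \<cong> alt_group 5" unfolding is_iso_def by blast
  then show ?thesis unfolding KS A5_field_def using N by blast
qed

lemma optimally_intersective_family:
  assumes w: "admissible w"
  shows "optimally_intersective (alt_group 5) (family_poly w)"
proof -
  let ?ps = "[map_poly of_int (quintic_w w), map_poly of_int (sextic (coeff_a w))] :: rat poly list"
  have no_root: "poly (map_poly of_int f) q \<noteq> 0"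
    if "Factorial_Ring.irreducible (map_poly of_int f :: rat poly)" "Polynomial.degree f > 1" for f and q :: rat
  proof
    assume "poly (map_poly of_int f) q = 0"
    then obtain g where g: "map_poly of_int f = [:- q, 1:] * g" by (auto simp: poly_eq_0_iff_dvd)
    then have "[:- q, 1:] dvd 1 \<or> g dvd 1" using that(1) by (rule Factorial_Ring.irreducibleD[rotated])
    moreover have "\<not> [:- q, 1:] dvd 1"
    proof
      assume "[:- q, 1:] dvd 1"
      then obtain c where "[:- q, 1:] = [:c:]" by (rule unit_poly_const)
      then show False by simp
    qed
    ultimately have "g dvd 1" by blast
    then obtain c where c: "g = [:c:]" "c \<noteq> 0" by (rule unit_poly_const)
    have "Polynomial.degree (map_poly of_int f :: rat poly) = 1" unfolding g c(1) using c(2) by simp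
    then show False using that(2) by (simp add: degree_map_poly)
  qed
  have "intersective (family_poly w)"
    unfolding intersective_def
  proof (intro conjI allI impI)
    show "Polynomial.lead_coeff (family_poly w) = 1" by (rule family_poly_monic)
    show "\<exists>x. m dvd poly (family_poly w) x" if "m > 0" for m
      unfolding family_poly_def quintic_w_def
      by (rule quintic_sextic_root_mod_all[OF coeff_a_def admissibleD(2,3,1)[OF w] that])
    show "\<not> (\<exists>q :: rat. poly (map_poly of_int (family_poly w)) q = 0)"
    proof
      assume "\<exists>q :: rat. poly (map_poly of_int (family_poly w)) q = 0"
      then obtain q :: rat where "poly (map_poly of_int (quintic_w w)) q = 0 \<or> poly (map_poly of_int (sextic (coeff_a w))) q = 0"
        by (auto simp: family_poly_def of_int_poly_hom.hom_mult)
      then show False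
        using no_root[OF irreducible_family(1)[OF w]] no_root[OF irreducible_family(2)[OF w]]
        by (auto simp: degree_sextic quintic_w_def degree_quintic)
    qed
  qed
  moreover have "length ?ps = covering_number (alt_group 5)"
    unfolding covering_number_alt_group_5 by simp
  moreover have "\<forall>p\<in>set ?ps. Factorial_Ring.irreducible p" using irreducible_family[OF w] by simp
  moreover have "prod_list ?ps = map_poly of_int (family_poly w)"
    by (simp add: family_poly_def of_int_poly_hom.hom_mult)
  moreover have "galois_group (splitting_field (family_poly w)) \<cong> alt_group 5"
    using A5_field_family[OF w] by (simp add: A5_field_def)
  ultimately show ?thesis unfolding optimally_intersective_def by blast
qed

lemma optimally_intersective_realization_family:
  assumes w: "admissible w"
  shows "optimally_intersective_realization (alt_group 5) (splitting_field (family_poly w))"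
proof -
  have f0: "family_poly w \<noteq> 0" using family_poly_monic[of w] by auto
  have N: "normal_field (splitting_field (family_poly w))" by (rule normal_field_splitting_field[OF f0])
  have "finite_galois_extension (splitting_field (family_poly w))"
    unfolding splitting_field_def
  proof (rule finite_galois_extension_generate)
    show "finite {z :: complex. poly (map_poly of_int (family_poly w)) z = 0}"
      using f0 by (intro poly_roots_finite) simp
    show "algebraic x" if "x \<in> {z. poly (map_poly of_int (family_poly w)) z = 0}" for x :: complex
      using root_of_int_poly_algebraic[OF f0] that by simp
  qed (use N in \<open>simp add: splitting_field_def\<close>)
  then show ?thesis
    unfolding optimally_intersective_realization_def
    using optimally_intersective_family[OF w] A5_field_family[OF w] by (auto simp: A5_field_def)
qed

section \<open>Ramification and infinitude of the family\<close>

lemma pairs_vand: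
  "(\<Prod>i\<in>{1..5}. \<Prod>j\<in>{1..5} - {i}. r i - r j) = vand5 r ^ 2"
proof -
  have s: "{1..5::nat} - {1} = {2, 3, 4, 5}" "{1..5::nat} - {2} = {1, 3, 4, 5}"
    "{1..5::nat} - {3} = {1, 2, 4, 5}" "{1..5::nat} - {4} = {1, 2, 3, 5}" "{1..5::nat} - {5} = {1, 2, 3, 4}"
    by auto
  show ?thesis
    unfolding prod_1_5 s vand_square_eq_prod by (simp add: mult.assoc del: One_nat_def)
qed

text \<open>A prime not dividing the discriminant is unramified: the trace form of the maximal order is
  nondegenerate modulo such a prime, so nothing outside \<open>p\<close> times the integers is nilpotent modulo \<open>p\<close>.\<close>

lemma unramified_reduced:
  fixes p :: nat
  assumes p: "Factorial_Ring.prime p" and K: "normal_field K" and fin: "finite (carrier (galois_group K))"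
    and gen: "K = generate_field CC (r ` {1..5})"
    and ri: "\<And>i. i \<in> {1..5} \<Longrightarrow> algebraic_int (r i)"
    and perm: "\<And>\<sigma> i. galois_aut \<sigma> \<Longrightarrow> i \<in> {1..5} \<Longrightarrow> \<sigma> (r i) \<in> r ` {1..5}"
    and V: "vand5 r = of_int N" "\<not> int p dvd N"
    and x: "x \<in> K" "algebraic_int x" "x ^ p \<in> multiples p"
  shows "x \<in> multiples p"
proof -
  let ?G = "carrier (galois_group K)"
  have I: "alg_ideal (multiples p)" by (rule alg_ideal_multiples)
  have pI: "of_nat p \<in> multiples p"
    unfolding multiples_def using int_imp_algebraic_int[of "1::complex"] by (intro CollectI exI[of _ 1]) simp
  have pp: "Factorial_Ring.prime (int p)" using p by simp
  have p0: "(of_nat p :: complex) \<noteq> 0" using prime_gt_0_nat[OF p] by simp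
  have KF: "csubfield K" by (rule normal_fieldD(1)[OF K])
  have G: "embedding K f" "f ` K \<subseteq> K" "\<And>y. y \<in> K \<Longrightarrow> algebraic_int y \<Longrightarrow> algebraic_int (f y)" if fG: "f \<in> ?G" for f
  proof -
    obtain \<sigma> where s: "galois_aut \<sigma>" "f = restrict \<sigma> K" using fG unfolding galois_group_carrier[OF K] by blast
    have "embedding K \<sigma>" by (rule galois_aut_embedding[OF s(1) KF]) (use normal_fieldD(2)[OF K] in blast)
    then show "embedding K f" by (rule embedding_cong) (simp add: s(2))
    show "f ` K \<subseteq> K" using normal_fieldD(3)[OF K s(1)] by (auto simp: s(2))
    show "algebraic_int (f y)" if "y \<in> K" "algebraic_int y" for y
      using galois_aut_algebraic_int[OF s(1) that(2)] that(1) by (simp add: s(2))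
  qed
  have rK: "r i \<in> K" if "i \<in> {1..5}" for i unfolding gen using subset_generate_field that by blast
  \<comment> \<open>\<open>S\<close> collects the elements nilpotent modulo \<open>p\<close>.
    \<open>U\<close> collects the weights on the Galois group whose weighted sums of conjugates are
    divisible by \<open>p\<close> on all of \<open>S\<close>; the aim is a weight in
    \<open>U\<close> supported at the identity.\<close>
  define S where "S = {y \<in> K. algebraic_int y \<and> y ^ p \<in> multiples p}"
  define U where "U = {u. (\<forall>f\<in>?G. algebraic_int (u f)) \<and> (\<forall>y\<in>S. (\<Sum>f\<in>?G. f y * u f) \<in> multiples p)}"
  have one_U: "(\<lambda>f. 1) \<in> U"
    unfolding U_def
  proof (intro CollectI conjI ballI)
    show "algebraic_int (1 :: complex)" by (rule int_imp_algebraic_int) simp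
    fix y assume y: "y \<in> S"
    then have yK: "y \<in> K" "algebraic_int y" "y ^ p \<in> multiples p" by (auto simp: S_def)
    define s where "s = (\<Sum>f\<in>?G. f y)"
    have s_int: "algebraic_int s" unfolding s_def by (rule algebraic_int_sum) (rule G(3)[OF _ yK(1,2)])
    have sK: "s \<in> K" unfolding s_def using G(2) yK(1) by (intro csubfield_sum[OF KF]) blast
    have "s \<in> \<rat>"
    proof -
      interpret Gr: group "galois_group K" by (rule galois_group_is_group[OF K])
      have "g s = s" if g: "g \<in> ?G" for g
      proof -
        have "g s = (\<Sum>f\<in>?G. g (f y))"
          unfolding s_def using G(2) yK(1) by (intro embedding_sum[OF G(1)[OF g]]) blast
        also have "\<dots> = (\<Sum>f\<in>?G. (g \<otimes>\<^bsub>galois_group K\<^esub> f) y)"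
        proof (rule sum.cong[OF refl])
          fix f assume f: "f \<in> ?G"
          obtain \<sigma> \<tau> where e: "galois_aut \<sigma>" "g = restrict \<sigma> K" "galois_aut \<tau>" "f = restrict \<tau> K"
            using f g unfolding galois_group_carrier[OF K] by blast
          show "g (f y) = (g \<otimes>\<^bsub>galois_group K\<^esub> f) y"
            unfolding e(2,4) galois_group_mult[OF K e(1,3)] using yK(1) normal_fieldD(3)[OF K e(3)] by simp
        qed
        also have "\<dots> = (\<Sum>f\<in>(\<lambda>f. g \<otimes>\<^bsub>galois_group K\<^esub> f) ` ?G. f y)"
          using Gr.inj_on_cmult[OF g] by (simp add: sum.reindex)
        also have "(\<lambda>f. g \<otimes>\<^bsub>galois_group K\<^esub> f) ` ?G = ?G" by (rule Gr.surj_const_mult[OF g])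
        finally show ?thesis by (simp add: s_def)
      qed
      then have "s \<in> {x \<in> K. \<forall>\<sigma> \<in> ?G. \<sigma> x = x}" using sK by blast
      then show ?thesis unfolding galois_group_fixed_field[OF K] .
    qed
    then have "s \<in> \<int>" using s_int rational_algebraic_int_is_int by blast
    then obtain n where n: "s = of_int n" by (elim Ints_cases)
    \<comment> \<open>Frobenius on the trace: its p-th power is congruent to the sum of the p-th
      powers of the conjugates, all divisible by \<open>p\<close>, so \<open>p\<close> divides the
      integral trace itself.\<close>
    have "cong_ideal (multiples p) (s ^ p) (\<Sum>f\<in>?G. f y ^ p)"
      unfolding s_def by (rule frobenius_sum[OF p I pI]) (rule G(3)[OF _ yK(1,2)])
    moreover have "(\<Sum>f\<in>?G. f y ^ p) \<in> multiples p"
    proof (rule alg_ideal_sum[OF I])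
      fix f assume f: "f \<in> ?G"
      obtain z where z: "y ^ p = of_nat p * z" "algebraic_int z" using yK(3) by (auto simp: multiples_def)
      have "z = y ^ p / of_nat p" using z(1) p0 by simp
      moreover have "(of_nat p :: complex) \<in> K" using csubfield_of_int[OF KF, of "int p"] by simp
      ultimately have zK: "z \<in> K" using csubfieldD(8)[OF KF csubfield_power[OF KF yK(1)]] by simp
      have "f y ^ p = f (of_nat p * z)" unfolding z(1)[symmetric] by (rule embedding_power[OF G(1)[OF f] yK(1), symmetric])
      also have "\<dots> = of_nat p * f z"
        using embeddingD(5)[OF G(1)[OF f] _ zK, of "of_nat p"] embedding_of_int[OF G(1)[OF f], of "int p"]
          csubfield_of_int[OF KF, of "int p"] by simp
      finally show "f y ^ p \<in> multiples p" using G(3)[OF f zK z(2)] by (auto simp: multiples_def)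
    qed
    ultimately have "(s ^ p - (\<Sum>f\<in>?G. f y ^ p)) + (\<Sum>f\<in>?G. f y ^ p) \<in> multiples p"
      by (intro alg_idealD(3)[OF I]) (simp_all add: cong_ideal_def)
    then have "of_int (n ^ p) \<in> multiples p" by (simp add: n)
    then obtain z :: complex where z: "of_int (n ^ p) = of_nat p * z" "algebraic_int z"
      unfolding multiples_def by blast
    have "of_int (int p) * z = of_int (n ^ p)" unfolding z(1) by simp
    from of_int_multiple_not_unit[OF z(2) this] have "int p dvd n ^ p" .
    then have "int p dvd n" by (rule prime_dvd_power[OF pp])
    then obtain k where "n = int p * k" by (elim dvdE)
    then have "s = of_nat p * of_int k" by (simp add: n)
    then have "s \<in> multiples p" unfolding multiples_def using algebraic_int_of_int by blast
    then show "(\<Sum>f\<in>?G. f y * 1) \<in> multiples p" by (simp add: s_def)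
  qed
  \<comment> \<open>Since \<open>S\<close> is stable under multiplication by integral elements c of
    \<open>K\<close>, weights in \<open>U\<close> may be multiplied by
    \<open>f c - d\<close>.\<close>
  have mult_U: "(\<lambda>f. (f c - d) * u f) \<in> U"
    if u: "u \<in> U" and c: "c \<in> K" "algebraic_int c" and d: "algebraic_int d" for u c d
    unfolding U_def
  proof (intro CollectI conjI ballI)
    have ui: "algebraic_int (u f)" if "f \<in> ?G" for f using u that by (simp add: U_def)
    show "algebraic_int ((f c - d) * u f)" if f: "f \<in> ?G" for f
      by (intro algebraic_int_plus_times(2) algebraic_int_diff G(3)[OF f c] d ui f)
    fix y assume y: "y \<in> S"
    have "c * y \<in> S"
      using y c csubfieldD(4)[OF KF] alg_idealD(4)[OF I, of "y ^ p" "c ^ p"]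
      by (simp add: S_def power_mult_distrib algebraic_int_plus_times algebraic_int_power)
    then have "(\<Sum>f\<in>?G. f (c * y) * u f) - d * (\<Sum>f\<in>?G. f y * u f) \<in> multiples p"
      using u y by (intro alg_idealD(4,7)[OF I] d) (auto simp: U_def)
    moreover have hom: "f (c * y) = f c * f y" if "f \<in> ?G" for f
      using embeddingD(5)[OF G(1)[OF that] c(1), of y] y by (simp add: S_def)
    have "(\<Sum>f\<in>?G. f y * ((f c - d) * u f)) = (\<Sum>f\<in>?G. f (c * y) * u f) - d * (\<Sum>f\<in>?G. f y * u f)"
      unfolding sum_distrib_left sum_subtractf[symmetric]
      by (rule sum.cong) (simp_all add: hom algebra_simps)
    ultimately show "(\<Sum>f\<in>?G. f y * ((f c - d) * u f)) \<in> multiples p" by simp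
  qed
  have prod_U: "(\<lambda>f. \<Prod>j\<in>B. f (r i) - r j) \<in> U \<and> (\<forall>u\<in>U. (\<lambda>f. (\<Prod>j\<in>B. f (r i) - r j) * u f) \<in> U)"
    if "finite B" "B \<subseteq> {1..5}" and i: "i \<in> {1..5}" for B i
    using that(1,2)
  proof (induction B rule: finite_induct)
    case empty
    then show ?case using one_U by simp
  next
    case (insert b B)
    have b: "b \<in> {1..5}" and B: "B \<subseteq> {1..5}" using insert.prems by auto
    have "(\<lambda>f. (f (r i) - r b) * ((\<Prod>j\<in>B. f (r i) - r j) * u f)) \<in> U" if "u \<in> U" for u
      by (rule mult_U) (use insert.IH[OF B] that rK[OF i] ri[OF i] ri[OF b] in auto)
    moreover have "(\<lambda>f. (f (r i) - r b) * (\<Prod>j\<in>B. f (r i) - r j)) \<in> U"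
      by (rule mult_U) (use insert.IH[OF B] rK[OF i] ri[OF i] ri[OF b] in auto)
    ultimately show ?case using insert.hyps by (simp add: mult.assoc)
  qed
  have "(\<lambda>f. \<Prod>i\<in>A. \<Prod>j\<in>{1..5} - {i}. f (r i) - r j) \<in> U" if "finite A" "A \<subseteq> {1..5}" for A
    using that
  proof (induction A rule: finite_induct)
    case empty
    then show ?case using one_U by simp
  next
    case (insert a A)
    then have "(\<lambda>f. \<Prod>i\<in>A. \<Prod>j\<in>{1..5} - {i}. f (r i) - r j) \<in> U" by simp
    then have "(\<lambda>f. (\<Prod>j\<in>{1..5} - {a}. f (r a) - r j) * (\<Prod>i\<in>A. \<Prod>j\<in>{1..5} - {i}. f (r i) - r j)) \<in> U"
      using prod_U[of "{1..5} - {a}" a] insert.prems by auto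
    then show ?case using insert.hyps by simp
  qed
  then have U: "(\<lambda>f. \<Prod>i\<in>{1..5}. \<Prod>j\<in>{1..5} - {i}. f (r i) - r j) \<in> U" by blast
  define e where "e = restrict (\<lambda>x. x) K"
  have eG: "e \<in> ?G" unfolding galois_group_carrier[OF K] e_def using galois_aut_id by blast
  \<comment> \<open>A nontrivial automorphism moves some root r_i to another root r_j, which kills
    one factor. At the identity the weight is the discriminant, so the weighted sum is
    \<open>x\<close> times an integer prime to \<open>p\<close>.\<close>
  have zero: "(\<Prod>i\<in>{1..5}. \<Prod>j\<in>{1..5} - {i}. f (r i) - r j) = 0" if f: "f \<in> ?G" "f \<noteq> e" for f
  proof -
    obtain \<sigma> where s: "galois_aut \<sigma>" "f = restrict \<sigma> K" using f(1) unfolding galois_group_carrier[OF K] by blast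
    have "\<exists>i\<in>{1..5}. \<sigma> (r i) \<noteq> r i"
    proof (rule ccontr)
      assume "\<not> (\<exists>i\<in>{1..5}. \<sigma> (r i) \<noteq> r i)"
      then have "\<sigma> y = y" if "y \<in> K" for y
        using galois_aut_eq_on_generate[OF s(1) galois_aut_id, of "r ` {1..5}" y] that rK normal_fieldD(2)[OF K]
        unfolding gen[symmetric] by blast
      then have "f = e" unfolding s(2) e_def by (rule restrict_ext)
      then show False using f(2) by blast
    qed
    then obtain i where i: "i \<in> {1..5}" "\<sigma> (r i) \<noteq> r i" by blast
    obtain j where j: "j \<in> {1..5}" "\<sigma> (r i) = r j" using perm[OF s(1) i(1)] by blast
    then have "j \<in> {1..5} - {i}" "f (r i) - r j = 0" using i rK by (auto simp: s(2))
    then have "(\<Prod>j\<in>{1..5} - {i}. f (r i) - r j) = 0" by (intro prod_zero) auto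
    then show ?thesis using i(1) by (intro prod_zero) auto
  qed
  have xS: "x \<in> S" using x by (simp add: S_def)
  have "(\<Sum>f\<in>?G. f x * (\<Prod>i\<in>{1..5}. \<Prod>j\<in>{1..5} - {i}. f (r i) - r j)) \<in> multiples p"
    using U xS by (simp add: U_def)
  also have "(\<Sum>f\<in>?G. f x * (\<Prod>i\<in>{1..5}. \<Prod>j\<in>{1..5} - {i}. f (r i) - r j))
      = (\<Sum>f\<in>{e}. f x * (\<Prod>i\<in>{1..5}. \<Prod>j\<in>{1..5} - {i}. f (r i) - r j))"
    using eG zero by (intro sum.mono_neutral_right fin) auto
  also have "\<dots> = x * (\<Prod>i\<in>{1..5}. \<Prod>j\<in>{1..5} - {i}. r i - r j)"
    using x(1) rK by (simp add: e_def)
  also have "\<dots> = x * of_int (N ^ 2)" unfolding pairs_vand V(1) by simp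
  finally have xN: "x * of_int (N ^ 2) \<in> multiples p" .
  have "\<not> int p dvd N ^ 2" using prime_dvd_power[OF pp] V(2) by blast
  then have "coprime (int p) (N ^ 2)" using prime_imp_coprime[OF pp] by blast
  then obtain u v where "u * int p + v * N ^ 2 = 1" by (metis bezout_int coprime_iff_gcd_eq_1)
  then have "of_int (u * int p + v * N ^ 2) = (1 :: complex)" by simp
  then have "x = of_int u * x * of_nat p + of_int v * (x * of_int (N ^ 2))"
    by (simp add: algebra_simps flip: distrib_left)
  also have "\<dots> \<in> multiples p"
    by (intro alg_idealD(3,4)[OF I] algebraic_int_plus_times(2) algebraic_int_of_int pI xN x(2))
  finally show ?thesis .
qed

text \<open>If the fields agreed, \<open>p\<close> would be unramified by the second description,
  whose discriminant is prime to \<open>p\<close>. But in the first a root \<alpha> satisfies an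
  Eisenstein-like relation: \<alpha>^5 is divisible by \<open>p\<close>, so \<alpha> would be, and
  then \<open>p\<close> would divide 4 w k, where k = a / p is prime to \<open>p\<close>.\<close>

lemma distinct_family_fields:
  fixes p :: nat
  assumes w: "admissible w" and w': "admissible w'" and p: "Factorial_Ring.prime p" "\<not> int p dvd 30"
    and pa: "int p dvd coeff_a w" "\<not> int p ^ 2 dvd coeff_a w" and pa': "\<not> int p dvd coeff_a w'"
  shows "splitting_field (family_poly w) \<noteq> splitting_field (family_poly w')"
proof
  assume eq: "splitting_field (family_poly w) = splitting_field (family_poly w')"
  have pp: "Factorial_Ring.prime (int p)" using p(1) by simp
  note pm = prime_dvd_mult_iff[OF pp]
  obtain r where r: "quintic_roots (coeff_a w) (4 * coeff_a w * w) r" and V: "vand5 r = 16 * of_int (coeff_a w) ^ 2"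
    by (rule admissible_roots[OF w])
  obtain s where s: "quintic_roots (coeff_a w') (4 * coeff_a w' * w') s" and V': "vand5 s = 16 * of_int (coeff_a w') ^ 2"
    by (rule admissible_roots[OF w'])
  define K where "K = splitting_field (family_poly w)"
  have Kr: "K = generate_field CC (r ` {1..5})" unfolding K_def by (rule splitting_field_family(1)[OF w r V])
  have Ks: "K = generate_field CC (s ` {1..5})" unfolding K_def eq by (rule splitting_field_family(1)[OF w' s V'])
  have A5: "A5_field K" unfolding K_def by (rule A5_field_family[OF w])
  then have N: "normal_field K" by (simp add: A5_field_def)
  have p2: "\<not> int p dvd 2"
  proof
    assume "int p dvd 2"
    then have "int p dvd 2 * 15" by (rule dvd_mult2)
    then show False using p(2) by simp
  qed
  have pn: "p \<noteq> 2" "p \<noteq> 3" using p(2) by auto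
  \<comment> \<open>The exponent \<open>p\<close> has to be at least 5, so that \<alpha>^p contains
    the factor \<alpha>^5.\<close>
  have p5: "p \<ge> 5"
  proof -
    have "p \<noteq> 4" using p(1) by (auto simp: prime_nat_iff intro: exI[of _ "2::nat"] dest: spec[of _ "2::nat"])
    then show ?thesis using pn prime_gt_1_nat[OF p(1)] by linarith
  qed
  have ne: "map_poly of_int (quintic_w w') \<noteq> (0 :: complex poly)"
    using degree_quintic(1) by (auto simp: quintic_w_def dest: arg_cong[of _ _ Polynomial.degree])
  have reduced: "x \<in> multiples p" if "x \<in> K" "algebraic_int x" "x ^ p \<in> multiples p" for x
  proof (rule unramified_reduced[OF p(1) N A5_field_card(2)[OF A5] Ks _ _ _ _ that])
    show "algebraic_int (s i)" if "i \<in> {1..5}" for i by (rule quintic_roots_algebraic_int[OF s that])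
    show "\<sigma> (s i) \<in> s ` {1..5}" if "galois_aut \<sigma>" "i \<in> {1..5}" for \<sigma> i
      using galois_aut_root[OF that(1) of_int_poly_in_polys_over ne, of "s i"] quintic_root_iff(2)[OF s] that(2)
      unfolding quintic_w_def by blast
    show "vand5 s = of_int (16 * coeff_a w' ^ 2)" using V' by simp
    show "\<not> int p dvd 16 * coeff_a w' ^ 2"
    proof
      assume "int p dvd 16 * coeff_a w' ^ 2"
      then have "int p dvd 2 ^ 4 \<or> int p dvd coeff_a w' ^ 2" using pm by simp
      then show False using prime_dvd_power[OF pp] p2 pa' by blast
    qed
  qed
  obtain k where k: "coeff_a w = int p * k" using pa(1) by (elim dvdE)
  have pk: "\<not> int p dvd k" using pa(2) k by (auto simp: power2_eq_square)
  let ?\<alpha> = "r 1" and ?p = "of_nat p :: complex" and ?w = "of_int w :: complex" and ?k = "of_int k :: complex"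
  have "?\<alpha> ^ 5 + of_int (coeff_a w) * ?\<alpha> + of_int (4 * coeff_a w * w) = 0"
    using quintic_root_iff(2)[OF r, of ?\<alpha>] by (auto simp: poly_quintic)
  then have \<alpha>5: "?\<alpha> ^ 5 = - (?p * ?k * (?\<alpha> + 4 * ?w))"
    unfolding k by (simp add: algebra_simps eq_neg_iff_add_eq_0)
  have \<alpha>i: "algebraic_int ?\<alpha>" by (rule quintic_roots_algebraic_int[OF r]) simp
  have \<alpha>K: "?\<alpha> \<in> K" unfolding Kr using subset_generate_field by force
  have i4w: "algebraic_int (4 * ?w)" using algebraic_int_of_int[of "4 * w"] by simp
  have "?\<alpha> ^ p = ?p * (- (?k * (?\<alpha> + 4 * ?w)) * ?\<alpha> ^ (p - 5))"
  proof -
    have "?\<alpha> ^ p = ?\<alpha> ^ 5 * ?\<alpha> ^ (p - 5)" using p5 by (simp flip: power_add)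
    then show ?thesis unfolding \<alpha>5 by (simp add: algebra_simps)
  qed
  moreover have "algebraic_int (- (?k * (?\<alpha> + 4 * ?w)) * ?\<alpha> ^ (p - 5))"
    by (intro algebraic_int_plus_times algebraic_int_minus algebraic_int_power algebraic_int_of_int \<alpha>i i4w)
  ultimately have "?\<alpha> ^ p \<in> multiples p" unfolding multiples_def by blast
  then have "?\<alpha> \<in> multiples p" by (rule reduced[OF \<alpha>K \<alpha>i])
  then obtain \<beta> where \<beta>: "?\<alpha> = ?p * \<beta>" "algebraic_int \<beta>" by (auto simp: multiples_def)
  have p0: "?p \<noteq> 0" using p5 by simp
  \<comment> \<open>Substituting \<alpha> = p \<beta> and cancelling one \<open>p\<close> leaves 4 w
    k as the only term not visibly divisible by \<open>p\<close>.\<close>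
  have "?p * (?p ^ 4 * \<beta> ^ 5 + ?k * (?p * \<beta> + 4 * ?w)) = 0"
    using \<alpha>5 unfolding \<beta>(1) by (simp add: power_mult_distrib algebra_simps numeral_eq_Suc)
  then have "?p ^ 4 * \<beta> ^ 5 + ?k * (?p * \<beta> + 4 * ?w) = 0" using p0 by simp
  moreover have "of_int (4 * w * k) = 4 * ?w * ?k" "of_int (int p) = ?p" by simp_all
  ultimately have "of_int (int p) * (- (?p ^ 3 * \<beta> ^ 5) - ?k * \<beta>) = of_int (4 * w * k)"
    by Groebner_Basis.algebra
  moreover have "algebraic_int (- (?p ^ 3 * \<beta> ^ 5) - ?k * \<beta>)"
    using algebraic_int_of_int[of "int p"]
    by (intro algebraic_int_diff algebraic_int_minus algebraic_int_plus_times algebraic_int_power \<beta>(2) algebraic_int_of_int) simp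
  ultimately have "int p dvd 4 * w * k" using of_int_multiple_not_unit by blast
  then have "int p dvd 2 * 2 * w \<or> int p dvd k" using pm by simp
  then have "int p dvd w" using p2 pk pm by blast
  then have "int p dvd 3125 * w ^ 4" by (simp add: dvd_mult power_eq_if)
  then have "int p dvd coeff_a w + 3125 * w ^ 4" using pa(1) by (rule dvd_add[rotated])
  then have "int p dvd 1" by (simp add: coeff_a_def)
  then show False using pp not_prime_unit by blast
qed

text \<open>Euclid's argument: a prime dividing 1 - 3125 w^4 cannot divide \<open>w\<close>, so
  making \<open>w\<close> a multiple of \<open>A\<close> yields a prime not dividing
  \<open>A\<close>. If its square also divides the value, a shift of \<open>w\<close> restores exact
  divisibility.\<close>

lemma admissible_new_prime:
  fixes A :: int
  assumes A: "A \<noteq> 0" "odd A" "\<not> 3 dvd A"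
  obtains w and p :: nat where "admissible w" "Factorial_Ring.prime p" "\<not> int p dvd 30" "\<not> int p dvd A"
    "int p dvd coeff_a w" "\<not> int p ^ 2 dvd coeff_a w"
proof -
  \<comment> \<open>As \<open>A\<close> is prime to 6, its square is 1 modulo 6, so ten times the
    square is 10 modulo 60.\<close>
  define w0 where "w0 = 10 * A ^ 2"
  have "A mod 6 = 1 \<or> A mod 6 = 5" using A(2,3) by presburger
  then have "A ^ 2 mod 6 = 1" by (auto simp: power_mod[of A 6 2, symmetric])
  then have w0: "admissible w0" unfolding admissible_def w0_def by presburger
  have "A ^ 2 \<ge> 1" using A(1) by (simp add: int_one_le_iff_zero_less)
  then have "w0 \<ge> 1" by (simp add: w0_def)
  then have "w0 ^ 4 \<ge> 1" by simp
  then have "coeff_a w0 < - 1" by (simp add: coeff_a_def)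
  then have "nat \<bar>coeff_a w0\<bar> \<noteq> 1" by simp
  then obtain p where p: "Factorial_Ring.prime p" "p dvd nat \<bar>coeff_a w0\<bar>" using prime_factor_nat by blast
  have pp: "Factorial_Ring.prime (int p)" using p(1) by simp
  note pm = prime_dvd_mult_iff[OF pp]
  have "int p dvd int (nat \<bar>coeff_a w0\<bar>)" using p(2) by (subst int_dvd_int_iff)
  then have pa: "int p dvd coeff_a w0" by simp
  have pw: "\<not> int p dvd w0"
  proof
    assume "int p dvd w0"
    then have "int p dvd 3125 * w0 ^ 4" by (simp add: dvd_mult power_eq_if)
    then have "int p dvd coeff_a w0 + 3125 * w0 ^ 4" using pa by (rule dvd_add[rotated])
    then have "int p dvd 1" by (simp add: coeff_a_def)
    then show False using pp not_prime_unit by blast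
  qed
  have p10: "\<not> int p dvd 10" "\<not> int p dvd A"
    using pw dvd_mult2[of "int p" 10 "A ^ 2"] dvd_mult[of "int p" "A ^ 2" 10] dvd_power[of 2 A]
    unfolding w0_def by (blast, meson dvd_trans pos2)
  have "p \<noteq> 3"
  proof
    assume "p = 3"
    then have "coeff_a w0 mod 3 = 0" using pa by simp
    then show False using admissibleD(4)[OF w0] by simp
  qed
  have p3: "\<not> int p dvd 3"
  proof
    assume "int p dvd 3"
    then have "int p dvd int 3" by simp
    then have "p dvd 3" by (simp only: int_dvd_int_iff)
    moreover have "Factorial_Ring.prime (3 :: nat)" by simp
    ultimately have "p = 3" using primes_dvd_imp_eq[OF p(1)] by blast
    then show False using \<open>p \<noteq> 3\<close> by simp
  qed
  then have p30: "\<not> int p dvd 30"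
    using p10(1) pm[of 10 3] by simp
  show thesis
  proof (cases "int p ^ 2 dvd coeff_a w0")
    case False
    then show thesis using that[of w0 p] w0 p(1) p30 p10(2) pa by blast
  next
    case True
    \<comment> \<open>A multiple of 60 keeps the residue class, and the factor \<open>p\<close>
      preserves divisibility by \<open>p\<close>. Modulo p^2 only the linear term of the expansion
      changes the value, and \<open>p\<close> divides it exactly once.\<close>
    define t where "t = 60 * A * int p"
    define w where "w = w0 + t"
    have "w mod 60 = w0 mod 60" unfolding w_def t_def by (simp add: mult.assoc)
    then have w: "admissible w" using w0 by (simp add: admissible_def)
    have ca: "coeff_a w = coeff_a w0 - int p * (3125 * (4 * w0 ^ 3 * (60 * A)))
        - int p ^ 2 * (3125 * (60 * A) ^ 2 * (6 * w0 ^ 2 + 4 * w0 * t + t ^ 2))"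
      unfolding coeff_a_def w_def t_def by Groebner_Basis.algebra
    have "int p dvd coeff_a w"
      unfolding ca by (intro dvd_diff pa dvd_triv_left) (simp add: power2_eq_square)
    moreover have "\<not> int p ^ 2 dvd coeff_a w"
    proof
      assume "int p ^ 2 dvd coeff_a w"
      then have "int p ^ 2 dvd coeff_a w0 - int p ^ 2 * (3125 * (60 * A) ^ 2 * (6 * w0 ^ 2 + 4 * w0 * t + t ^ 2)) - coeff_a w"
        using True by (intro dvd_diff) auto
      then have "int p * int p dvd int p * (3125 * (4 * w0 ^ 3 * (60 * A)))" by (simp add: ca power2_eq_square)
      then have "int p dvd 3125 * (4 * w0 ^ 3 * (60 * A))" using pp by (simp add: prime_gt_0_int)
      moreover have "3125 * (4 * w0 ^ 3 * (60 * A)) dvd (10 ^ 5 * w0 ^ 3 * 30 * A)"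
        by (rule dvdI[of _ _ 4]) simp
      ultimately have "int p dvd 10 ^ 5 * w0 ^ 3 * 30 * A" by (rule dvd_trans)
      then have "int p dvd 10 ^ 5 \<or> int p dvd w0 ^ 3 \<or> int p dvd 30 \<or> int p dvd A"
        by (simp only: pm disj_assoc)
      then show False using prime_dvd_power[OF pp] p10 pw p30 by blast
    qed
    ultimately show thesis using that[of w p] w p(1) p30 p10(2) by blast
  qed
qed

text \<open>If finitely many parameters gave all the fields, a new prime exactly dividing some
  \<open>coeff_a w\<close> but none of theirs would ramify in the field of \<open>w\<close> and in
  no listed field.\<close>

lemma infinite_family: "infinite ((\<lambda>w. splitting_field (family_poly w)) ` {w. admissible w})"
proof
  let ?F = "\<lambda>w. splitting_field (family_poly w)"
  assume "finite (?F ` {w. admissible w})"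
  then obtain T where T: "T \<subseteq> {w. admissible w}" "finite T" "?F ` {w. admissible w} = ?F ` T"
    using finite_subset_image[OF _ subset_refl] by metis
  define A where "A = (\<Prod>w\<in>T. coeff_a w)"
  have adm: "admissible w" if "w \<in> T" for w using that T(1) by blast
  have "odd (coeff_a w)" if "w \<in> T" for w
    using admissibleD(2)[OF adm[OF that]] by (auto simp: coeff_a_def dest: dvd_trans[of 2 10])
  then have "odd A" unfolding A_def using T(2) by (simp add: even_prod_iff)
  moreover have "\<not> 3 dvd A"
  proof
    assume "3 dvd A"
    moreover have "Factorial_Ring.prime (3 :: int)" by simp
    ultimately obtain w where "w \<in> T" "3 dvd coeff_a w"
      unfolding A_def using T(2) prime_dvd_prod_iff by blast
    then show False using admissibleD(4)[OF adm] by force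
  qed
  moreover have "A \<noteq> 0" using calculation(1) by auto
  ultimately obtain w and p :: nat where w: "admissible w" "Factorial_Ring.prime p" "\<not> int p dvd 30" "\<not> int p dvd A"
    "int p dvd coeff_a w" "\<not> int p ^ 2 dvd coeff_a w"
    using admissible_new_prime by metis
  then obtain w' where w': "w' \<in> T" "?F w = ?F w'" using T(3) by (metis imageE imageI mem_Collect_eq)
  have "coeff_a w' dvd A" unfolding A_def by (rule dvd_prodI[OF T(2) w'(1)])
  then have "\<not> int p dvd coeff_a w'" using w(4) dvd_trans by blast
  then show False using distinct_family_fields[OF w(1) adm[OF w'(1)] w(2,3,5,6)] w'(2) by blast
qed

theorem theorem4p2:
  shows "\<exists>\<K> :: complex set set. infinite \<K> \<and>
    (\<forall>K\<in>\<K>. optimally_intersective_realization (alt_group 5) K) \<and>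
    linearly_disjoint \<K>"
proof (intro exI conjI ballI)
  let ?\<K> = "(\<lambda>w. splitting_field (family_poly w)) ` {w. admissible w}"
  show "infinite ?\<K>" by (rule infinite_family)
  show "optimally_intersective_realization (alt_group 5) K" if "K \<in> ?\<K>" for K
    using that optimally_intersective_realization_family by blast
  show "linearly_disjoint ?\<K>"
    by (rule linearly_disjoint_A5_fields) (use A5_field_family in blast)
qed

end
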